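(* For the two-dimensional Epstein type sequence $\Lambda=\{n_1^2+n_2^2 : (n_1,n_2)\in\mathbb{N}_0^2\setminus\{(0,0)\}\}$, the expected number of summands of a partition of $n$ satisfies, as $n\to\infty$, $$m_{E_2}(n)=\left(\frac{4n}{\pi\zeta_R(2)}\right)^{\frac12}\left(\mathrm{FP}_{t=1}\zeta_{E_2}(t)-\frac\pi8\log\left(\frac{\pi\zeta_R(2)}{4n}\right)\right)\left[1+O\bigl(n^{-\frac14}\bigr)\right].$$
   Context: The sequence $\Lambda$ is counted with multiplicity: it has one entry for each vector $(n_1,n_2)\in\mathbb{N}_0^2\setminus\{(0,0)\}$. Let $\zeta_{E_2}(s)=\sum_{(n_1,n_2)\in\mathbb{N}_0^2\setminus\{(0,0)\}}(n_1^2+n_2^2)^{-s}$ for $\Re s>1$, also denoting its meromorphic continuation; $\mathrm{FP}_{t=1}\zeta_{E_2}(t)$ is the constant term of its Laurent expansion about $t=1$. $\zeta_R$ is the Riemann zeta-function. Let $p(n,m)$ be the number of partitions of $n$ into $m$ summands from $\Lambda$, with repetition of summands allowed and entries coming from different vectors regarded as different even if numerically equal; that is, $\prod_{\lambda\in\Lambda}(1-zx^\lambda)^{-1}=\sum_{n,m\ge0}p(n,m)x^nz^m$. Then $m_{E_2}(n)=\dfrac{\sum_m m\,p(n,m)}{\sum_m p(n,m)}$. *)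

theory Defs
  imports "HOL-Complex_Analysis.Complex_Analysis" "HOL-Library.Multiset"
    "HOL-Library.Landau_Symbols"
begin

text \<open>
  The sequence is indexed by the vectors themselves, so numerically equal entries that come from
  different vectors remain distinct summands.
\<close>

definition epstein_index :: "(nat \<times> nat) set" where
  "epstein_index = UNIV - {(0, 0)}"

definition epstein_entry :: "nat \<times> nat \<Rightarrow> nat" where
  "epstein_entry v = (fst v)\<^sup>2 + (snd v)\<^sup>2"

definition epstein_partitions :: "nat \<Rightarrow> nat \<Rightarrow> (nat \<times> nat) multiset set" where
  "epstein_partitions n m =
     {M \<in> multisets_of_size epstein_index m. (\<Sum>v\<in>#M. epstein_entry v) = n}"

definition num_partitions :: "nat \<Rightarrow> nat \<Rightarrow> nat" where
  "num_partitions n m = card (epstein_partitions n m)"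

text \<open>
  The facts below show that \<^const>\<open>card\<close> is applied to finite sets only and that the series over
  \<open>m\<close> in the mean have only finitely many nonzero terms.
\<close>

lemma size_le_of_epstein_partition:
  assumes "M \<in> epstein_partitions n m"
  shows "m \<le> n"
proof -
  have "size M \<le> (\<Sum>v\<in>#M. epstein_entry v)" if "set_mset M \<subseteq> epstein_index"
    using that
  proof (induction M)
    case (add v M)
    have "1 \<le> epstein_entry v"
      using add.prems
      by (cases v) (auto simp: epstein_index_def epstein_entry_def Suc_le_eq)
    with add show ?case by auto
  qed simp
  with assms show ?thesis by (auto simp: epstein_partitions_def multisets_of_size_def)
qed

lemma num_partitions_eq_0: "n < m \<Longrightarrow> num_partitions n m = 0"
  using size_le_of_epstein_partition[of _ n m]
  by (auto simp: num_partitions_def card_eq_0_iff)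

lemma finite_epstein_partitions: "finite (epstein_partitions n m)"
proof (rule finite_subset)
  have entry: "a \<le> n \<and> b \<le> n"
    if M: "M \<in> epstein_partitions n m" and v: "(a, b) \<in># M" for M a b
  proof -
    have "epstein_entry (a, b) \<le> n"
      using M v sum_mset.remove[of "epstein_entry (a, b)" "image_mset epstein_entry M"]
      by (auto simp: epstein_partitions_def multisets_of_size_def dest!: multi_member_split)
    moreover have "a \<le> a\<^sup>2" "b \<le> b\<^sup>2"
      by (auto simp: power2_eq_square)
    ultimately show ?thesis by (auto simp: epstein_entry_def)
  qed
  show "epstein_partitions n m \<subseteq> multisets_of_size ({..n} \<times> {..n}) m"
    using entry by (force simp: epstein_partitions_def multisets_of_size_def)
  show "finite (multisets_of_size ({..n} \<times> {..n}) m)"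
    by (rule finite_multisets_of_size) simp
qed

definition expected_summands :: "nat \<Rightarrow> real" where
  "expected_summands n =
     (\<Sum>m. real m * real (num_partitions n m)) / (\<Sum>m. real (num_partitions n m))"

text \<open>
  The meromorphic continuation to the complex plane. The requirement
  \<^const>\<open>nicely_meromorphic_on\<close> fixes the values at poles (to zero) and at removable singularities
  (to the limit), so at most one function satisfies the description.
\<close>

definition epstein_zeta :: "complex \<Rightarrow> complex" where
  "epstein_zeta = (THE f. f nicely_meromorphic_on UNIV \<and>
     (\<forall>s. Re s > 1 \<longrightarrow>
        f s = (\<Sum>\<^sub>\<infinity>v\<in>epstein_index. of_nat (epstein_entry v) powr (- s))))"

definition finite_part :: "(complex \<Rightarrow> complex) \<Rightarrow> complex \<Rightarrow> complex" where
  "finite_part f a = fls_nth (laurent_expansion f a) 0"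

text \<open>Only the Dirichlet series of the Riemann zeta function, i.e. meaningful for \<open>s > 1\<close>.\<close>

definition riemann_zeta :: "real \<Rightarrow> real" where
  "riemann_zeta s = (\<Sum>n. real (Suc n) powr (- s))"

end

theory Submission
  imports Defs "HOL-Probability.Characteristic_Functions"
begin

text \<open>
  Let \<open>p(n)\<close> be the number of partitions of \<open>n\<close>, \<open>T(z) = \<Sum>\<^sub>\<lambda> \<Sum>\<^sub>k z^(k\<lambda>)\<close> and
  \<open>F(z) = \<Sum>\<^sub>n p(n) z^n = exp (\<Sum>\<^sub>\<lambda> \<Sum>\<^sub>k z^(k\<lambda>) / k)\<close>. The total number of summands of the
  partitions of \<open>n\<close> is the coefficient of \<open>T F\<close>. Both coefficients are integrals over the circle of
  radius \<open>exp (- b)\<close>, with \<open>b\<close> the exact solution of the saddle point equation. There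
  \<open>\<bar>T(e^(-b+it)) - T(e^(-b))\<bar> \<le> \<bar>t\<bar> \<bar>T'(e^(-b))\<bar>\<close>, while \<open>F\<close> is concentrated on
  \<open>\<bar>t\<bar> \<lesssim> b^(3/2)\<close>, so replacing \<open>T\<close> by the constant \<open>T(e^(-b))\<close> costs only a relative error
  of order \<open>b^(1/2) \<approx> n^(-1/4)\<close>. In particular \<open>T\<close> and the saddle point equation are needed for
  real arguments only, where they follow from the lattice point count in a quarter disc by partial
  summation; the same partial summation gives the constant term of the zeta function at its pole.
  For the continuation, \<open>\<zeta>\<^sub>E(s)\<close> is written in terms of sums over \<open>\<int>\<^sup>2\<close> and \<open>\<int>\<close> with
  alternating signs, which become entire after repeated differencing.
\<close>

section \<open>Counting partitions\<close>

text \<open>Since only a ratio of two coefficients is wanted, a lower bound of the right order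
  \<open>b^(3/2)\<close> for the coefficient integral of \<open>F\<close> suffices, and the
  numerator is treated through its difference from \<open>T(e^(-b)) p(n)\<close>. With the exact
  saddle point the linear phase cancels against \<open>n\<close> identically. Put
  \<open>L = 1 - ln b\<close>. Then \<open>T'\<close> has order \<open>L / b^2\<close> and the first
  absolute moment of the integrand has order \<open>b^3\<close>, so the deviation of the mean from
  \<open>T(e^(-b))\<close> is \<open>O(L b / b^(3/2)) = O(L / b^(1/2))\<close>, against a main term
  of order \<open>L / b\<close>. The logarithm stands in both and cancels, which is why the final
  relative error carries none. The elementary lattice error \<open>O(n^(1/2))\<close> costs a
  relative \<open>b^(1/2)\<close> in the saddle point equation, which matches this. The alternating
  sums are tied to the plain ones because the vectors of \<open>\<int>^2\<close> with even
  coordinate sum form a copy of \<open>\<int>^2\<close> enlarged by \<open>sqrt 2\<close>. This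
  gives the factor \<open>2 * 2^(-s) - 1\<close>, whose zero at \<open>s = 1\<close> accounts for
  the pole.\<close>

definition index_partitions :: "nat \<Rightarrow> (nat \<times> nat) multiset set" where
  "index_partitions n = {M. set_mset M \<subseteq> epstein_index \<and> (\<Sum>v\<in>#M. epstein_entry v) = n}"

definition npart :: "nat \<Rightarrow> nat" where
  "npart n = card (index_partitions n)"

definition entry_mult :: "nat \<Rightarrow> nat" where
  "entry_mult d = card {v \<in> epstein_index. epstein_entry v = d}"

definition divsum :: "(nat \<Rightarrow> nat) \<Rightarrow> nat \<Rightarrow> nat" where
  "divsum u j = (\<Sum>d | d dvd j. u d)"

text \<open>Every number divides \<open>0\<close>, so the sum over an infinite set defaults to \<open>0\<close>.\<close>

lemma divsum_0 [simp]: "divsum u 0 = 0"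
  by (simp add: divsum_def infinite_UNIV_nat)

lemma epstein_entry_pos: "v \<in> epstein_index \<Longrightarrow> 0 < epstein_entry v"
  by (cases v) (auto simp: epstein_index_def epstein_entry_def)

lemma fst_snd_le_epstein_entry: "fst v \<le> epstein_entry v" "snd v \<le> epstein_entry v"
  by (auto simp: epstein_entry_def power2_eq_square intro: trans_le_add1 trans_le_add2)

lemma finite_entry_le: "finite {v \<in> epstein_index. epstein_entry v \<le> d}"
proof (rule finite_subset)
  show "{v \<in> epstein_index. epstein_entry v \<le> d} \<subseteq> {..d} \<times> {..d}"
  proof
    fix v assume "v \<in> {v \<in> epstein_index. epstein_entry v \<le> d}"
    with fst_snd_le_epstein_entry[of v] have "fst v \<le> d" "snd v \<le> d" by auto
    then show "v \<in> {..d} \<times> {..d}" by (cases v) auto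
  qed
qed simp

lemma finite_entry_eq: "finite {v \<in> epstein_index. epstein_entry v = d}"
  by (rule finite_subset[OF _ finite_entry_le[of d]]) auto

lemma index_partitions_eq: "index_partitions n = (\<Union>m\<le>n. epstein_partitions n m)"
  using size_le_of_epstein_partition
  by (fastforce simp: index_partitions_def epstein_partitions_def multisets_of_size_def)

lemma finite_index_partitions [simp]: "finite (index_partitions n)"
  by (simp add: index_partitions_eq finite_epstein_partitions)

lemma size_epstein_partitions: "M \<in> epstein_partitions n m \<Longrightarrow> size M = m"
  by (simp add: epstein_partitions_def multisets_of_size_def)

lemma sum_index_partitions:
  "(\<Sum>M\<in>index_partitions n. f M) = (\<Sum>m\<le>n. \<Sum>M\<in>epstein_partitions n m. f M)"
  unfolding index_partitions_eq
  by (intro sum.UNION_disjoint)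
     (auto simp: finite_epstein_partitions dest: size_epstein_partitions)

lemma suminf_num_partitions: "(\<Sum>m. real (num_partitions n m)) = real (npart n)"
proof -
  have "(\<Sum>m. real (num_partitions n m)) = (\<Sum>m\<le>n. real (num_partitions n m))"
    by (intro suminf_finite) (auto simp: num_partitions_eq_0)
  also have "\<dots> = real (npart n)"
    by (simp add: npart_def num_partitions_def sum_index_partitions card_eq_sum del: sum_constant)
  finally show ?thesis .
qed

lemma suminf_size_num_partitions:
  "(\<Sum>m. real m * real (num_partitions n m)) = real (\<Sum>M\<in>index_partitions n. size M)"
proof -
  have "(\<Sum>m. real m * real (num_partitions n m)) = (\<Sum>m\<le>n. real m * real (num_partitions n m))"
    by (intro suminf_finite) (auto simp: num_partitions_eq_0)
  also have "\<dots> = real (\<Sum>M\<in>index_partitions n. size M)"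
    by (simp add: num_partitions_def sum_index_partitions size_epstein_partitions mult.commute)
  finally show ?thesis .
qed

definition entry_multiples :: "nat \<Rightarrow> ((nat \<times> nat) \<times> nat) set" where
  "entry_multiples j = {(v, k). v \<in> epstein_index \<and> 1 \<le> k \<and> k * epstein_entry v = j}"

lemma finite_entry_multiples: "0 < j \<Longrightarrow> finite (entry_multiples j)"
proof (rule finite_subset)
  show "entry_multiples j \<subseteq> {v \<in> epstein_index. epstein_entry v \<le> j} \<times> {..j}"
    using epstein_entry_pos by (fastforce simp: entry_multiples_def)
  show "finite ({v \<in> epstein_index. epstein_entry v \<le> j} \<times> {..j})"
    by (simp add: finite_entry_le)
qed

text \<open>A pair \<open>(v, k)\<close> amounts to a divisor \<open>d = epstein_entry v\<close> of
  \<open>j\<close> together with a vector over \<open>d\<close>, because \<open>k = j div d\<close>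
  is then determined.\<close>

lemma sum_entry_multiples:
  assumes "0 < j"
  shows "(\<Sum>(v, k)\<in>entry_multiples j. g (epstein_entry v)) = divsum (\<lambda>d. entry_mult d * g d) j"
proof -
  have "(\<Sum>(v, k)\<in>entry_multiples j. g (epstein_entry v)) =
      (\<Sum>(d, v)\<in>(SIGMA d:{d. d dvd j}. {v \<in> epstein_index. epstein_entry v = d}). g d)"
    using assms epstein_entry_pos
    by (intro sum.reindex_bij_witness[of _ "\<lambda>(d, v). (v, j div d)" "\<lambda>(v, k). (epstein_entry v, v)"])
       (auto simp: entry_multiples_def elim!: dvdE)
  also have "\<dots> = divsum (\<lambda>d. entry_mult d * g d) j"
    using assms by (subst sum.Sigma[symmetric]) (auto simp: divsum_def entry_mult_def
          finite_entry_eq)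
  finally show ?thesis .
qed

lemma count_le_sum_mset: 
  assumes "k \<le> count M v"
  shows "k * f v \<le> (\<Sum>x\<in>#M. f x :: nat)"
proof -
  have "replicate_mset k v \<subseteq># M" 
    using assms by (simp add: count_le_replicate_mset_subset_eq)
  then have "M = replicate_mset k v + (M - replicate_mset k v)" by simp
  then have "(\<Sum>x\<in>#M. f x) = (\<Sum>x\<in>#replicate_mset k v. f x) + (\<Sum>x\<in>#M - replicate_mset k v. f x)"
    by (metis image_mset_union sum_mset.union)
  then show ?thesis by simp
qed

lemma sum_mset_count_sum: "(\<Sum>x\<in>#M. f x :: nat) = (\<Sum>x\<in>set_mset M. count M x * f x)"
proof (induction M)
  case (add x M)
  have "(\<Sum>y\<in>set_mset (add_mset x M). count (add_mset x M) y * f y) =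
      (\<Sum>y\<in>insert x (set_mset M). count M y * f y + (if y = x then f x else 0))"
    by (intro sum.cong) auto
  also have "\<dots> = (\<Sum>y\<in>insert x (set_mset M). count M y * f y) + f x"
    by (simp add: sum.distrib)
  also have "(\<Sum>y\<in>insert x (set_mset M). count M y * f y) = (\<Sum>y\<in>set_mset M. count M y * f y)"
    by (cases "x \<in># M") (auto simp: insert_absorb not_in_iff)
  finally show ?case using add.IH by simp
qed simp

text \<open>Removing \<open>k\<close> copies of \<open>v\<close> from a partition with at least \<open>k\<close> of them is a bijection.\<close>

lemma sum_parts:
  fixes g :: "nat \<times> nat \<Rightarrow> nat"
  shows "(\<Sum>M\<in>index_partitions n. \<Sum>v\<in>#M. g v) =
    (\<Sum>j\<in>{1..n}. (\<Sum>(v, k)\<in>entry_multiples j. g v) * npart (n - j))"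
proof -
  \<comment> \<open>The multiplicity of \<open>v\<close> is spread over marks
    \<open>k = 1, ..., count M v\<close>; the mark tells how many copies the bijection
    removes.\<close>
  have "(\<Sum>M\<in>index_partitions n. \<Sum>v\<in>#M. g v) =
      (\<Sum>M\<in>index_partitions n. \<Sum>v\<in>set_mset M. \<Sum>k\<in>{1..count M v}. g v)"
    by (intro sum.cong refl) (simp add: sum_mset_count_sum)
  also have "\<dots> = (\<Sum>M\<in>index_partitions n. \<Sum>(v, k)\<in>(SIGMA v:set_mset M. {1..count M v}). g v)"
    by (intro sum.cong refl, subst sum.Sigma[symmetric]) auto
  also have "\<dots> = (\<Sum>(M, v, k)\<in>(SIGMA M:index_partitions n. SIGMA v:set_mset M. {1..count M v}). g v)"
    by (subst sum.Sigma) auto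
  also have "\<dots> = (\<Sum>(j, (v, k), M)\<in>(SIGMA j:{1..n}. entry_multiples j \<times> index_partitions (n - j)).
        g v)"
  proof -
    have fwd: "k * epstein_entry v \<in> {1..n} \<and> (v, k) \<in> entry_multiples (k * epstein_entry v) \<and>
        M - replicate_mset k v \<in> index_partitions (n - k * epstein_entry v) \<and>
        M - replicate_mset k v + replicate_mset k v = M"
      if "M \<in> index_partitions n" "v \<in># M" "k \<in> {1..count M v}" for M v k
    proof -
      have M: "set_mset M \<subseteq> epstein_index" "(\<Sum>v\<in>#M. epstein_entry v) = n"
        using that by (auto simp: index_partitions_def)
      have "replicate_mset k v \<subseteq># M"
        using that by (simp add: count_le_replicate_mset_subset_eq)
      then obtain M' where M': "M = replicate_mset k v + M'"
        by (metis subset_mset.less_eqE)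
      have "k * epstein_entry v + (\<Sum>v\<in>#M'. epstein_entry v) = n"
        using M(2) by (simp add: M')
      moreover have "v \<in> epstein_index" using M(1) that(2) by blast
      moreover have "0 < epstein_entry v" using calculation(2) by (rule epstein_entry_pos)
      moreover have "set_mset M' \<subseteq> epstein_index" using M(1) by (auto simp: M')
      ultimately show ?thesis using that(3)
        unfolding M' by (auto simp: entry_multiples_def index_partitions_def)
    qed
    have bwd: "M + replicate_mset k v \<in> index_partitions n \<and> v \<in># M + replicate_mset k v \<and>
        k \<in> {1..count (M + replicate_mset k v) v} \<and> k * epstein_entry v = j"
      if "j \<in> {1..n}" "(v, k) \<in> entry_multiples j" "M \<in> index_partitions (n - j)" for j v k M
      using that by (auto simp: entry_multiples_def index_partitions_def)
    show ?thesis
      by (intro sum.reindex_bij_witness[of _ "\<lambda>(j, (v, k), M). (M + replicate_mset k v, v, k)"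
          "\<lambda>(M, v, k). (k * epstein_entry v, (v, k), M - replicate_mset k v)"])
         (use fwd bwd in \<open>auto simp del: replicate_mset_Suc\<close>)
  qed
  also have "\<dots> = (\<Sum>j\<in>{1..n}. \<Sum>((v, k), M)\<in>entry_multiples j \<times> index_partitions (n - j). g v)"
    by (subst sum.Sigma) (auto simp: finite_entry_multiples)
  also have "\<dots> = (\<Sum>j\<in>{1..n}. (\<Sum>(v, k)\<in>entry_multiples j. g v) * npart (n - j))"
    by (intro sum.cong refl, subst sum.cartesian_product[symmetric])
       (simp add: npart_def split_def sum_distrib_left sum_distrib_right mult.commute)
  finally show ?thesis .
qed

abbreviation part_count :: "nat \<Rightarrow> nat" where
  "part_count \<equiv> divsum entry_mult"

abbreviation part_sum :: "nat \<Rightarrow> nat" where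
  "part_sum \<equiv> divsum (\<lambda>d. d * entry_mult d)"

text \<open>The case \<open>g = epstein_entry\<close> of \<open>sum_parts\<close>: every partition
  of \<open>n\<close> has total weight \<open>n\<close>. This is the coefficient form of the
  logarithmic derivative of \<open>F\<close> and determines \<open>npart\<close>
  recursively.\<close>

lemma npart_rec: "n * npart n = (\<Sum>j\<in>{1..n}. part_sum j * npart (n - j))"
proof -
  have "n * npart n = (\<Sum>M\<in>index_partitions n. \<Sum>v\<in>#M. epstein_entry v)"
    by (simp add: npart_def index_partitions_def)
  also have "\<dots> = (\<Sum>j\<in>{1..n}. part_sum j * npart (n - j))"
    unfolding sum_parts
    using sum_entry_multiples[of _ "\<lambda>d. d"] by (intro sum.cong) (simp_all add: mult.commute)
  finally show ?thesis .
qed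

text \<open>The case \<open>g = 1\<close> of \<open>sum_parts\<close>: the numerator of the mean
  becomes a coefficient of \<open>T F\<close>.\<close>

lemma sum_size_index_partitions:
  "(\<Sum>M\<in>index_partitions n. size M) = (\<Sum>j\<in>{1..n}. part_count j * npart (n - j))"
proof -
  have "(\<Sum>M\<in>index_partitions n. size M) = (\<Sum>M\<in>index_partitions n. \<Sum>v\<in>#M. 1)"
    by (intro sum.cong refl size_eq_sum_mset)
  also have "\<dots> = (\<Sum>j\<in>{1..n}. part_count j * npart (n - j))"
    unfolding sum_parts
    using sum_entry_multiples[of _ "\<lambda>d. 1"] by (intro sum.cong) simp_all
  finally show ?thesis .
qed

lemma npart_0: "npart 0 = 1"
proof -
  have "index_partitions 0 = {{#}}"
  proof (intro equalityI subsetI)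
    fix M assume M: "M \<in> index_partitions 0"
    have "v \<notin># M" for v
    proof
      assume v: "v \<in># M"
      have "1 * epstein_entry v \<le> (\<Sum>x\<in>#M. epstein_entry x)"
        by (rule count_le_sum_mset) (use v in \<open>simp add: Suc_le_eq\<close>)
      with M v epstein_entry_pos[of v] show False by (auto simp: index_partitions_def)
    qed
    then show "M \<in> {{#}}" by (simp add: multiset_eq_iff not_in_iff)
  qed (simp add: index_partitions_def)
  then show ?thesis by (simp add: npart_def)
qed

lemma expected_summands_eq:
  "expected_summands n = (\<Sum>j\<le>n. real (part_count j) * real (npart (n - j))) / real (npart n)"
proof -
  \<comment> \<open>Including \<open>j = 0\<close>, where \<open>divsum\<close> is 0, gives the
    convolution the shape of a Cauchy product.\<close>
  have "(\<Sum>j\<le>n. real (part_count j) * real (npart (n - j))) =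
      (\<Sum>j\<in>{1..n}. real (part_count j) * real (npart (n - j)))"
    by (rule sum.mono_neutral_right) (auto simp: not_less_eq_eq le_Suc_eq)
  then show ?thesis
    unfolding expected_summands_def suminf_num_partitions suminf_size_num_partitions
      sum_size_index_partitions by simp
qed

section \<open>Lattice points in a quarter disc\<close>

definition entry_count :: "nat \<Rightarrow> nat" where
  "entry_count n = (\<Sum>d\<le>n. entry_mult d)"

definition count_error :: "nat \<Rightarrow> real" where
  "count_error n = real (entry_count n) - pi / 4 * real n"

lemma entry_mult_0 [simp]: "entry_mult 0 = 0"
proof -
  have *: "{v \<in> epstein_index. epstein_entry v = 0} = {}" using epstein_entry_pos by fastforce
  show ?thesis unfolding entry_mult_def * by simp
qed

lemma entry_count_eq_card: "entry_count n = card {v \<in> epstein_index. epstein_entry v \<le> n}"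
proof -
  have "{v \<in> epstein_index. epstein_entry v \<le> n} = (\<Union>d\<le>n. {v \<in> epstein_index. epstein_entry v = d})"
    by auto
  also have "card \<dots> = (\<Sum>d\<le>n. card {v \<in> epstein_index. epstein_entry v = d})"
    by (intro card_UN_disjoint) (auto simp: finite_entry_eq)
  finally show ?thesis by (simp add: entry_count_def entry_mult_def)
qed

text \<open>\<open>F\<close> is an antiderivative of the decreasing function
  \<open>sqrt (R^2 - x^2)\<close>, so its increments lie between the endpoint values. The mean value
  theorem is used in the form that asks for a derivative only inside the interval, because
  \<open>arcsin (x / R)\<close> has none at \<open>x = R\<close>.\<close>

lemma quarter_disc_mean_value:
  fixes R x y :: real
  assumes "0 \<le> x" "x \<le> y" "y \<le> R"
  defines "F \<equiv> \<lambda>x. (x * sqrt (R\<^sup>2 - x\<^sup>2) + R\<^sup>2 * arcsin (x / R)) / 2"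
  shows "(y - x) * sqrt (R\<^sup>2 - y\<^sup>2) \<le> F y - F x" "F y - F x \<le> (y - x) * sqrt (R\<^sup>2 - x\<^sup>2)"
proof -
  have "(y - x) * sqrt (R\<^sup>2 - y\<^sup>2) \<le> F y - F x \<and> F y - F x \<le> (y - x) * sqrt (R\<^sup>2 - x\<^sup>2)"
  proof (cases "x = y")
    case False
    with assms have xy: "x < y" and R: "0 < R" by auto
    have cont: "continuous_on {x..y} F"
    proof -
      have "-1 \<le> z / R" "z / R \<le> 1" if "z \<in> {x..y}" for z
        using that assms R by (auto simp: divide_simps)
      then show ?thesis unfolding F_def
        by (intro continuous_intros) (use R in auto)
    qed
    have der: "(F has_real_derivative sqrt (R\<^sup>2 - z\<^sup>2)) (at z)" if z: "x < z" "z < y" for z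
    proof -
      have zR: "0 < z" "z < R" using z assms by auto
      then have pos: "0 < R\<^sup>2 - z\<^sup>2" by (simp add: power_strict_mono)
      have "1 - (z / R)\<^sup>2 = (R\<^sup>2 - z\<^sup>2) / R\<^sup>2" using R by (simp add: field_simps)
      then have s: "sqrt (1 - (z / R)\<^sup>2) = sqrt (R\<^sup>2 - z\<^sup>2) / R"
        using R by (simp add: real_sqrt_divide)
      have e: "inverse (sqrt (R\<^sup>2 - z\<^sup>2) / R) * (1 / R) = 1 / sqrt (R\<^sup>2 - z\<^sup>2)"
        using R by (simp add: field_simps)
      have d1: "((\<lambda>x. sqrt (R\<^sup>2 - x\<^sup>2)) has_real_derivative - z / sqrt (R\<^sup>2 - z\<^sup>2)) (at z)"
        using pos by (auto intro!: derivative_eq_intros simp: field_simps)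
      have "((\<lambda>x. arcsin (x / R)) has_real_derivative inverse (sqrt (1 - (z / R)\<^sup>2)) * (1 / R))
            (at z)"
        by (rule DERIV_chain2[OF DERIV_arcsin])
           (use zR R in \<open>auto intro!: derivative_eq_intros simp: field_simps\<close>)
      then have d2: "((\<lambda>x. arcsin (x / R)) has_real_derivative 1 / sqrt (R\<^sup>2 - z\<^sup>2)) (at z)"
        unfolding s e .
      have "(F has_real_derivative
          (1 * sqrt (R\<^sup>2 - z\<^sup>2) + - z / sqrt (R\<^sup>2 - z\<^sup>2) * z + R\<^sup>2 * (1 / sqrt (R\<^sup>2 - z\<^sup>2))) / 2)
              (at z)"
        unfolding F_def
        by (intro DERIV_cdivide DERIV_add DERIV_mult DERIV_ident DERIV_cmult d1 d2)
      also have "(1 * sqrt (R\<^sup>2 - z\<^sup>2) + - z / sqrt (R\<^sup>2 - z\<^sup>2) * z + R\<^sup>2 * (1 / sqrt (R\<^sup>2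
            - z\<^sup>2))) / 2
          = (sqrt (R\<^sup>2 - z\<^sup>2) + (R\<^sup>2 - z\<^sup>2) / sqrt (R\<^sup>2 - z\<^sup>2)) / 2"
        by (simp add: diff_divide_distrib power2_eq_square)
      also have "\<dots> = sqrt (R\<^sup>2 - z\<^sup>2)" using pos by (simp add: real_div_sqrt)
      finally show ?thesis .
    qed
    obtain l z where z: "x < z" "z < y" "(F has_real_derivative l) (at z)" "F y - F x = (y - x) * l"
      using MVT[OF xy cont] der by (meson real_differentiable_def)
    have "l = sqrt (R\<^sup>2 - z\<^sup>2)" using DERIV_unique[OF z(3) der[OF z(1,2)]] .
    moreover have "sqrt (R\<^sup>2 - y\<^sup>2) \<le> sqrt (R\<^sup>2 - z\<^sup>2)" "sqrt (R\<^sup>2 - z\<^sup>2) \<le> sqrt (R\<^sup>2 - x\<^sup>2)"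
      using z assms by (auto intro!: power_mono)
    ultimately show ?thesis using z xy by (auto intro!: mult_left_mono)
  qed simp
  then show "(y - x) * sqrt (R\<^sup>2 - y\<^sup>2) \<le> F y - F x" "F y - F x \<le> (y - x) * sqrt (R\<^sup>2 - x\<^sup>2)"
    by auto
qed

text \<open>Riemann sums with unit step for the quarter circle. The last strip from \<open>s\<close>
  to \<open>sqrt n\<close> is shorter than 1 and is covered by the term \<open>a = s\<close>;
  passing from left to right endpoints costs the value \<open>sqrt n\<close> at 0.\<close>

lemma sum_quarter_disc:
  fixes n :: nat
  defines "s \<equiv> nat \<lfloor>sqrt n\<rfloor>"
  shows "pi / 4 * n \<le> (\<Sum>a\<le>s. sqrt (real n - real a ^ 2))"
    and "(\<Sum>a\<le>s. sqrt (real n - real a ^ 2)) \<le> pi / 4 * n + sqrt n"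
proof -
  define R where "R = sqrt n"
  define F where "F = (\<lambda>x. (x * sqrt (R\<^sup>2 - x\<^sup>2) + R\<^sup>2 * arcsin (x / R)) / 2)"
  define f where "f = (\<lambda>x::real. sqrt (R\<^sup>2 - x\<^sup>2))"
  have R2: "R\<^sup>2 = n" "0 \<le> R" by (auto simp: R_def)
  have "real s = of_int \<lfloor>R\<rfloor>" by (simp add: s_def R_def)
  then have sR: "real s \<le> R" "R < real s + 1" by linarith+
  have F0: "F 0 = 0" by (simp add: F_def)
  have FR: "F R = pi / 4 * n"
    by (cases "n = 0") (auto simp: F_def R2 R_def)
  have mv: "(y - x) * f y \<le> F y - F x \<and> F y - F x \<le> (y - x) * f x" if "0 \<le> x" "x \<le> y" "y \<le> R"
        for x y
    using quarter_disc_mean_value[OF that] unfolding F_def f_def by auto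
  have tel: "(\<Sum>a<s. F (real (Suc a)) - F (real a)) = F s"
    by (subst sum_lessThan_telescope) (simp add: F0)
  have aR: "real (Suc a) \<le> R" if "a < s" for a using that sR by simp
  have Fs: "0 \<le> F R - F s" "F R - F s \<le> f s"
  proof -
    have f: "0 \<le> f R" "0 \<le> f s" using sR by (auto simp: f_def intro!: power_mono)
    show "0 \<le> F R - F s" using mv[of s R] sR f by (smt (verit) mult_nonneg_nonneg of_nat_0_le_iff)
    have "(R - s) * f s \<le> 1 * f s" using sR f by (intro mult_right_mono) auto
    then show "F R - F s \<le> f s" using mv[of s R] sR by auto
  qed
  have "F s \<le> (\<Sum>a<s. f a)"
    unfolding tel[symmetric]
  proof (intro sum_mono)
    fix a assume "a \<in> {..<s}"
    then show "F (real (Suc a)) - F (real a) \<le> f a" using mv[of a "Suc a"] aR[of a] by auto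
  qed
  moreover have "(\<Sum>a\<le>s. f a) = (\<Sum>a<s. f a) + f s"
    by (simp add: lessThan_Suc_atMost[symmetric])
  ultimately show "pi / 4 * n \<le> (\<Sum>a\<le>s. sqrt (real n - real a ^ 2))"
    using Fs FR by (simp add: f_def R2)
  have "(\<Sum>a<s. f (Suc a)) \<le> F s"
    unfolding tel[symmetric]
  proof (intro sum_mono)
    fix a assume "a \<in> {..<s}"
    then show "f (real (Suc a)) \<le> F (real (Suc a)) - F (real a)" using mv[of a "Suc a"] aR[of a]
          by auto
  qed
  moreover have "(\<Sum>a\<le>s. f a) = f 0 + (\<Sum>a<s. f (Suc a))"
    unfolding lessThan_Suc_atMost[symmetric] by (subst sum.lessThan_Suc_shift) simp
  ultimately show "(\<Sum>a\<le>s. sqrt (real n - real a ^ 2)) \<le> pi / 4 * n + sqrt n"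
    using Fs FR by (simp add: f_def R2)
qed

text \<open>The points of the quarter disc are counted by columns. \<open>Suc\<close> on the left
  stands for the origin, which is not in \<open>epstein_index\<close>; \<open>Suc\<close> on the
  right for the point of the column on the horizontal axis.\<close>

lemma Suc_entry_count:
  fixes n :: nat
  defines "s \<equiv> nat \<lfloor>sqrt n\<rfloor>"
  shows "Suc (entry_count n) = (\<Sum>a\<le>s. Suc (nat \<lfloor>sqrt (real n - real a ^ 2)\<rfloor>))"
proof -
  have "insert (0, 0) {v \<in> epstein_index. epstein_entry v \<le> n} = {v. epstein_entry v \<le> n}"
    by (auto simp: epstein_index_def epstein_entry_def)
  moreover have "(0, 0) \<notin> {v \<in> epstein_index. epstein_entry v \<le> n}"
    by (auto simp: epstein_index_def)
  ultimately have "Suc (entry_count n) = card {v. epstein_entry v \<le> n}"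
    unfolding entry_count_eq_card using finite_entry_le[of n] by (metis card_insert_disjoint)
  also have "{v. epstein_entry v \<le> n} = (SIGMA a:{..s}. {..nat \<lfloor>sqrt (real n - real a ^ 2)\<rfloor>})"
  proof -
    have "a\<^sup>2 + b\<^sup>2 \<le> n \<longleftrightarrow> a \<le> s \<and> b \<le> nat \<lfloor>sqrt (real n - real a ^ 2)\<rfloor>" for a b
    proof -
      have s: "a \<le> s \<longleftrightarrow> real a \<le> sqrt n" 
        unfolding s_def by (simp add: le_nat_iff le_floor_iff)
      also have "\<dots> \<longleftrightarrow> real a ^ 2 \<le> n"
        using real_le_rsqrt real_sqrt_le_iff[of "real a ^ 2" n] by simp
      finally have 1: "a \<le> s \<longleftrightarrow> real a ^ 2 \<le> n" .
      show ?thesis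
      proof (cases "a \<le> s")
        case True
        then have "b \<le> nat \<lfloor>sqrt (real n - real a ^ 2)\<rfloor> \<longleftrightarrow> real b \<le> sqrt (real n - real a ^ 2)"
          using 1 by (simp add: le_nat_iff le_floor_iff)
        also have "\<dots> \<longleftrightarrow> real b ^ 2 \<le> real n - real a ^ 2"
          using real_sqrt_le_iff[of "real b ^ 2" "real n - real a ^ 2"] by simp
        also have "\<dots> \<longleftrightarrow> real (a\<^sup>2 + b\<^sup>2) \<le> real n" by auto
        finally show ?thesis using True by (simp only: of_nat_le_iff simp_thms)
      next
        case False
        then have "real n < real (a\<^sup>2)" using 1 by simp
        then show ?thesis using False by simp
      qed
    qed
    then show ?thesis by (auto simp: epstein_entry_def)
  qed
  also have "card \<dots> = (\<Sum>a\<le>s. Suc (nat \<lfloor>sqrt (real n - real a ^ 2)\<rfloor>))"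
    by (subst card_SigmaI) auto
  finally show ?thesis .
qed

text \<open>Rounding the column heights costs at most \<open>s + 1\<close>, the comparison with the
  area at most \<open>sqrt n\<close>, and leaving out the origin takes back 1. From below only the
  origin is lost, and \<open>1 \<le> sqrt n\<close> absorbs it; hence the separate case
  \<open>n = 0\<close>.\<close>

lemma abs_count_error_le: "\<bar>count_error n\<bar> \<le> 2 * sqrt n"
proof (cases "n = 0")
  case False
  define s where "s = nat \<lfloor>sqrt n\<rfloor>"
  define f where "f = (\<lambda>a::nat. sqrt (real n - real a ^ 2))"
  have sR: "real s \<le> sqrt n" by (auto simp: s_def)
  have f: "0 \<le> f a" if "a \<le> s" for a
  proof -
    have "real a \<le> sqrt n" using that sR by linarith
    then have "real a ^ 2 \<le> sqrt n ^ 2" by (intro power_mono) auto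
    then show ?thesis by (simp add: f_def)
  qed
  have 1: "real (Suc (entry_count n)) = (\<Sum>a\<le>s. real (Suc (nat \<lfloor>f a\<rfloor>)))"
    by (simp only: Suc_entry_count f_def s_def of_nat_sum)
  have "(\<Sum>a\<le>s. f a) \<le> (\<Sum>a\<le>s. real (Suc (nat \<lfloor>f a\<rfloor>)))"
    by (intro sum_mono) (linarith)
  moreover have "(\<Sum>a\<le>s. real (Suc (nat \<lfloor>f a\<rfloor>))) \<le> (\<Sum>a\<le>s. f a + 1)"
    using f by (intro sum_mono) (auto simp: )
  moreover have "(\<Sum>a\<le>s. f a + 1) = (\<Sum>a\<le>s. f a) + s + 1"
    by (simp add: sum.distrib)
  moreover have "pi / 4 * n \<le> (\<Sum>a\<le>s. f a)" "(\<Sum>a\<le>s. f a) \<le> pi / 4 * n + sqrt n"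
    using sum_quarter_disc[of n] by (auto simp: s_def f_def)
  moreover have "1 \<le> sqrt n" using False by simp
  ultimately show ?thesis
    using 1 sR unfolding count_error_def by linarith
qed (simp add: count_error_def entry_count_def)

section \<open>Abel summation against the lattice point error\<close>

lemma count_error_0 [simp]: "count_error 0 = 0"
  by (simp add: count_error_def entry_count_def)

lemma count_error_Suc: "count_error (Suc n) = count_error n + real (entry_mult (Suc n)) - pi / 4"
  by (simp add: count_error_def entry_count_def field_simps)

lemma sum_entry_mult_by_parts:
  "(\<Sum>j<n. real (entry_mult (Suc j)) * f (Suc j)) = pi / 4 * (\<Sum>j<n. f (Suc j)) +
     (\<Sum>j<n. count_error (Suc j) * (f (Suc j) - f (Suc (Suc j)))) + count_error n * f (Suc n)"
  by (induction n) (simp_all add: count_error_Suc algebra_simps)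

text \<open>Abel summation replaces the irregular weights by their density \<open>pi / 4\<close>;
  the lattice error meets only differences of \<open>f\<close>. The lemma serves
  \<open>m exp (- t m)\<close>, the Bose function and \<open>m powr (- s)\<close> alike.\<close>

lemma entry_mult_sums:
  assumes "(\<lambda>j. f (Suc j)) sums s"
    and "(\<lambda>j. count_error (Suc j) * (f (Suc j) - f (Suc (Suc j)))) sums t"
    and "(\<lambda>n. count_error n * f (Suc n)) \<longlonglongrightarrow> 0"
  shows "(\<lambda>j. real (entry_mult (Suc j)) * f (Suc j)) sums (pi / 4 * s + t)"
proof -
  have "(\<lambda>n. pi / 4 * (\<Sum>j<n. f (Suc j)) +
     (\<Sum>j<n. count_error (Suc j) * (f (Suc j) - f (Suc (Suc j)))) + count_error n * f (Suc n))
     \<longlonglongrightarrow> pi / 4 * s + t + 0"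
    using assms by (intro tendsto_intros) (auto simp: sums_def)
  then show ?thesis by (simp add: sums_def sum_entry_mult_by_parts)
qed

section \<open>Exponential inequalities and the series in the saddle point equation\<close>

lemma sinh_ge: "2 * y \<le> exp y - exp (- y)" if "0 \<le> y" for y :: real
proof -
  have "exp 0 - exp (- 0) - 2 * 0 \<le> exp y - exp (- y) - 2 * y"
  proof (rule DERIV_nonneg_imp_nondecreasing[OF that])
    fix x :: real
    have "2 \<le> exp x + exp (- x)"
      using cosh_real_ge_1[of x] by (simp add: cosh_def)
    then show "\<exists>y. ((\<lambda>x. exp x - exp (- x) - 2 * x) has_real_derivative y) (at x) \<and> 0 \<le> y"
      by (intro exI[of _ "exp x + exp (- x) - 2"]) (auto intro!: derivative_eq_intros)
  qed
  then show ?thesis by simp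
qed

text \<open>This is \<open>x \<le> 2 sinh (x / 2)\<close>, multiplied by \<open>exp (x / 2)\<close>
  and squared. It is used as \<open>exp x / (exp x - 1)^2 \<le> 1 / x^2\<close>.\<close>

lemma sq_exp_le: "x\<^sup>2 * exp x \<le> (exp x - 1)\<^sup>2" if "0 \<le> x" for x :: real
proof -
  have "x * exp (x / 2) \<le> (exp (x / 2) - exp (- (x / 2))) * exp (x / 2)"
    using sinh_ge[of "x / 2"] that by (intro mult_right_mono) auto
  also have "\<dots> = exp x - 1"
    by (simp add: algebra_simps exp_minus mult_exp_exp)
  finally have "(x * exp (x / 2))\<^sup>2 \<le> (exp x - 1)\<^sup>2"
    using that by (intro power_mono) auto
  then show ?thesis by (simp add: power_mult_distrib exp_double[symmetric])
qed

lemma sqrt_le_exp: "sqrt y \<le> exp (y / 4)" if "0 \<le> y" for y :: real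
proof -
  have "0 \<le> (sqrt y / 2 - 1)\<^sup>2" by simp
  then have "sqrt y \<le> 1 + y / 4" using that by (simp add: power2_eq_square algebra_simps)
  then show ?thesis using exp_ge_add_one_self[of "y / 4"] by linarith
qed

lemma exp_geometric_sums: "(\<lambda>j. exp (- (t * real (Suc j)))) sums (1 / (exp t - 1))" if "0 < t"
proof -
  have "(\<lambda>j. exp (- t) * exp (- t) ^ j) sums (exp (- t) * (1 / (1 - exp (- t))))"
    using that by (intro sums_mult geometric_sums) auto
  moreover have "exp (- t) * (1 / (1 - exp (- t))) = 1 / (exp t - 1)"
    using that by (simp add: field_simps exp_minus)
  moreover have "(\<lambda>j. exp (- t) * exp (- t) ^ j) = (\<lambda>j. exp (- (t * real (Suc j))))"
    by (simp add: exp_of_nat_mult[symmetric] mult_exp_exp algebra_simps)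
  ultimately show ?thesis by simp
qed

text \<open>The estimate has to hold for every \<open>t > 0\<close>, large ones included, because it
  will be summed over \<open>t = b k\<close> for all \<open>k \<ge> 1\<close>; the exponent
  \<open>- 3 / 2\<close> keeps that sum finite. Of the constant 17, 16 comes from the lattice error
  and 1 from replacing the series over \<open>m exp (- t m)\<close> by
  \<open>1 / t^2\<close>.\<close>

lemma weighted_entry_mult_sums:
  assumes t: "0 < t"
  obtains S where "(\<lambda>j. real (entry_mult (Suc j)) * (real (Suc j) * exp (- (t * real (Suc j)))))
        sums S"
    "\<bar>S - pi / 4 / t\<^sup>2\<bar> \<le> 17 * t powr (- 3 / 2)"
proof -
  define f where "f = (\<lambda>j. real j * exp (- (t * real j)))"
  define d where "d = (\<lambda>j. count_error (Suc j) * (f (Suc j) - f (Suc (Suc j))))"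
  have t32: "t powr (- 3 / 2) = 1 / (t * sqrt t)"
  proof -
    have "t powr (- 3 / 2) = t powr (- 1 + - (1 / 2))" by simp
    also have "\<dots> = t powr (- 1) * t powr (- (1 / 2))" by (rule powr_add)
    also have "\<dots> = 1 / (t * sqrt t)" using t by (simp only: powr_minus powr_half_sqrt powr_one
          less_imp_le) (simp add: field_simps)
    finally show ?thesis .
  qed
  have fs: "(\<lambda>j. f (Suc j)) sums (exp (- t) / (1 - exp (- t))\<^sup>2)"
  proof -
    have "(\<lambda>j. exp (- t) * (real (Suc j) * exp (- t) ^ j))
          sums (exp (- t) * (1 / (1 - exp (- t))\<^sup>2))"
      using t by (intro sums_mult geometric_deriv_sums) auto
    moreover have "(\<lambda>j. exp (- t) * (real (Suc j) * exp (- t) ^ j)) = (\<lambda>j. f (Suc j))"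
      by (simp add: f_def exp_of_nat_mult[symmetric] mult_exp_exp algebra_simps)
    ultimately show ?thesis by simp
  qed
  \<comment> \<open>The exponential is spent in portions: half of it absorbs the factor
    \<open>m t + 1\<close> of the difference, a quarter absorbs \<open>sqrt m\<close> from the
    lattice error, and a quarter is left for convergence.\<close>
  have dle: "norm (d j) \<le> 4 / sqrt t * exp (- (t / 4 * real (Suc j)))" for j
  proof -
    define m where "m = real (Suc j)"
    have m: "0 \<le> m" by (simp add: m_def)
    have et: "0 \<le> 1 - exp (- t)" "1 - exp (- t) \<le> t" "exp (- t) \<le> 1"
      using t exp_ge_add_one_self[of "-t"] by (auto simp: algebra_simps)
    have e1: "exp (- (t * real (Suc (Suc j)))) = exp (- (t * m)) * exp (- t)"
      by (simp add: m_def mult_exp_exp algebra_simps)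
    have s1: "real (Suc (Suc j)) = m + 1" by (simp add: m_def)
    have "f (Suc j) - f (Suc (Suc j)) = exp (- (t * m)) * (m * (1 - exp (- t)) - exp (- t))"
      unfolding f_def e1 by (simp add: m_def[symmetric] s1 algebra_simps del: of_nat_Suc)
    also have "\<bar>\<dots>\<bar> \<le> exp (- (t * m)) * (m * t + 1)"
    proof -
      have "0 \<le> m * (1 - exp (- t))" "m * (1 - exp (- t)) \<le> m * t"
        using et m by (auto intro: mult_left_mono)
      then have "\<bar>m * (1 - exp (- t)) - exp (- t)\<bar> \<le> m * t + 1"
        using et exp_ge_zero[of "-t"] unfolding abs_le_iff by linarith
      then show ?thesis by (simp add: abs_mult)
    qed
    also have "\<dots> \<le> exp (- (t * m)) * (2 * exp (t * m / 2))"
    proof (intro mult_left_mono exp_ge_zero)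
      have "0 \<le> t * m" using t m by simp
      then show "m * t + 1 \<le> 2 * exp (t * m / 2)"
        using exp_ge_add_one_self[of "t * m / 2"] unfolding mult.commute[of m t] by linarith
    qed
    also have "exp (- (t * m)) * (2 * exp (t * m / 2)) = 2 * exp (- (t * m / 2))"
      by (simp add: mult_exp_exp)
    finally have 1: "\<bar>f (Suc j) - f (Suc (Suc j))\<bar> \<le> 2 * exp (- (t * m / 2))" by simp
    have 2: "\<bar>count_error (Suc j)\<bar> \<le> 2 * (exp (t * m / 4) / sqrt t)"
    proof -
      have "sqrt (t * m) \<le> exp (t * m / 4)" using t m by (intro sqrt_le_exp) auto
      then have "sqrt m \<le> exp (t * m / 4) / sqrt t" using t
            by (simp add: real_sqrt_mult field_simps)
      then show ?thesis using abs_count_error_le[of "Suc j"] by (simp add: m_def)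
    qed
    have "norm (d j) \<le> (2 * (exp (t * m / 4) / sqrt t)) * (2 * exp (- (t * m / 2)))"
      unfolding d_def real_norm_def abs_mult
      by (intro mult_mono 1 2) (use t in auto)
    also have "\<dots> = 4 / sqrt t * (exp (t * m / 4) * exp (- (t * m / 2)))" by simp
    also have "exp (t * m / 4) * exp (- (t * m / 2)) = exp (- (t / 4 * m))"
      by (simp add: mult_exp_exp)
    finally show ?thesis by (simp add: m_def)
  qed
  have M: "(\<lambda>j. 4 / sqrt t * exp (- (t / 4 * real (Suc j)))) sums (4 / sqrt t * (1 / (exp (t / 4)
        - 1)))"
    using t by (intro sums_mult exp_geometric_sums) auto
  have ds: "summable d"
    by (rule summable_comparison_test'[OF sums_summable[OF M], of 0]) (use dle in auto)
  have "\<bar>suminf d\<bar> \<le> 4 / sqrt t * (1 / (exp (t / 4) - 1))"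
    using suminf_le[OF dle summable_norm_cancel[of "\<lambda>j. norm (d j)"]]
      norm_suminf_le[OF dle sums_summable[OF M]] sums_unique[OF M] by simp
  also have "\<dots> \<le> 4 / sqrt t * (1 / (t / 4))"
  proof -
    have "t / 4 \<le> exp (t / 4) - 1" using exp_ge_add_one_self[of "t / 4"] by linarith
    then show ?thesis using t by (intro mult_left_mono divide_left_mono mult_pos_pos) auto
  qed
  also have "\<dots> = 16 * t powr (- 3 / 2)" unfolding t32 using t by simp
  finally have dsum: "\<bar>suminf d\<bar> \<le> 16 * t powr (- 3 / 2)" .
  have lim: "(\<lambda>n. count_error n * f (Suc n)) \<longlonglongrightarrow> 0"
  proof (rule Lim_null_comparison)
    show "\<forall>\<^sub>F n in sequentially. norm (count_error n * f (Suc n)) \<le>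
        2 * sqrt (real n) * ((real n + 1) * exp (- (t * (real n + 1))))"
    proof (intro always_eventually allI)
      fix n
      show "norm (count_error n * f (Suc n)) \<le> 2 * sqrt (real n) * ((real n + 1) * exp (- (t *
            (real n + 1))))"
        unfolding real_norm_def abs_mult
        by (intro mult_mono) (use abs_count_error_le[of n] in \<open>auto simp: f_def abs_mult add_ac\<close>)
    qed
    show "(\<lambda>n. 2 * sqrt (real n) * ((real n + 1) * exp (- (t * (real n + 1))))) \<longlonglongrightarrow> 0"
      using t by real_asymp
  qed
  have "(\<lambda>j. real (entry_mult (Suc j)) * f (Suc j)) sums
      (pi / 4 * (exp (- t) / (1 - exp (- t))\<^sup>2) + suminf d)"
    by (rule entry_mult_sums[OF fs _ lim]) (use ds in \<open>simp add: d_def summable_sums\<close>)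
  moreover have "\<bar>pi / 4 * (exp (- t) / (1 - exp (- t))\<^sup>2) + suminf d - pi / 4 / t\<^sup>2\<bar>
        \<le> 17 * t powr (- 3 / 2)"
  proof -
    define h where "h = exp (- t) / (1 - exp (- t))\<^sup>2"
    have h: "h = exp t / (exp t - 1)\<^sup>2"
      using t by (simp add: h_def field_simps exp_minus power2_eq_square)
    have e1: "0 < exp t - 1" using t by simp
    have up: "h \<le> 1 / t\<^sup>2"
      using sq_exp_le[of t] t e1 unfolding h by (simp add: field_simps)
    have lo: "1 / t\<^sup>2 - 1 / t \<le> h"
    proof -
      have "(1 - exp (- t))\<^sup>2 \<le> t\<^sup>2" using t exp_ge_add_one_self[of "-t"] by (intro power_mono) auto
      then have "exp (- t) / t\<^sup>2 \<le> h" using t unfolding h_def by (intro divide_left_mono) auto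
      moreover have "(1 - t) / t\<^sup>2 \<le> exp (- t) / t\<^sup>2"
        using exp_ge_add_one_self[of "-t"] by (intro divide_right_mono) auto
      moreover have "(1 - t) / t\<^sup>2 = 1 / t\<^sup>2 - 1 / t" using t
            by (simp add: field_simps power2_eq_square)
      ultimately show ?thesis by simp
    qed
    have h0: "0 \<le> h" unfolding h by simp
    have "\<bar>h - 1 / t\<^sup>2\<bar> \<le> t powr (- 3 / 2)"
    \<comment> \<open>The available errors are \<open>1 / t\<close> and \<open>1 / t^2\<close>; the
      first is below \<open>t powr (- 3 / 2)\<close> for \<open>t \<le> 1\<close>, the second for
      \<open>t > 1\<close>.\<close>
    proof (cases "t \<le> 1")
      case True
      have "\<bar>h - 1 / t\<^sup>2\<bar> \<le> 1 / t" using up lo by auto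
      also have "\<dots> \<le> 1 / (t * sqrt t)"
        using t True by (intro divide_left_mono) (auto simp: mult_le_cancel_left1)
      finally show ?thesis unfolding t32 .
    next
      case False
      have "\<bar>h - 1 / t\<^sup>2\<bar> \<le> 1 / t\<^sup>2" using up h0 by auto
      also have "\<dots> \<le> 1 / (t * sqrt t)"
        using t False by (intro divide_left_mono) (auto simp: power2_eq_square intro!:
              real_le_lsqrt)
      finally show ?thesis unfolding t32 .
    qed
    then have "\<bar>pi / 4 * (h - 1 / t\<^sup>2)\<bar> \<le> 1 * t powr (- 3 / 2)"
      unfolding abs_mult using pi_less_4 by (intro mult_mono) auto
    moreover have "pi / 4 * h + suminf d - pi / 4 / t\<^sup>2 = pi / 4 * (h - 1 / t\<^sup>2) + suminf d"
      by (simp add: algebra_simps)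
    ultimately show ?thesis using dsum unfolding h_def[symmetric] by linarith
  qed
  ultimately show ?thesis using that unfolding f_def by blast
qed

text \<open>Rearrangement of a Lambert series: summing the double family along
  \<open>j = (d + 1) (k + 1)\<close> collects the divisors of \<open>j\<close>. Unconditional
  summability of the family allows the regrouping. The index \<open>j = 0\<close>, with its infinite
  set of divisors, enters only at the end with value 0.\<close>

lemma divsum_sums:
  assumes "((\<lambda>(d, k). real (u (Suc d)) * x ^ (Suc d * Suc k)) has_sum S) UNIV"
  shows "(\<lambda>j. real (divsum u j) * x ^ j) sums (S :: real)"
proof -
  have "((\<lambda>(j, d). real (u d) * x ^ j) has_sum S) (SIGMA j:{1..}. {d. d dvd j}) \<longleftrightarrow>
      ((\<lambda>(d, k). real (u (Suc d)) * x ^ (Suc d * Suc k)) has_sum S) UNIV"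
    by (rule has_sum_reindex_bij_witness[of _ "\<lambda>(d, k). (Suc d * Suc k, Suc d)"
          "\<lambda>(j, d). (d - 1, j div d - 1)"])
       (auto elim!: dvdE simp del: mult_Suc mult_Suc_right power_Suc)
  with assms have 1: "((\<lambda>(j, d). real (u d) * x ^ j) has_sum S) (SIGMA j:{1..}. {d. d dvd j})"
    by blast
  have "((\<lambda>j. real (divsum u j) * x ^ j) has_sum S) {1..}"
  proof (rule has_sum_SigmaD[OF 1])
    fix j :: nat assume "j \<in> {1..}"
    then show "((\<lambda>d. case (j, d) of (j, d) \<Rightarrow> real (u d) * x ^ j)
          has_sum real (divsum u j) * x ^ j) {d. d dvd j}"
      by (intro has_sum_finiteI) (auto simp: divsum_def sum_distrib_right)
  qed
  also have "?this \<longleftrightarrow> ((\<lambda>j. real (divsum u j) * x ^ j) has_sum S) UNIV"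
    by (intro has_sum_cong_neutral) (auto simp: not_less_eq_eq)
  finally show ?thesis by (rule has_sum_imp_sums)
qed


lemma inverse_sq_sums: "(\<lambda>k. 1 / (b * real (Suc k))\<^sup>2) sums (riemann_zeta 2 / b\<^sup>2)"
proof -
  have "(\<lambda>k. real (Suc k) powr - 2) = (\<lambda>k. inverse ((real (Suc k)) ^ 2))"
    by (simp add: powr_minus powr_numeral[symmetric] del: of_nat_Suc powr_numeral)
  moreover have "summable (\<lambda>k. inverse ((real (Suc k)) ^ 2))"
    using inverse_power_summable[of 2, where ?'a = real] by (subst summable_Suc_iff) simp
  ultimately have "(\<lambda>k. inverse ((real (Suc k)) ^ 2)) sums riemann_zeta 2"
    by (simp add: riemann_zeta_def summable_sums)
  from sums_mult[OF this, of "1 / b\<^sup>2"] show ?thesis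
    by (simp add: power_mult_distrib divide_inverse inverse_mult_distrib mult_ac power_inverse)
qed

lemma riemann_zeta_2_pos: "0 < riemann_zeta 2"
proof -
  have "0 < 1 / (1 * real (Suc 0))\<^sup>2" by simp
  also have "\<dots> \<le> riemann_zeta 2 / 1\<^sup>2"
    using sum_le_suminf[OF sums_summable[OF inverse_sq_sums[of 1]], of
          "{0}"] sums_unique[OF inverse_sq_sums[of 1]]
    by simp
  finally show ?thesis by simp
qed

definition zeta_three_halves :: real where
  "zeta_three_halves = (\<Sum>k. real (Suc k) powr (- 3 / 2))"

lemma three_halves_sums: "(\<lambda>k. (b * real (Suc k)) powr (- 3 / 2))
      sums (b powr (- 3 / 2) * zeta_three_halves)"
  if "0 < b"
proof -
  have "summable (\<lambda>k. real (Suc k) powr (- 3 / 2))"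
    using summable_real_powr_iff[of "- 3 / 2"] by (subst summable_Suc_iff[of
          "\<lambda>k. real k powr (- 3 / 2)"]) simp
  then have "(\<lambda>k. b powr (- 3 / 2) * real (Suc k) powr (- 3 / 2))
        sums (b powr (- 3 / 2) * zeta_three_halves)"
    unfolding zeta_three_halves_def by (intro sums_mult summable_sums)
  then show ?thesis using that by (simp add: powr_mult)
qed

text \<open>The double series is summed over \<open>d\<close> before \<open>k\<close>: for fixed
  \<open>k\<close> it is \<open>weighted_entry_mult_sums\<close> at \<open>t = b (k + 1)\<close>,
  and the sum over \<open>k\<close> turns main term and error into values of the zeta function at 2
  and \<open>3 / 2\<close>.\<close>

lemma part_sum_sums:
  assumes b: "0 < b"
  obtains S where "(\<lambda>j. real (part_sum j) * exp (- b) ^ j) sums S"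
    "\<bar>S - pi / 4 * riemann_zeta 2 / b\<^sup>2\<bar> \<le> 17 * zeta_three_halves * b powr (- 3 / 2)"
proof -
  define P where "P = (\<lambda>k S. (\<lambda>j. real (entry_mult (Suc j)) * (real (Suc j) * exp (- (b * real
        (Suc k) * real (Suc j))))) sums S \<and>
    \<bar>S - pi / 4 / (b * real (Suc k))\<^sup>2\<bar> \<le> 17 * (b * real (Suc k)) powr (- 3 / 2))"
  have "\<exists>S. P k S" for k
    by (rule weighted_entry_mult_sums[of "b * real (Suc k)"]) (use b P_def in auto)
  then obtain T where *: "\<And>k. P k (T k)" by metis
  have T: "(\<lambda>j. real (entry_mult (Suc j)) * (real (Suc j) * exp (- (b * real (Suc k) * real (Suc
        j))))) sums T k"
    and Tb: "\<bar>T k - pi / 4 / (b * real (Suc k))\<^sup>2\<bar> \<le> 17 * (b * real (Suc k)) powr (- 3 / 2)" for k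
    using * by (auto simp: P_def)
  have M1: "(\<lambda>k. pi / 4 * (1 / (b * real (Suc k))\<^sup>2)) sums (pi / 4 * (riemann_zeta 2 / b\<^sup>2))"
    by (intro sums_mult inverse_sq_sums)
  have M2: "(\<lambda>k. 17 * (b * real (Suc k)) powr (- 3 / 2))
        sums (17 * (b powr (- 3 / 2) * zeta_three_halves))"
    using b by (intro sums_mult three_halves_sums)
  define E where "E = (\<lambda>k. T k - pi / 4 * (1 / (b * real (Suc k))\<^sup>2))"
  have Ele: "norm (E k) \<le> 17 * (b * real (Suc k)) powr (- 3 / 2)" for k
    using Tb[of k] by (simp add: E_def)
  have Es: "summable E"
    by (rule summable_comparison_test'[OF sums_summable[OF M2], of 0]) (use Ele in auto)
  have Eb: "\<bar>suminf E\<bar> \<le> 17 * (b powr (- 3 / 2) * zeta_three_halves)"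
    using norm_suminf_le[OF Ele sums_summable[OF M2]] sums_unique[OF M2] by simp
  have Ts: "T sums (pi / 4 * (riemann_zeta 2 / b\<^sup>2) + suminf E)"
    using sums_add[OF M1 summable_sums[OF Es]] by (simp add: E_def)
  have T0: "0 \<le> T k" for k
    by (rule sums_le[OF _ sums_zero T[of k]]) simp
  define S where "S = pi / 4 * (riemann_zeta 2 / b\<^sup>2) + suminf E"
  have x: "exp (- b) ^ (Suc d * Suc k) = exp (- (b * real (Suc k) * real (Suc d)))" for d k
    by (simp add: exp_of_nat_mult[symmetric] algebra_simps del: mult_Suc mult_Suc_right)
  define f where "f = (\<lambda>(k, d). real (Suc d * entry_mult (Suc d)) * exp (- b) ^ (Suc d * Suc k))"
  have row: "((\<lambda>d. f (k, d)) has_sum T k) UNIV" for k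
    using T[of k] unfolding f_def x by (intro sums_nonneg_imp_has_sum) (simp_all add: mult_ac del:
          of_nat_Suc mult_Suc mult_Suc_right)
  have col: "(T has_sum S) UNIV"
    using Ts T0 unfolding S_def by (intro sums_nonneg_imp_has_sum)
  have "(f has_sum S) (UNIV \<times> UNIV)"
    by (rule has_sum_SigmaI[OF row col] summable_on_SigmaI[OF row] has_sum_imp_summable[OF col])+
       (auto simp: f_def)
  then have "((\<lambda>(d, k). real (Suc d * entry_mult (Suc d)) * exp (- b) ^ (Suc d * Suc k))
        has_sum S) UNIV"
    by (subst has_sum_reindex_bij_witness[of _ "\<lambda>(k, d). (d, k)" "\<lambda>(d, k). (k, d)" UNIV f _ S S])
       (auto simp: f_def)
  from divsum_sums[OF this] have "(\<lambda>j. real (part_sum j) * exp (- b) ^ j) sums S" .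
  moreover have "\<bar>S - pi / 4 * riemann_zeta 2 / b\<^sup>2\<bar> \<le> 17 * zeta_three_halves * b powr (- 3 / 2)"
    using Eb by (simp add: S_def mult_ac)
  ultimately show ?thesis by (rule that)
qed

section \<open>The Bose sum and the series that counts summands\<close>

definition bose_error :: "real \<Rightarrow> real" where
  "bose_error x = 1 / (exp x - 1) - 1 / x"

text \<open>The bound \<open>- 1\<close> is meant for small \<open>x\<close>, the bound
  \<open>- 1 / x\<close> for large \<open>x\<close>; together they give the decay
  \<open>2 / (1 + x)\<close> used below.\<close>

lemma bose_error_bounds:
  assumes "0 < x"
  shows "- 1 \<le> bose_error x" "- 1 / x \<le> bose_error x" "bose_error x \<le> 0"
proof -
  have e: "x < exp x - 1" "0 < exp x - 1" using exp_minus_greater[of "-x"] assms by auto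
  then show "bose_error x \<le> 0" using assms by (simp add: bose_error_def frac_le)
  show "- 1 / x \<le> bose_error x" using e by (simp add: bose_error_def)
  have "(1 - x) * exp x \<le> exp (- x) * exp x"
    using exp_ge_add_one_self[of "-x"] by (intro mult_right_mono) auto
  then have "exp x - 1 \<le> x * exp x" by (simp add: mult_exp_exp algebra_simps)
  then have "1 / x \<le> exp x / (exp x - 1)"
    using e assms by (simp add: field_simps)
  also have "\<dots> = 1 + 1 / (exp x - 1)" using e by (simp add: field_simps)
  finally show "- 1 \<le> bose_error x" by (simp add: bose_error_def)
qed

text \<open>The derivative is \<open>1 / z^2 - exp z / (exp z - 1)^2\<close>, nonnegative by
  \<open>sq_exp_le\<close>.\<close>

lemma bose_error_mono:
  assumes "0 < x" "x \<le> y"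
  shows "bose_error x \<le> bose_error y"
proof (rule DERIV_nonneg_imp_nondecreasing[OF assms(2)])
  fix z assume z: "x \<le> z" "z \<le> y"
  then have z0: "0 < z" using assms by auto
  then have e: "0 < exp z - 1" by simp
  have "(bose_error has_real_derivative (- exp z / (exp z - 1)\<^sup>2 + 1 / z\<^sup>2)) (at z)"
    unfolding bose_error_def using z0 e
    by (auto intro!: derivative_eq_intros simp: power2_eq_square field_simps)
  moreover have "0 \<le> - exp z / (exp z - 1)\<^sup>2 + 1 / z\<^sup>2"
    using sq_exp_le[of z] z0 e by (simp add: field_simps)
  ultimately show "\<exists>d. (bose_error has_real_derivative d) (at z) \<and> 0 \<le> d" by blast
qed

text \<open>\<open>W\<close> is an antiderivative of \<open>bose_error\<close>, so monotonicity of
  the latter compares each term of a Riemann sum with an increment of \<open>W\<close>.\<close>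

lemma bose_error_mean_value:
  assumes "0 < x" "x < y"
  defines "W \<equiv> \<lambda>x. ln (1 - exp (- x)) - ln x"
  shows "(y - x) * bose_error x \<le> W y - W x" "W y - W x \<le> (y - x) * bose_error y"
proof -
  have "(W has_real_derivative bose_error z) (at z)" if "x \<le> z" "z \<le> y" for z
  proof -
    have z: "0 < z" "0 < 1 - exp (- z)" using that assms by auto
    have "(W has_real_derivative (1 / (1 - exp (- z)) * exp (- z) - 1 / z)) (at z)"
      unfolding W_def using z by (auto intro!: derivative_eq_intros)
    also have "1 / (1 - exp (- z)) * exp (- z) - 1 / z = bose_error z"
      using z by (simp add: bose_error_def exp_minus field_simps)
    finally show ?thesis .
  qed
  from MVT2[OF assms(2) this] obtain z where z: "x < z" "z < y" "W y - W x = (y - x) * bose_error z"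
    by auto
  then show "(y - x) * bose_error x \<le> W y - W x" "W y - W x \<le> (y - x) * bose_error y"
    using bose_error_mono[of x z] bose_error_mono[of z y] assms by (auto intro!: mult_left_mono)
qed

text \<open>Abel summation, comparing with the integral of \<open>1 / (2 * sqrt x * (1 + b * x))\<close>.\<close>

lemma sum_sqrt_diff_le:
  fixes v :: "nat \<Rightarrow> real"
  assumes b: "0 < b" and v: "\<And>j. 0 \<le> v j" "\<And>j. 0 < j \<Longrightarrow> v j \<le> 2 / (1 + b * j)"
  shows "(\<Sum>j<n. sqrt (Suc j) * (v (Suc j) - v (Suc (Suc j)))) \<le> pi / sqrt b"
proof -
  have "(\<Sum>j<n. sqrt (Suc j) * (v (Suc j) - v (Suc (Suc j)))) =
      (\<Sum>j<n. (sqrt (Suc j) - sqrt j) * v (Suc j)) - sqrt n * v (Suc n)"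
    by (induction n) (simp_all add: algebra_simps)
  also have "\<dots> \<le> (\<Sum>j<n. (sqrt (Suc j) - sqrt j) * v (Suc j))"
    using v by simp
  \<comment> \<open>The substitution \<open>z = sqrt (b x)\<close> makes
    \<open>2 / sqrt b * arctan (sqrt (b x))\<close> an antiderivative of
    \<open>1 / (sqrt x * (1 + b x))\<close>. Since \<open>arctan\<close> stays below
    \<open>pi / 2\<close>, the bound is uniform in \<open>n\<close>.\<close>
  also have "\<dots> \<le> (\<Sum>j<n. 2 / sqrt b * (arctan (sqrt (b * Suc j)) - arctan (sqrt (b * j))))"
  proof (intro sum_mono)
    fix j
    define x y where "x = sqrt (b * j)" and "y = sqrt (b * Suc j)"
    have xy: "0 \<le> x" "x < y" using b by (auto simp: x_def y_def)
    have "\<And>z. x \<le> z \<Longrightarrow> z \<le> y \<Longrightarrow> (arctan has_real_derivative inverse (1 + z\<^sup>2)) (at z)"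
      by (rule DERIV_arctan)
    from MVT2[OF xy(2) this] obtain z where z: "x < z" "z < y" "arctan y - arctan x
          = (y - x) * inverse (1 + z\<^sup>2)"
      by auto
    have "z\<^sup>2 \<le> y\<^sup>2" using z xy by (intro power_mono) auto
    then have "inverse (1 + y\<^sup>2) \<le> inverse (1 + z\<^sup>2)"
      by (intro le_imp_inverse_le) (auto simp: add_pos_nonneg)
    then have 1: "(y - x) * inverse (1 + y\<^sup>2) \<le> arctan y - arctan x"
      unfolding z using xy by (intro mult_left_mono) auto
    have y2: "y\<^sup>2 = b * Suc j" using b by (simp add: y_def)
    have "(sqrt (Suc j) - sqrt j) * v (Suc j) \<le> (sqrt (Suc j) - sqrt j) * (2 / (1 + b * Suc j))"
      using v(2)[of "Suc j"] by (intro mult_left_mono) auto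
    also have "\<dots> = (y - x) / sqrt b * (2 / (1 + b * Suc j))"
      unfolding x_def y_def real_sqrt_mult right_diff_distrib[symmetric] using b by simp
    also have "(y - x) / sqrt b * (2 / (1 + b * Suc j)) = 2 / sqrt b * ((y - x) * inverse (1
          + y\<^sup>2))"
      unfolding y2 by (simp add: divide_inverse)
    also have "\<dots> \<le> 2 / sqrt b * (arctan y - arctan x)"
      using 1 b by (intro mult_left_mono) auto
    finally show "(sqrt (Suc j) - sqrt j) * v (Suc j) \<le> 2 / sqrt b * (arctan (sqrt (b * Suc j))
          - arctan (sqrt (b * j)))"
      by (simp add: x_def y_def)
  qed
  also have "\<dots> = 2 / sqrt b * arctan (sqrt (b * n))"
    by (subst sum_distrib_left[symmetric], subst sum_lessThan_telescope[of
          "\<lambda>j. arctan (sqrt (b * real j))"]) simp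
  also have "\<dots> \<le> 2 / sqrt b * (pi / 2)"
    using b arctan_ubound[of "sqrt (b * n)"] by (intro mult_left_mono) auto
  finally show ?thesis by simp
qed

text \<open>The constant term of \<open>epstein_zeta\<close> at 1, as shown in
  \<open>finite_part_epstein_zeta\<close>. The formula is what Abel summation leaves at
  \<open>s = 1\<close>: \<open>pi / 4\<close> times the constant term of the Riemann zeta function,
  plus the lattice error against \<open>1 / j\<close>. Having it explicit links the expansion of
  \<open>T\<close> for small \<open>b\<close> to the Dirichlet series.\<close>

definition zeta_const :: real where
  "zeta_const = pi / 4 * euler_mascheroni +
     (\<Sum>j. count_error (Suc j) * (1 / real (Suc j) - 1 / real (Suc (Suc j))))"

lemma summable_count_error: "summable (\<lambda>j. count_error (Suc j) * (1 / real (Suc j) - 1 / real (Suc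
      (Suc j))))"
proof (rule summable_comparison_test'[OF sums_summable[OF sums_mult[OF three_halves_sums[of 1], of
      2]], of 0])
  fix j :: nat
  define m where "m = real (Suc j)"
  have m: "0 < m" by (simp add: m_def)
  have "norm (count_error (Suc j) * (1 / m - 1 / (m + 1))) \<le> 2 * sqrt m * (1 / m\<^sup>2)"
    unfolding real_norm_def abs_mult
  proof (intro mult_mono)
    have "1 / m - 1 / (m + 1) = 1 / (m * (m + 1))" using m by (simp add: field_simps)
    also have "\<bar>\<dots>\<bar> \<le> 1 / m\<^sup>2" using m by (auto simp: power2_eq_square intro!: divide_left_mono)
    finally show "\<bar>1 / m - 1 / (m + 1)\<bar> \<le> 1 / m\<^sup>2" .
  qed (use abs_count_error_le[of "Suc j"] m in \<open>auto simp: m_def\<close>)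
  also have "\<dots> = 2 * (1 * m) powr (- 3 / 2)"
  proof -
    have "m powr (1 / 2) * m powr (- 2) = m powr (- 3 / 2)" by (simp flip: powr_add)
    moreover have "m powr (- 2) = 1 / m\<^sup>2" using m by (simp add: powr_minus divide_inverse)
    ultimately show ?thesis using m by (simp add: powr_half_sqrt)
  qed
  finally show "norm (count_error (Suc j) * (1 / real (Suc j) - 1 / real (Suc (Suc j)))) \<le>
      2 * (1 * real (Suc j)) powr (- 3 / 2)"
    by (simp add: m_def add.commute)
qed simp

text \<open>Each term is \<open>1 / j + b * bose_error (b j)\<close>. The harmonic part against
  logarithms gives \<open>euler_mascheroni\<close>; the rest is a Riemann sum of a monotone
  function, hence close to an increment of its antiderivative \<open>W\<close>.\<close>

lemma bose_sums:
  fixes b :: real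
  assumes b: "0 < b"
  obtains E where "(\<lambda>j. b / (exp (b * Suc j) - 1)) sums (euler_mascheroni - ln b + E)" "\<bar>E\<bar> \<le> 2 * b"
proof -
  define G W where "G = (\<lambda>x::real. ln (1 - exp (- x)))" and
        "W = (\<lambda>x::real. ln (1 - exp (- x)) - ln x)"
  \<comment> \<open>The error of the Riemann sum on one step. By monotonicity it is at most the
    increment of \<open>w\<close>, so the total error telescopes to at most
    \<open>b\<close>.\<close>
  define e where "e = (\<lambda>j. b * bose_error (b * Suc j) - (W (b * Suc (Suc j)) - W (b * Suc j)))"
  have "(\<lambda>n. G (b * Suc n)) \<longlonglongrightarrow> 0" unfolding G_def using b by real_asymp
  from telescope_sums[OF this]
  have G: "(\<lambda>j. G (b * Suc (Suc j)) - G (b * Suc j)) sums (- G b)" by simp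
  have gamma: "(\<lambda>j. inverse (real (j + 1)) + ln (real (j + 1)) - ln (real (j + 2)))
        sums euler_mascheroni"
    by (rule euler_mascheroni_sum_real)
  define w where "w = (\<lambda>n. b * bose_error (b * Suc n))"
  have ele: "norm (e j) \<le> w (Suc j) - w j" for j
  proof -
    define p q where "p = b * Suc j" and "q = b * Suc (Suc j)"
    have pq: "0 < p" "p < q" "q - p = b"
      using b by (simp_all add: p_def q_def algebra_simps add_pos_nonneg)
    have "b * bose_error p \<le> W q - W p" "W q - W p \<le> b * bose_error q"
      using bose_error_mean_value[OF pq(1,2)] unfolding pq(3) W_def by auto
    then show ?thesis unfolding e_def w_def real_norm_def p_def[symmetric] q_def[symmetric]
          by linarith
  qed
  have "w \<longlonglongrightarrow> 0" unfolding w_def bose_error_def using b by real_asymp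
  from telescope_sums[OF this] have w: "(\<lambda>j. w (Suc j) - w j) sums (- w 0)" by simp
  have es: "summable e"
    by (rule summable_comparison_test'[OF sums_summable[OF w], of 0]) (use ele in auto)
  have "norm (suminf e) \<le> - w 0"
    using norm_suminf_le[OF ele sums_summable[OF w]] sums_unique[OF w] by simp
  also have "- w 0 \<le> b" 
    using mult_left_mono[OF bose_error_bounds(1)[OF b], of b] b by (simp add: w_def)
  finally have eb: "\<bar>suminf e\<bar> \<le> b" by simp
  have Wb: "\<bar>W b\<bar> \<le> b"
  proof -
    have p: "0 < 1 - exp (- b)" "1 - exp (- b) \<le> b" using b exp_ge_add_one_self[of "-b"] by auto
    have "W b \<le> 0" unfolding W_def using p b by (simp add: ln_mono)
    have "b * exp (- b) \<le> 1 - exp (- b)"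
    proof -
      have "(1 + b) * exp (- b) \<le> exp b * exp (- b)"
        using exp_ge_add_one_self[of b] by (intro mult_right_mono) auto
      then show ?thesis by (simp add: mult_exp_exp algebra_simps)
    qed
    then have "ln (b * exp (- b)) \<le> ln (1 - exp (- b))" using b by (intro ln_mono) auto
    then have "- b \<le> W b" using b unfolding W_def by (simp add: ln_mult)
    then show ?thesis using \<open>W b \<le> 0\<close> by simp
  qed
  have "(\<lambda>j. (inverse (real (j + 1)) + ln (real (j + 1)) - ln (real (j + 2))) + (G (b * Suc (Suc
        j)) - G (b * Suc j)) + e j)
      sums (euler_mascheroni + (- G b) + suminf e)"
    by (intro sums_add gamma G summable_sums es)
  also have "(\<lambda>j. (inverse (real (j + 1)) + ln (real (j + 1)) - ln (real (j + 2)))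
        + (G (b * Suc (Suc j)) - G (b * Suc j)) + e j)
      = (\<lambda>j. b / (exp (b * Suc j) - 1))"
  proof
    fix j
    have "ln (b * Suc j) = ln b + ln (real (j + 1))" "ln (b * Suc (Suc j))
          = ln b + ln (real (j + 2))"
      using b by (simp_all add: ln_mult add_ac del: of_nat_Suc)
    moreover have "b * bose_error (b * Suc j) = b / (exp (b * Suc j) - 1) - inverse (real (j + 1))"
      using b by (simp add: bose_error_def right_diff_distrib divide_inverse del: of_nat_Suc)
    ultimately show "(inverse (real (j + 1)) + ln (real (j + 1)) - ln (real (j + 2)))
          + (G (b * Suc (Suc j)) - G (b * Suc j)) + e j
      = b / (exp (b * Suc j) - 1)"
      unfolding e_def G_def W_def by linarith
  qed
  \<comment> \<open>The term \<open>- ln b\<close> is separated from the telescoped value by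
    \<open>G b = W b + ln b\<close>, where \<open>W b\<close> is small.\<close>
  also have "euler_mascheroni + (- G b) + suminf e = euler_mascheroni - ln b + (suminf e - W b)"
    by (simp add: G_def W_def)
  finally show ?thesis by (rule that) (use eb Wb in linarith)
qed

text \<open>Splitting \<open>f j = 1 / j - b * v j\<close> in the Abel error separates a series
  independent of \<open>b\<close>, the one in \<open>zeta_const\<close>, from one bounded by
  \<open>2 pi sqrt b\<close>. The constant 9 is 7 for that series plus 2 from the error term
  \<open>E\<close> of \<open>bose_sums\<close>.\<close>

lemma entry_mult_bose_sums:
  assumes b: "0 < b" "b \<le> 1"
  obtains S where "(\<lambda>j. real (entry_mult (Suc j)) * (b / (exp (b * real (Suc j)) - 1))) sums S"
    "\<bar>S - (zeta_const - pi / 4 * ln b)\<bar> \<le> 9 * sqrt b"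
proof -
  define f where "f = (\<lambda>j. b / (exp (b * real j) - 1))"
  obtain E where E: "(\<lambda>j. b / (exp (b * Suc j) - 1)) sums (euler_mascheroni - ln b + E)"
        "\<bar>E\<bar> \<le> 2 * b"
    using bose_sums[OF b(1)] by blast
  define v where "v = (\<lambda>j. - bose_error (b * real j))"
  define r where "r = (\<lambda>j. count_error (Suc j) * (1 / real (Suc j) - 1 / real (Suc (Suc j))))"
  define d where "d = (\<lambda>j. count_error (Suc j) * (b * (v (Suc (Suc j)) - v (Suc j))))"
  define M where "M = (\<lambda>j. 2 * b * (sqrt (Suc j) * (v (Suc j) - v (Suc (Suc j)))))"
  have v: "v (Suc (Suc j)) \<le> v (Suc j)" for j
    using bose_error_mono[of "b * Suc j" "b * Suc (Suc j)"] b by (simp add: v_def)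
  \<comment> \<open>\<open>sum_sqrt_diff_le\<close> asks for all \<open>j\<close>; at
    \<open>j = 0\<close> both quotients have denominator 0 and are therefore 0.\<close>
  have v1: "0 \<le> v j" for j
    using bose_error_bounds(3)[of "b * real j"] b by (cases
          "j = 0") (auto simp: v_def bose_error_def)
  have v2: "v j \<le> 2 / (1 + b * j)" if "0 < j" for j
  proof -
    define x where "x = b * j"
    have x: "0 < x" using that b by (simp add: x_def)
    have "v j \<le> 1" "v j \<le> 1 / x" using bose_error_bounds(1,2)[OF x] by (auto simp: v_def x_def)
    \<comment> \<open>Adding the two bounds in the form \<open>v \<le> 1\<close> and
      \<open>v x \<le> 1\<close> interpolates between them.\<close>
    then have "v j + v j * x \<le> 1 + 1 / x * x"
      using x by (intro add_mono mult_right_mono) auto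
    then have "v j * (1 + x) \<le> 2" using x by (simp add: algebra_simps)
    then show ?thesis using x by (simp add: x_def[symmetric] field_simps)
  qed
  have M0: "0 \<le> M j" for j using b v[of j] by (simp add: M_def)
  have Msum: "(\<Sum>j<n. M j) \<le> 2 * b * (pi / sqrt b)" for n
    unfolding M_def sum_distrib_left[symmetric]
    using sum_sqrt_diff_le[OF b(1) v1 v2] b by (intro mult_left_mono) auto
  have Ms: "summable M" by (rule bounded_imp_summable[OF M0 Msum[of
        "Suc _", unfolded lessThan_Suc_atMost]])
  have Mle: "suminf M \<le> 2 * b * (pi / sqrt b)" by (rule suminf_le_const[OF Ms Msum])
  have dle: "norm (d j) \<le> M j" for j
  proof -
    have "norm (d j) = \<bar>count_error (Suc j)\<bar> * (b * (v (Suc j) - v (Suc (Suc j))))"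
      using v[of j] b by (simp add: d_def abs_mult)
    also have "\<dots> \<le> 2 * sqrt (Suc j) * (b * (v (Suc j) - v (Suc (Suc j))))"
      using v[of j] b by (intro mult_right_mono abs_count_error_le) auto
    finally show ?thesis by (simp add: M_def mult_ac)
  qed
  have ds: "summable d" by (rule summable_comparison_test'[OF Ms, of 0]) (use dle in auto)
  have "\<bar>suminf d\<bar> \<le> 2 * b * (pi / sqrt b)"
    using norm_suminf_le[OF dle Ms] Mle by simp
  also have "\<dots> = 2 * pi * sqrt b" using b by (simp add: real_div_sqrt field_simps)
  finally have dsum: "\<bar>suminf d\<bar> \<le> 2 * pi * sqrt b" .
  have "(\<lambda>j. r j + d j) sums (suminf r + suminf d)"
    using summable_count_error ds by (intro sums_add summable_sums) (auto simp: r_def)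
  also have "(\<lambda>j. r j + d j) = (\<lambda>j. count_error (Suc j) * (f (Suc j) - f (Suc (Suc j))))"
  proof
    fix j
    have fv: "f j = 1 / j - b * v j" if "0 < j" for j
      using that b by (simp add: f_def v_def bose_error_def field_simps)
    show "r j + d j = count_error (Suc j) * (f (Suc j) - f (Suc (Suc j)))"
      by (simp add: r_def d_def fv algebra_simps del: of_nat_Suc)
  qed
  finally have 2: "(\<lambda>j. count_error (Suc j) * (f (Suc j) - f (Suc (Suc j))))
        sums (suminf r + suminf d)" .
  have 3: "(\<lambda>n. count_error n * f (Suc n)) \<longlonglongrightarrow> 0"
  proof (rule Lim_null_comparison)
    show "\<forall>\<^sub>F n in sequentially. norm (count_error n * f (Suc n))
          \<le> 2 * sqrt (real n) * (1 / (real n + 1))"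
    proof (intro always_eventually allI)
      fix n
      have "b * real (Suc n) \<le> exp (b * real (Suc n)) - 1" "0 < b * real (Suc n)"
        using exp_ge_add_one_self[of "b * real (Suc n)"] b by (linarith, simp)
      then have p: "b * real (Suc n) \<le> exp (b * real (Suc n)) - 1" "0 < exp (b * real (Suc n)) - 1"
        by linarith+
      have "f (Suc n) \<le> b / (b * real (Suc n))"
        unfolding f_def by (rule divide_left_mono[OF p(1)]) (use b p in simp_all)
      moreover have "0 \<le> f (Suc n)" unfolding f_def using b p by (intro divide_nonneg_pos) auto
      ultimately have "f (Suc n) \<le> b / (b * real (Suc n))" "0 \<le> f (Suc n)" .
      then have "\<bar>f (Suc n)\<bar> \<le> 1 / (real n + 1)" using b by (simp add: add.commute)
      then show "norm (count_error n * f (Suc n)) \<le> 2 * sqrt (real n) * (1 / (real n + 1))"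
        unfolding real_norm_def abs_mult using abs_count_error_le[of n] by (intro mult_mono) auto
    qed
    show "(\<lambda>n. 2 * sqrt (real n) * (1 / (real n + 1))) \<longlonglongrightarrow> 0" by real_asymp
  qed
  define S where "S = pi / 4 * (euler_mascheroni - ln b + E) + (suminf r + suminf d)"
  have "(\<lambda>j. real (entry_mult (Suc j)) * f (Suc j)) sums S"
    unfolding S_def by (rule entry_mult_sums[OF _ 2 3]) (use E in \<open>simp add: f_def\<close>)
  moreover have "\<bar>S - (zeta_const - pi / 4 * ln b)\<bar> \<le> 9 * sqrt b"
  proof -
    have "S - (zeta_const - pi / 4 * ln b) = pi / 4 * E + suminf d"
      unfolding S_def zeta_const_def r_def[symmetric] distrib_left right_diff_distrib[of "pi / 4"]
            by linarith
    moreover have "\<bar>pi / 4 * E\<bar> \<le> 1 * (2 * b)"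
      unfolding abs_mult using E(2) pi_less_4 by (intro mult_mono) auto
    moreover have "b \<le> sqrt b" using b by (simp add: real_le_rsqrt power2_eq_square mult_left_le)
    moreover have "pi * sqrt b \<le> 3.5 * sqrt b" using pi_less_4 pi_approx b
          by (intro mult_right_mono) auto
    ultimately show ?thesis using dsum by linarith
  qed
  ultimately show ?thesis using that unfolding f_def by blast
qed

text \<open>Here the geometric sum over \<open>k\<close> is taken inside, and it produces the Bose
  function at \<open>b (d + 1)\<close>.\<close>

lemma part_count_sums:
  assumes b: "0 < b" "b \<le> 1"
  obtains S where "(\<lambda>j. real (part_count j) * exp (- b) ^ j) sums S"
    "\<bar>b * S - (zeta_const - pi / 4 * ln b)\<bar> \<le> 9 * sqrt b"
proof -
  obtain S' where S': "(\<lambda>j. real (entry_mult (Suc j)) * (b / (exp (b * real (Suc j)) - 1))) sums S'"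
    and S'b: "\<bar>S' - (zeta_const - pi / 4 * ln b)\<bar> \<le> 9 * sqrt b"
    using entry_mult_bose_sums[OF b] by blast
  define S where "S = S' / b"
  define g where "g = (\<lambda>d. real (entry_mult (Suc d)) * (1 / (exp (b * real (Suc d)) - 1)))"
  have gs: "g sums S"
    using sums_divide[OF S', of b] b by (simp add: g_def S_def)
  define f where "f = (\<lambda>(d, k). real (entry_mult (Suc d)) * exp (- b) ^ (Suc d * Suc k))"
  have x: "exp (- b) ^ (Suc d * Suc k) = exp (- (b * real (Suc d) * real (Suc k)))" for d k
    by (simp add: exp_of_nat_mult[symmetric] algebra_simps del: mult_Suc mult_Suc_right)
  have row: "((\<lambda>k. f (d, k)) has_sum g d) UNIV" for d
    unfolding f_def x g_def prod.case using b
    by (intro sums_nonneg_imp_has_sum sums_mult exp_geometric_sums) auto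
  have col: "(g has_sum S) UNIV"
    by (rule sums_nonneg_imp_has_sum[OF gs]) (use b in \<open>simp add: g_def\<close>)
  have "(f has_sum S) (UNIV \<times> UNIV)"
    by (rule has_sum_SigmaI[OF row col] summable_on_SigmaI[OF row] has_sum_imp_summable[OF col])+
       (auto simp: f_def)
  then have "((\<lambda>(d, k). real (entry_mult (Suc d)) * exp (- b) ^ (Suc d * Suc k)) has_sum S) UNIV"
    by (simp add: f_def)
  from divsum_sums[OF this] have "(\<lambda>j. real (part_count j) * exp (- b) ^ j) sums S" .
  moreover have "b * S = S'" using b by (simp add: S_def)
  ultimately show ?thesis using that S'b by simp
qed

section \<open>The Dirichlet series near its pole\<close>

text \<open>The subtracted quotient is the integral of \<open>x powr (- s)\<close> from
  \<open>j + 1\<close> to \<open>j + 2\<close>. These integrals telescope to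
  \<open>1 / (s - 1)\<close>, so the pole is isolated from the remainders.\<close>

definition integral_remainder :: "nat \<Rightarrow> real \<Rightarrow> real" where
  "integral_remainder j s = real (Suc j) powr (- s) - (real (Suc j) powr (1 - s) - real (Suc (Suc
      j)) powr (1 - s)) / (s - 1)"

definition count_error_term :: "nat \<Rightarrow> real \<Rightarrow> real" where
  "count_error_term j s = count_error (Suc j) * (real (Suc j) powr (- s) - real (Suc (Suc j)) powr
      (- s))"

lemma powr_diff_bounds:
  fixes s x :: real
  assumes s: "1 < s" "s \<le> 2" and x: "1 \<le> x"
  shows "0 \<le> x powr (- s) - (x + 1) powr (- s)" "x powr (- s) - (x + 1) powr (- s)
        \<le> 2 * x powr (- 2)"
proof -
  have xx: "x < x + 1" by simp
  have der: "\<And>z. x \<le> z \<Longrightarrow> z \<le> x + 1 \<Longrightarrow> ((\<lambda>x. x powr (- s)) has_real_derivative (- s) * z powr (- s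
        - 1)) (at z)"
    using x by (auto intro!: derivative_eq_intros)
  obtain z where z: "x < z" "z < x + 1" "(x + 1) powr (- s) - x powr (- s)
        = (x + 1 - x) * ((- s) * z powr (- s - 1))"
    using MVT2[OF xx der] by blast
  then have eq: "x powr (- s) - (x + 1) powr (- s) = s * z powr (- s - 1)" by simp
  show "0 \<le> x powr (- s) - (x + 1) powr (- s)" unfolding eq using s by simp
  have "z powr (- s - 1) \<le> z powr (- 2)" using s z x by (intro powr_mono) auto
  also have "\<dots> \<le> x powr (- 2)" using z x by (intro powr_mono2') auto
  finally show "x powr (- s) - (x + 1) powr (- s) \<le> 2 * x powr (- 2)"
    unfolding eq using s by (intro mult_mono) auto
qed

text \<open>The mean of \<open>x powr (- s)\<close> over a unit interval lies between the endpoint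
  values. The bound is uniform for \<open>1 < s \<le> 2\<close>, as the passage to the limit
  \<open>s = 1\<close> under the sum requires.\<close>

lemma integral_remainder_bound:
  assumes s: "1 < s" "s \<le> 2"
  shows "norm (integral_remainder j s) \<le> 2 * real (Suc j) powr (- 2)"
proof -
  define x where "x = real (Suc j)"
  have x: "1 \<le> x" by (simp add: x_def)
  have xx: "x < x + 1" by simp
  have der: "\<And>z. x \<le> z \<Longrightarrow> z \<le> x + 1 \<Longrightarrow> ((\<lambda>x. x powr (1 - s)) has_real_derivative (1 - s) * z powr (-
        s)) (at z)"
    using x by (auto intro!: derivative_eq_intros)
  obtain z where z: "x < z" "z < x + 1" "(x + 1) powr (1 - s) - x powr (1 - s)
        = (x + 1 - x) * ((1 - s) * z powr (- s))"
    using MVT2[OF xx der] by blast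
  then have "x powr (1 - s) - (x + 1) powr (1 - s) = (s - 1) * z powr (- s)"
        by (simp add: algebra_simps)
  then have eq: "integral_remainder j s = x powr (- s) - z powr (- s)"
    using s by (simp add: integral_remainder_def x_def add.commute)
  have "z powr (- s) \<le> x powr (- s)" "(x + 1) powr (- s) \<le> z powr (- s)"
    using z x s by (auto intro!: powr_mono2')
  then show ?thesis using powr_diff_bounds(2)[OF s x] unfolding eq x_def[symmetric] by auto
qed

lemma count_error_term_bound:
  assumes s: "1 < s" "s \<le> 2"
  shows "norm (count_error_term j s) \<le> 4 * (1 * real (Suc j)) powr (- 3 / 2)"
proof -
  define x where "x = real (Suc j)"
  have x: "1 \<le> x" by (simp add: x_def)
  have "norm (count_error_term j s) \<le> (2 * sqrt x) * (2 * x powr (- 2))"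
    unfolding count_error_term_def real_norm_def abs_mult
    using powr_diff_bounds[OF s x] abs_count_error_le[of "Suc j"]
    by (intro mult_mono) (auto simp: x_def add.commute)
  also have "\<dots> = 4 * (x powr (1 / 2) * x powr (- 2))" using x by (simp add: powr_half_sqrt)
  also have "x powr (1 / 2) * x powr (- 2) = x powr (- 3 / 2)" by (simp flip: powr_add)
  finally show ?thesis by (simp add: x_def)
qed

lemma summable_powr_2: "summable (\<lambda>j. 2 * real (Suc j) powr (- 2))"
  using summable_real_powr_iff[of "- 2"]
  by (intro summable_mult, subst summable_Suc_iff[of "\<lambda>k. real k powr (- 2)"]) simp

lemma summable_powr_3_2: "summable (\<lambda>j. 4 * (1 * real (Suc j)) powr (- 3 / 2))"
  by (intro summable_mult sums_summable[OF three_halves_sums]) simp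

definition epstein_real :: "real \<Rightarrow> real" where
  "epstein_real s = pi / 4 * (1 / (s - 1) + (\<Sum>j. integral_remainder j s)) + (\<Sum>j.
      count_error_term j s)"

lemma entry_mult_powr_sums_aux:
  assumes s: "1 < s" "s \<le> 2"
  shows "(\<lambda>j. real (entry_mult (Suc j)) * real (Suc j) powr (- s)) sums epstein_real s"
  unfolding epstein_real_def
proof (rule entry_mult_sums)
  have "(\<lambda>n. real (Suc n) powr (1 - s) / (s - 1)) \<longlonglongrightarrow> 0" using s by real_asymp
  from telescope_sums'[OF this]
  have 1: "(\<lambda>j. (real (Suc j) powr (1 - s) - real (Suc (Suc j)) powr (1 - s)) / (s - 1))
        sums (1 / (s - 1))"
    by (simp add: diff_divide_distrib)
  have "summable (\<lambda>j. integral_remainder j s)"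
    by (rule summable_comparison_test'[OF summable_powr_2, of 0]) (use integral_remainder_bound[OF
          s] in auto)
  from sums_add[OF 1 summable_sums[OF this]]
  show "(\<lambda>j. real (Suc j) powr (- s)) sums (1 / (s - 1) + (\<Sum>j. integral_remainder j s))"
    by (simp add: integral_remainder_def)
  have "summable (\<lambda>j. count_error_term j s)"
    by (rule summable_comparison_test'[OF summable_powr_3_2, of 0]) (use count_error_term_bound[OF
          s] in auto)
  then show "(\<lambda>j. count_error (Suc j) * (real (Suc j) powr (- s) - real (Suc (Suc j)) powr (- s)))
        sums (\<Sum>j. count_error_term j s)"
    unfolding count_error_term_def by (rule summable_sums)
  show "(\<lambda>n. count_error n * real (Suc n) powr (- s)) \<longlonglongrightarrow> 0"
  proof (rule Lim_null_comparison)
    show "\<forall>\<^sub>F n in sequentially. norm (count_error n * real (Suc n) powr (- s)) \<le>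
        2 * sqrt (real n) * (real n + 1) powr (- s)"
    proof (intro always_eventually allI)
      fix n
      show "norm (count_error n * real (Suc n) powr (- s))
            \<le> 2 * sqrt (real n) * (real n + 1) powr (- s)"
        unfolding real_norm_def abs_mult
        by (intro mult_mono) (use abs_count_error_le[of n] in \<open>auto simp: add.commute\<close>)
    qed
    show "(\<lambda>n. 2 * sqrt (real n) * (real n + 1) powr (- s)) \<longlonglongrightarrow> 0"
      using s by real_asymp
  qed
qed

text \<open>Tannery's theorem, with the majorants just proved, takes the limit in each term; the
  limits of \<open>integral_remainder\<close> form the logarithmic series for
  \<open>euler_mascheroni\<close>.\<close>

lemma epstein_real_tendsto: "((\<lambda>s. epstein_real s - pi / 4 / (s - 1)) \<longlongrightarrow> zeta_const) (at_right 1)"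
proof -
  have ev: "\<forall>\<^sub>F s in at_right (1::real). 1 < s \<and> s \<le> 2"
    unfolding eventually_at_right_field by (auto intro!: exI[of _ 2])
  have e: "\<forall>\<^sub>F (j, s) in at_top \<times>\<^sub>F at_right 1. norm (integral_remainder j s)
        \<le> 2 * real (Suc j) powr (- 2)"
    using eventually_prodI[OF eventually_True ev]
          by eventually_elim (use integral_remainder_bound in auto)
  have c: "\<forall>\<^sub>F (j, s) in at_top \<times>\<^sub>F at_right 1. norm (count_error_term j s)
        \<le> 4 * (1 * real (Suc j)) powr (- 3 / 2)"
    using eventually_prodI[OF eventually_True ev]
          by eventually_elim (use count_error_term_bound in auto)
  have el: "((\<lambda>s. integral_remainder j s) \<longlongrightarrow> inverse (real (j + 1)) + ln (real (j + 1))
        - ln (real (j + 2))) (at_right 1)" for j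
  proof -
    define a b where "a = real (Suc j)" and "b = real (Suc (Suc j))"
    have ab: "0 < a" "0 < b" by (auto simp: a_def b_def)
    \<comment> \<open>Subtracting 1 from both powers leaves \<open>integral_remainder\<close>
      unchanged and turns each quotient into a difference quotient of \<open>x powr (1 - s)\<close>
      at \<open>s = 1\<close>.\<close>
    have d: "((\<lambda>s. (x powr (1 - s) - 1) / (s - 1)) \<longlongrightarrow> - ln x) (at_right 1)" if "0 < x" for x :: real
    proof -
      have "((\<lambda>s. x powr (1 - s)) has_real_derivative - ln x) (at 1)"
        using that by (auto intro!: derivative_eq_intros)
      then have "((\<lambda>s. (x powr (1 - s) - 1) / (s - 1)) \<longlongrightarrow> - ln x) (at 1)"
        using that by (simp add: has_field_derivative_iff)
      then show ?thesis by (rule tendsto_mono[rotated]) (simp add: at_le)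
    qed
    have "((\<lambda>s. a powr (- s) - ((a powr (1 - s) - 1) / (s - 1) - (b powr (1 - s) - 1) / (s - 1)))
        \<longlongrightarrow> a powr (- 1) - (- ln a - (- ln b))) (at_right 1)"
      using ab by (intro tendsto_intros d) auto
    moreover have "(\<lambda>s. a powr (- s) - ((a powr (1 - s) - 1) / (s - 1) - (b powr (1 - s) - 1) / (s
          - 1))) = integral_remainder j"
      by (rule ext) (simp add: integral_remainder_def a_def b_def diff_divide_distrib)
    moreover have "a powr (- 1) - (- ln a - (- ln b)) = inverse (real (j + 1)) + ln (real (j + 1))
          - ln (real (j + 2))"
      using ab by (simp add: powr_minus a_def b_def add.commute)
    ultimately show ?thesis by simp
  qed
  have cl: "((\<lambda>s. count_error_term j s) \<longlongrightarrow> count_error (Suc j) * (1 / real (Suc j) - 1 / real (Suc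
        (Suc j)))) (at_right 1)" for j
  proof -
    have "((\<lambda>s. count_error_term j s) \<longlongrightarrow> count_error (Suc j) * (real (Suc j) powr (- 1)
          - real (Suc (Suc j)) powr (- 1))) (at_right 1)"
      unfolding count_error_term_def by (intro tendsto_intros) auto
    then show ?thesis by (simp add: powr_minus divide_inverse del: of_nat_Suc)
  qed
  have "((\<lambda>s. \<Sum>j. integral_remainder j s) \<longlongrightarrow> (\<Sum>j. inverse (real (j + 1)) + ln (real (j + 1))
        - ln (real (j + 2)))) (at_right 1)"
    using tannerys_theorem[OF el e summable_powr_2] by simp
  moreover have "(\<Sum>j. inverse (real (j + 1)) + ln (real (j + 1)) - ln (real (j + 2)))
        = euler_mascheroni"
    using euler_mascheroni_sum_real by (rule sums_unique[symmetric])
  ultimately have 1: "((\<lambda>s. \<Sum>j. integral_remainder j s) \<longlongrightarrow> euler_mascheroni) (at_right 1)" by simp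
  have 2: "((\<lambda>s. \<Sum>j. count_error_term j s) \<longlongrightarrow> (\<Sum>j. count_error (Suc j) * (1 / real (Suc j)
        - 1 / real (Suc (Suc j))))) (at_right 1)"
    using tannerys_theorem[OF cl c summable_powr_3_2] by simp
  have "((\<lambda>s. pi / 4 * (\<Sum>j. integral_remainder j s) + (\<Sum>j. count_error_term j s))
        \<longlongrightarrow> zeta_const) (at_right 1)"
    unfolding zeta_const_def by (intro tendsto_intros 1 2)
  also have "(\<lambda>s. pi / 4 * (\<Sum>j. integral_remainder j s) + (\<Sum>j. count_error_term j s))
        = (\<lambda>s. epstein_real s - pi / 4 / (s - 1))"
    unfolding epstein_real_def distrib_left by (rule ext) simp
  finally show ?thesis .
qed

lemma epstein_index_has_sum:
  assumes s: "1 < s" "s \<le> 2"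
  shows "((\<lambda>v. real (epstein_entry v) powr (- s)) has_sum epstein_real s) epstein_index"
proof -
  define B where "B = (\<lambda>j. {v \<in> epstein_index. epstein_entry v = Suc j})"
  define f where "f = (\<lambda>(j :: nat, v). real (epstein_entry v) powr (- s))"
  have row: "((\<lambda>v. f (j, v)) has_sum (real (entry_mult (Suc j)) * real (Suc j) powr (- s))) (B j)"
        for j
  proof (rule has_sum_finiteI)
    show "finite (B j)" by (simp add: B_def finite_entry_eq)
    have "sum (\<lambda>v. f (j, v)) (B j) = (\<Sum>v\<in>B j. real (Suc j) powr (- s))"
      by (intro sum.cong) (auto simp: f_def B_def)
    then show "real (entry_mult (Suc j)) * real (Suc j) powr (- s) = sum (\<lambda>v. f (j, v)) (B j)"
      by (simp add: entry_mult_def B_def)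
  qed
  have col: "((\<lambda>j. real (entry_mult (Suc j)) * real (Suc j) powr (- s))
        has_sum epstein_real s) UNIV"
    using entry_mult_powr_sums_aux[OF s] by (intro sums_nonneg_imp_has_sum) auto
  have "(f has_sum epstein_real s) (SIGMA j:UNIV. B j)"
    by (rule has_sum_SigmaI[OF row col] summable_on_SigmaI[OF row] has_sum_imp_summable[OF col])+
       (auto simp: f_def)
  also have "?this \<longleftrightarrow> ((\<lambda>v. real (epstein_entry v) powr (- s)) has_sum epstein_real s) epstein_index"
    using epstein_entry_pos
    by (intro has_sum_reindex_bij_witness[of _
          "\<lambda>v. (epstein_entry v - 1, v)" snd]) (auto simp: f_def B_def)
  finally show ?thesis .
qed

lemma summable_on_epstein_index:
  assumes "1 < s"
  shows "(\<lambda>v. real (epstein_entry v) powr (- s)) summable_on epstein_index"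
proof (rule summable_on_comparison_test)
  \<comment> \<open>The sum is known for exponents up to 2 only; larger exponents are dominated by
    exponent 2, as all entries are at least 1.\<close>
  show "(\<lambda>v. real (epstein_entry v) powr (- min s 2)) summable_on epstein_index"
    using has_sum_imp_summable[OF epstein_index_has_sum[of "min s 2"]] assms by simp
  fix v assume "v \<in> epstein_index"
  then have "1 \<le> epstein_entry v" using epstein_entry_pos[of v] by simp
  then show "real (epstein_entry v) powr (- s) \<le> real (epstein_entry v) powr (- min s 2)"
    by (intro powr_mono) auto
qed auto

lemma epstein_series_of_real:
  assumes s: "1 < s" "s \<le> 2"
  shows "(\<Sum>\<^sub>\<infinity>v\<in>epstein_index. of_nat (epstein_entry v) powr (- complex_of_real s))
        = complex_of_real (epstein_real s)"
proof (rule infsumI)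
  have "((\<lambda>v. complex_of_real (real (epstein_entry v) powr (- s)))
        has_sum complex_of_real (epstein_real s)) epstein_index"
    by (intro has_sum_of_real epstein_index_has_sum s)
  also have "?this \<longleftrightarrow> ((\<lambda>v. of_nat (epstein_entry v) powr (- complex_of_real s))
        has_sum complex_of_real (epstein_real s)) epstein_index"
    using powr_of_real[of "real (epstein_entry v)" "- s" for v] by (intro has_sum_cong) simp
  finally show "((\<lambda>v. of_nat (epstein_entry v) powr (- complex_of_real s))
        has_sum complex_of_real (epstein_real s)) epstein_index" .
qed

section \<open>Meromorphic continuation\<close>

text \<open>Averaging an alternating series with its shift by one replaces the terms by these half
  differences, as in Euler's transformation of series.\<close>

definition half_diff :: "(complex \<Rightarrow> complex) \<Rightarrow> complex \<Rightarrow> complex" where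
  "half_diff f z = (f z - f (z + 1)) / 2"

text \<open>Cauchy's estimate: \<open>z\<close> and \<open>z + 1\<close> lie in the disc of radius
  \<open>3 r / 4\<close> because \<open>r \<ge> 4\<close>, and discs of radius \<open>r / 8\<close>
  about its points stay inside the large disc. One difference thus gains a factor
  \<open>1 / r\<close> at the price of half the radius.\<close>

lemma half_diff_bound:
  assumes hol: "f holomorphic_on ball x r" and bd: "\<And>z. z \<in> ball x r \<Longrightarrow> norm (f z) \<le> B"
    and r: "4 \<le> r" and z: "z \<in> ball x (r / 2)"
  shows "norm (half_diff f z) \<le> 4 * B / r"
proof -
  define S where "S = ball x (3 / 4 * r)"
  have zS: "z \<in> S" "z + 1 \<in> S"
  proof -
    have z': "norm (x - z) < r / 2" using z by (simp add: dist_norm)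
    then show "z \<in> S" using r by (simp add: S_def dist_norm)
    have "norm (x - (z + 1)) \<le> norm (x - z) + norm (1 :: complex)"
      using norm_triangle_ineq4[of "x - z" 1] by (simp add: algebra_simps)
    then show "z + 1 \<in> S" using z' r by (simp add: S_def dist_norm)
  qed
  have "norm (f z - f (z + 1)) \<le> 8 * B / r * norm (z - (z + 1))"
  proof (rule field_differentiable_bound[where S = S])
    show "convex S" by (simp add: S_def)
    fix w assume w: "w \<in> S"
    have sub: "cball w (r / 8) \<subseteq> ball x r"
    proof
      fix u assume "u \<in> cball w (r / 8)"
      then have "dist w u \<le> r / 8" "dist x w < 3 / 4 * r" using w by (auto simp: S_def)
      then show "u \<in> ball x r" using dist_triangle[of x u w] r by simp
    qed
    have "w \<in> ball x r" using w r by (simp add: S_def)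
    then have "f field_differentiable at w"
      using hol holomorphic_on_imp_differentiable_at open_ball by blast
    then show "(f has_field_derivative deriv f w) (at w within S)"
      using field_differentiable_derivI has_field_derivative_at_within by blast
    have "norm ((deriv ^^ 1) f w) \<le> fact 1 * B / (r / 8) ^ 1"
    proof (rule Cauchy_inequality)
      show "f holomorphic_on ball w (r / 8)" "continuous_on (cball w (r / 8)) f"
        using sub hol ball_subset_cball[of w "r / 8"]
        by (meson holomorphic_on_subset subset_trans, meson holomorphic_on_imp_continuous_on
              holomorphic_on_subset)
      show "0 < r / 8" using r by simp
      fix u assume "norm (w - u) = r / 8"
      then have "u \<in> cball w (r / 8)" by (simp add: dist_norm)
      then show "norm (f u) \<le> B" using sub bd by blast
    qed
    then show "norm (deriv f w) \<le> 8 * B / r" by (simp add: mult.commute)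
  qed (use zS in auto)
  then show ?thesis by (simp add: half_diff_def norm_divide)
qed

lemma half_diff_holomorphic:
  assumes hol: "f holomorphic_on ball x r" and r: "4 \<le> r"
  shows "half_diff f holomorphic_on ball x (r / 2)"
proof -
  have "(\<lambda>z. z + 1) ` ball x (r / 2) \<subseteq> ball x r"
  proof safe
    fix z assume "z \<in> ball x (r / 2)"
    then have "norm (x - z) < r / 2" by (simp add: dist_norm)
    moreover have "norm (x - (z + 1)) \<le> norm (x - z) + norm (1 :: complex)"
      using norm_triangle_ineq4[of "x - z" 1] by (simp add: algebra_simps)
    ultimately show "z + 1 \<in> ball x r" using r by (simp add: dist_norm)
  qed
  moreover have "ball x (r / 2) \<subseteq> ball x r" using r by (intro subset_ball) auto
  ultimately have "(f \<circ> (\<lambda>z. z + 1)) holomorphic_on ball x (r / 2)"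
        "f holomorphic_on ball x (r / 2)"
    using hol by (auto intro!: holomorphic_on_compose_gen[OF _ hol] holomorphic_intros intro:
          holomorphic_on_subset)
  then show ?thesis
    unfolding half_diff_def o_def by (intro holomorphic_intros) auto
qed

text \<open>The constant depends on \<open>N\<close> alone, since the induction passes from
  \<open>f\<close> to \<open>half_diff f\<close> on the halved disc; the condition on
  \<open>r\<close> keeps the radius at least 4 in all \<open>N\<close> steps.\<close>

lemma half_diff_iterate_bound:
  "\<exists>C\<ge>0. \<forall>f x r B. f holomorphic_on ball x r \<longrightarrow> (\<forall>z\<in>ball x r. norm (f z) \<le> B) \<longrightarrow> 4 * 2 ^ N \<le> r \<longrightarrow>
      norm ((half_diff ^^ N) f x) \<le> C * B / r ^ N"
proof (induction N)
  case 0
  show ?case by (intro exI[of _ 1]) auto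
next
  case (Suc N)
  then obtain C where C: "0 \<le> C" and *: "\<And>f x r B. f holomorphic_on ball x r \<Longrightarrow>
        (\<forall>z\<in>ball x r. norm (f z) \<le> B) \<Longrightarrow>
      4 * 2 ^ N \<le> r \<Longrightarrow> norm ((half_diff ^^ N) f x) \<le> C * B / r ^ N"
    by blast
  show ?case
  proof (intro exI[of _ "C * 4 * 2 ^ N"] conjI allI impI)
    fix f :: "complex \<Rightarrow> complex" and x r B
    assume hol: "f holomorphic_on ball x r" and bd: "\<forall>z\<in>ball x r. norm (f z) \<le> B" and r:
          "4 * 2 ^ Suc N \<le> r"
    have r4: "4 \<le> r" using r one_le_power[of "2::real" "Suc N"] by linarith
    have "norm ((half_diff ^^ N) (half_diff f) x) \<le> C * (4 * B / r) / (r / 2) ^ N"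
      using half_diff_bound[OF hol _ r4] bd r by (intro * half_diff_holomorphic[OF hol r4]) auto
    also have "(half_diff ^^ N) (half_diff f) = (half_diff ^^ Suc N) f"
      by (simp add: funpow_swap1)
    also have "C * (4 * B / r) / (r / 2) ^ N = C * 4 * 2 ^ N * B / r ^ Suc N"
      by (simp add: power_divide field_simps)
    finally show "norm ((half_diff ^^ Suc N) f x) \<le> C * 4 * 2 ^ N * B / r ^ Suc N" .
  qed (use C in auto)
qed

section \<open>Differenced lattice terms and their decay\<close>

definition lattice_norm :: "int \<times> int \<Rightarrow> real" where
  "lattice_norm v = (of_int (fst v))\<^sup>2 + (of_int (snd v))\<^sup>2"

text \<open>Differences are taken in the first coordinate, which becomes a complex variable so that
  Cauchy's estimate applies. For \<open>N = 0\<close> this is the usual term, and it is 0 at the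
  zero vector because \<open>0 powr w = 0\<close>.\<close>

definition lattice_term :: "nat \<Rightarrow> complex \<Rightarrow> int \<times> int \<Rightarrow> complex" where
  "lattice_term N s v = (half_diff ^^ N) (\<lambda>z. (z\<^sup>2 + (of_int (snd v))\<^sup>2) powr (- s)) (of_int (fst
      v))"

lemma lattice_term_0: "lattice_term 0 s v = complex_of_real (lattice_norm v) powr (- s)"
  by (simp add: lattice_term_def lattice_norm_def)

lemma lattice_term_Suc: "lattice_term (Suc N) s (a, b)
      = (lattice_term N s (a, b) - lattice_term N s (a + 1, b)) / 2"
  by (simp add: lattice_term_def half_diff_def)

lemma lattice_term_holomorphic: "(\<lambda>s. lattice_term N s v) holomorphic_on A"
proof -
  have "(\<lambda>s. (half_diff ^^ N) (\<lambda>z. (z\<^sup>2 + c) powr (- s)) z) holomorphic_on A" for c z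
  proof (induction N arbitrary: z)
    case 0
    show ?case by (auto intro!: holomorphic_intros)
  next
    case (Suc N)
    have "(\<lambda>s. ((half_diff ^^ N) (\<lambda>z. (z\<^sup>2 + c) powr (- s)) z - (half_diff ^^ N) (\<lambda>z.
          (z\<^sup>2 + c) powr (- s)) (z + 1)) / 2)
        holomorphic_on A"
      by (intro holomorphic_intros Suc) auto
    then show ?case by (simp add: half_diff_def[of "(half_diff ^^ N) _"])
  qed
  then show ?thesis by (simp add: lattice_term_def)
qed

text \<open>The modulus is \<open>exp (- Re s * ln (norm u) + Im s * Im (Ln u))\<close>; the
  argument is at most \<open>pi\<close> in absolute value and \<open>ln (norm u)\<close> is within
  \<open>ln 4\<close> of \<open>ln q\<close>.\<close>

lemma norm_powr_complex_le:
  fixes u s :: complex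
  assumes q: "0 < q" and u: "q / 4 \<le> norm u" "norm u \<le> 4 * q" and s: "norm s \<le> S"
  shows "norm (u powr (- s)) \<le> exp (S * pi + S * ln 4) * q powr (- Re s)"
proof -
  have u0: "u \<noteq> 0" "0 < norm u" using u q by auto
  have "norm (u powr (- s)) = exp (Re (- s * Ln u))" using u0 by (simp add: powr_def norm_exp_eq_Re)
  also have "Re (- s * Ln u) = - Re s * ln (norm u) + Im s * Im (Ln u)" using u0 by simp
  also have "\<dots> \<le> - Re s * ln q + S * ln 4 + S * pi"
  proof -
    have sS: "\<bar>Re s\<bar> \<le> S" "\<bar>Im s\<bar> \<le> S" using s abs_Re_le_cmod[of s] abs_Im_le_cmod[of s] by auto
    have "\<bar>Im s * Im (Ln u)\<bar> \<le> S * pi"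
      unfolding abs_mult using sS Im_Ln_le_pi[OF u0(1)] mpi_less_Im_Ln[OF u0(1)]
            by (intro mult_mono) auto
    moreover have "ln q - ln 4 \<le> ln (norm u)" "ln (norm u) \<le> ln q + ln 4"
    proof -
      have "ln (q / 4) \<le> ln (norm u)" using u q by (intro ln_mono) auto
      then show "ln q - ln 4 \<le> ln (norm u)" using q by (simp add: ln_div)
      have "ln (norm u) \<le> ln (4 * q)" using u q u0 by (intro ln_mono) auto
      then show "ln (norm u) \<le> ln q + ln 4" using q by (simp add: ln_mult)
    qed
    then have "\<bar>Re s * (ln q - ln (norm u))\<bar> \<le> S * ln 4"
      unfolding abs_mult using sS by (intro mult_mono) auto
    then have "- Re s * ln (norm u) \<le> - Re s * ln q + S * ln 4" by (simp add: algebra_simps)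
    ultimately show ?thesis by linarith
  qed
  finally have "norm (u powr (- s)) \<le> exp (- Re s * ln q + S * ln 4 + S * pi)" by simp
  also have "\<dots> = exp (S * pi + S * ln 4) * q powr (- Re s)"
    using q by (simp add: powr_def mult_exp_exp add_ac)
  finally show ?thesis .
qed

text \<open>On the disc about \<open>a\<close> whose radius \<open>r\<close> is a quarter of the
  length of \<open>v\<close>, the value \<open>z^2 + b^2\<close> differs from
  \<open>lattice_norm v\<close> by at most \<open>9 r^2\<close>, that is \<open>9 / 16\<close> of
  it. So it avoids the branch cut and keeps its size, and \<open>N\<close> differences gain
  \<open>r^(-N)\<close>. Taking \<open>r\<close> from the whole vector gives the gain also when
  \<open>a\<close> is small and \<open>b\<close> large.\<close>

lemma lattice_term_bound:
  "\<exists>C\<ge>0. \<forall>s v. norm s \<le> S \<longrightarrow> 16 * 2 ^ N \<le> sqrt (lattice_norm v) \<longrightarrow>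
      norm (lattice_term N s v) \<le> C * lattice_norm v powr (- (Re s + real N / 2))"
proof -
  obtain C where C: "0 \<le> C" and *: "\<And>f x r B. f holomorphic_on ball x r \<Longrightarrow> (\<forall>z\<in>ball x r. norm (f z)
        \<le> B) \<Longrightarrow>
      4 * 2 ^ N \<le> r \<Longrightarrow> norm ((half_diff ^^ N) f x) \<le> C * B / r ^ N"
    using half_diff_iterate_bound[of N] by blast
  define K where "K = exp (S * pi + S * ln 4)"
  show ?thesis
  proof (intro exI[of _ "C * K * 4 ^ N"] conjI allI impI)
    fix s :: complex and v assume s: "norm s \<le> S" and v: "16 * 2 ^ N \<le> sqrt (lattice_norm v)"
    obtain a b where ab: "v = (a, b)" by (cases v)
    define Q where "Q = lattice_norm v"
    define r where "r = sqrt Q / 4"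
    have r: "4 * 2 ^ N \<le> r" using v by (simp add: r_def Q_def)
    have r0: "0 < r" using r by (rule less_le_trans[rotated]) simp
    have Q: "0 < Q" using r0 by (simp add: r_def)
    have rQ: "r\<^sup>2 = Q / 16" using Q by (simp add: r_def power_divide)
    have aQ: "norm (of_int a :: complex) \<le> 4 * r"
    proof -
      have "(of_int a)\<^sup>2 \<le> Q" by (simp add: Q_def lattice_norm_def ab)
      then have "\<bar>of_int a\<bar> \<le> sqrt Q" using real_le_rsqrt[of "\<bar>of_int a\<bar>" Q] by simp
      then show ?thesis by (simp add: r_def)
    qed
    let ?w = "\<lambda>z :: complex. z\<^sup>2 + (of_int b)\<^sup>2"
    have close: "norm (?w z - of_real Q) \<le> 9 / 16 * Q" if z: "z \<in> ball (of_int a) r"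
          for z :: complex
    proof -
      define w where "w = z - of_int a"
      have w: "norm w \<le> r" using z by (simp add: w_def dist_norm norm_minus_commute)
      have "?w z - of_real Q = 2 * of_int a * w + w\<^sup>2"
        by (simp add: Q_def lattice_norm_def ab w_def power2_eq_square algebra_simps)
      also have "norm \<dots> \<le> norm (2 * of_int a * w) + norm (w\<^sup>2)" by (rule norm_triangle_ineq)
      also have "\<dots> = 2 * norm (of_int a :: complex) * norm w + norm w ^ 2"
            by (simp add: norm_mult norm_power)
      also have "\<dots> \<le> 2 * (4 * r) * r + r ^ 2"
        using aQ w r0 by (intro add_mono mult_mono power_mono) auto
      also have "\<dots> = 9 * r\<^sup>2" by (simp add: power2_eq_square)
      finally show ?thesis unfolding rQ by simp
    qed
    have pos: "?w z \<notin> \<real>\<^sub>\<le>\<^sub>0" if "z \<in> ball (of_int a) r" for z :: complex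
    proof -
      have "\<bar>Re (?w z - of_real Q)\<bar> \<le> 9 / 16 * Q"
        using close[OF that] abs_Re_le_cmod order_trans by blast
      moreover have "Re (?w z - of_real Q) = Re (?w z) - Q" by simp
      ultimately have "0 < Re (?w z)" using Q unfolding abs_le_iff by linarith
      then show ?thesis by (auto simp: complex_nonpos_Reals_iff)
    qed
    have "norm ((half_diff ^^ N) (\<lambda>z. (?w z) powr (- s)) (of_int a))
          \<le> C * (K * Q powr (- Re s)) / r ^ N"
    proof (rule *[OF _ _ r])
      show "(\<lambda>z. (?w z) powr (- s)) holomorphic_on ball (of_int a) r"
        using pos by (intro holomorphic_intros)
      show "\<forall>z\<in>ball (of_int a) r. norm ((?w z) powr (- s)) \<le> K * Q powr (- Re s)"
      proof
        fix z :: complex assume z: "z \<in> ball (of_int a) r"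
        have "norm (of_real Q :: complex) = Q" using Q by simp
        with close[OF z] norm_triangle_ineq2[of "of_real Q" "?w z"]
          norm_triangle_ineq2[of "?w z" "of_real Q"]
        have "Q / 4 \<le> norm (?w z)" "norm (?w z) \<le> 4 * Q"
          using Q by (auto simp: norm_minus_commute)
        from norm_powr_complex_le[OF Q this s] show "norm ((?w z) powr (- s)) \<le> K * Q powr (- Re s)"
          by (simp add: K_def)
      qed
    qed
    also have "r ^ N = Q powr (real N / 2) / 4 ^ N"
    proof -
      have "sqrt Q ^ N = (Q powr (1 / 2)) ^ N" using Q by (simp add: powr_half_sqrt)
      also have "\<dots> = Q powr (real N / 2)" using Q by (subst powr_power) auto
      finally show ?thesis by (simp add: r_def power_divide)
    qed
    also have "C * (K * Q powr (- Re s)) / (Q powr (real N / 2) / 4 ^ N)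
          = C * K * 4 ^ N * (Q powr (- Re s) / Q powr (real N / 2))"
      by simp
    also have "Q powr (- Re s) / Q powr (real N / 2) = Q powr (- (Re s + real N / 2))"
      by (simp add: powr_diff[symmetric])
    finally show "norm (lattice_term N s v) \<le> C * K * 4 ^ N * lattice_norm v powr (- (Re s
          + real N / 2))"
      by (simp add: lattice_term_def ab Q_def)
  qed (use C in \<open>auto simp: K_def\<close>)
qed

lemma lattice_norm_summable:
  assumes p: "1 < p"
  shows "(\<lambda>v. lattice_norm v powr (- p)) summable_on UNIV"
proof -
  define sg where "sg = (\<lambda>(e :: int, e' :: int) (m :: nat, n :: nat). (e * int m, e' * int n))"
  have 1: "(\<lambda>v. lattice_norm v powr (- p)) summable_on (sg e ` epstein_index)" if
        "e \<in> {-1, 1} \<times> {-1, 1}" for e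
  proof -
    have inj: "inj_on (sg e) epstein_index"
      using that by (auto simp: inj_on_def sg_def)
    have "((\<lambda>v. lattice_norm v powr (- p)) \<circ> sg e) = (\<lambda>v. real (epstein_entry v) powr (- p))"
      using that by (auto simp: fun_eq_iff sg_def lattice_norm_def epstein_entry_def
            power_mult_distrib)
    then show ?thesis
      using summable_on_epstein_index[OF p] by (simp add: summable_on_reindex[OF inj])
  qed
  \<comment> \<open>The four reflected quadrants overlap on the axes, so the union is not
    disjoint.\<close>
  have un: "f summable_on (A \<union> B)" if "f summable_on A" "f summable_on B"
    for f :: "int \<times> int \<Rightarrow> real" and A B
  proof -
    have "f summable_on (A \<union> (B - A))"
      using that by (intro summable_on_Un_disjoint) (auto intro: summable_on_subset_banach)
    then show ?thesis by simp
  qed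
  let ?A = "\<lambda>a b. sg (a, b) ` epstein_index"
  let ?U = "{(0, 0)} \<union> (?A 1 1 \<union> (?A 1 (-1) \<union> (?A (-1) 1 \<union> ?A (-1) (-1))))"
  have "(\<lambda>v. lattice_norm v powr (- p)) summable_on ?U"
    by (intro un 1) auto
  also have "?U = UNIV"
  proof (intro equalityI subsetI UNIV_I)
    fix v :: "int \<times> int"
    obtain a b where v: "v = (a, b)" by (cases v)
    define m where "m = (nat \<bar>a\<bar>, nat \<bar>b\<bar>)"
    have "v = (0, 0) \<or> m \<in> epstein_index" by (auto simp: v m_def epstein_index_def)
    moreover have "v = sg (1, 1) m \<or> v = sg (1, -1) m \<or> v = sg (-1, 1) m \<or> v = sg (-1, -1) m"
      by (auto simp: v m_def sg_def abs_if)
    ultimately show "v \<in> ?U" by blast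
  qed
  finally show ?thesis .
qed

section \<open>Alternating sums and their entire extensions\<close>

definition alternating_term :: "nat \<Rightarrow> complex \<Rightarrow> int \<times> int \<Rightarrow> complex" where
  "alternating_term N s v = (if even (fst v + snd v) then 1 else - 1) * lattice_term N s v"

text \<open>\<open>Y\<close> restricts the second coordinate: \<open>UNIV\<close> gives the plane
  and \<open>{0}\<close> the axis. Shifts of the first coordinate preserve
  \<open>UNIV \<times> Y\<close>, so both cases are treated together.\<close>

definition alternating_sum :: "int set \<Rightarrow> nat \<Rightarrow> complex \<Rightarrow> complex" where
  "alternating_sum Y N s = (\<Sum>\<^sub>\<infinity>v\<in>UNIV \<times> Y. alternating_term N s v)"

lemma finite_lattice_norm_less: "finite {v. sqrt (lattice_norm v) < r}"
proof (rule finite_subset)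
  define k where "k = \<lceil>r\<rceil>"
  show "{v. sqrt (lattice_norm v) < r} \<subseteq> {-k..k} \<times> {-k..k}"
  proof
    fix v assume v: "v \<in> {v. sqrt (lattice_norm v) < r}"
    have "\<bar>of_int (fst v)\<bar> \<le> sqrt (lattice_norm v)" "\<bar>of_int (snd v)\<bar> \<le> sqrt (lattice_norm v)"
      unfolding lattice_norm_def by (auto intro!: real_le_rsqrt)
    with v have "\<bar>real_of_int (fst v)\<bar> \<le> r" "\<bar>real_of_int (snd v)\<bar> \<le> r" by auto
    then have "\<bar>fst v\<bar> \<le> k" "\<bar>snd v\<bar> \<le> k" unfolding k_def by linarith+
    then show "v \<in> {-k..k} \<times> {-k..k}" by (cases v) auto
  qed
qed simp

text \<open>Finitely many short vectors are bounded by compactness of the disc, all others by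
  \<open>lattice_term_bound\<close>. The majorant yields both absolute summability and holomorphy of
  the sum.\<close>

lemma alternating_term_majorant:
  assumes s0: "1 - real N / 2 < Re s0"
  obtains r M where "0 < r" "M summable_on (UNIV :: (int \<times> int) set)"
    "\<And>s v. s \<in> cball s0 r \<Longrightarrow> norm (alternating_term N s v) \<le> M v"
proof -
  \<comment> \<open>Half the distance to the boundary line: the exponent \<open>p\<close> becomes
    \<open>1 + r\<close>, and every \<open>s\<close> in the disc has exponent at least
    \<open>p\<close>.\<close>
  define r where "r = (Re s0 - (1 - real N / 2)) / 2"
  have r: "0 < r" using s0 by (simp add: r_def)
  define p where "p = Re s0 - r + real N / 2"
  have p: "1 < p" using s0 by (simp add: p_def r_def field_simps)
  obtain C where C: "0 \<le> C" "\<And>s v. norm s \<le> norm s0 + r \<Longrightarrow> 16 * 2 ^ N \<le> sqrt (lattice_norm v) \<Longrightarrow>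
      norm (lattice_term N s v) \<le> C * lattice_norm v powr (- (Re s + real N / 2))"
    using lattice_term_bound[of "norm s0 + r" N] by blast
  have "\<exists>m. \<forall>s\<in>cball s0 r. norm (lattice_term N s v) \<le> m" for v
  proof -
    have "compact ((\<lambda>s. norm (lattice_term N s v)) ` cball s0 r)"
      by (intro compact_continuous_image continuous_intros compact_cball
            holomorphic_on_imp_continuous_on lattice_term_holomorphic)
    then show ?thesis
      by (auto dest!: compact_imp_bounded simp: bounded_iff)
  qed
  then obtain m where m: "\<And>v s. s \<in> cball s0 r \<Longrightarrow> norm (lattice_term N s v) \<le> m v" by metis
  define M where "M = (\<lambda>v. if sqrt (lattice_norm v) < 16 * 2 ^ N then m v else C * lattice_norm v
        powr (- p))"
  have "(\<lambda>v. C * lattice_norm v powr (- p)) summable_on (UNIV - {v. sqrt (lattice_norm v)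
        < 16 * 2 ^ N})"
    using summable_on_cmult_right[OF lattice_norm_summable[OF p]]
          by (rule summable_on_subset_banach) auto
  then have "M summable_on (UNIV - {v. sqrt (lattice_norm v) < 16 * 2 ^ N})"
    by (rule summable_on_cong[THEN iffD1, rotated]) (auto simp: M_def)
  moreover have "M summable_on {v. sqrt (lattice_norm v) < 16 * 2 ^ N}"
    by (intro summable_on_finite finite_lattice_norm_less)
  ultimately have "M summable_on ((UNIV - {v. sqrt (lattice_norm v) < 16 * 2 ^ N}) \<union> {v.
        sqrt (lattice_norm v) < 16 * 2 ^ N})"
    by (intro summable_on_Un_disjoint) auto
  then have Ms: "M summable_on UNIV" by (simp add: Un_Diff_cancel2)
  have "norm (alternating_term N s v) \<le> M v" if s: "s \<in> cball s0 r" for s v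
  proof -
    have eq: "norm (alternating_term N s v) = norm (lattice_term N s v)"
      by (simp add: alternating_term_def norm_mult)
    show ?thesis
    proof (cases "sqrt (lattice_norm v) < 16 * 2 ^ N")
      case True
      then show ?thesis using m[OF s] by (simp add: eq M_def)
    next
      case False
      have d: "norm (s - s0) \<le> r" using s by (simp add: dist_norm norm_minus_commute)
      have "norm s \<le> norm s0 + r" using norm_triangle_ineq2[of s s0] d by linarith
      then have "norm (lattice_term N s v) \<le> C * lattice_norm v powr (- (Re s + real N / 2))"
        using False C(2) by simp
      also have "\<dots> \<le> C * lattice_norm v powr (- p)"
      proof (intro mult_left_mono C(1) powr_mono)
        have "Re s0 - r \<le> Re s" using d abs_Re_le_cmod[of "s - s0"] by simp
        then show "- (Re s + real N / 2) \<le> - p" by (simp add: p_def)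
        have "(1::real) \<le> 2 ^ N" by (rule one_le_power) simp
        then have "1 \<le> sqrt (lattice_norm v)" using False by linarith
        then show "1 \<le> lattice_norm v" by simp
      qed
      finally show ?thesis using False by (simp add: eq M_def)
    qed
  qed
  with r Ms show ?thesis by (rule that)
qed

lemma alternating_term_summable:
  assumes "1 - real N / 2 < Re s"
  shows "alternating_term N s summable_on A"
proof -
  obtain r M where "0 < r" "M summable_on (UNIV :: (int \<times> int) set)"
    "\<And>s' v. s' \<in> cball s r \<Longrightarrow> norm (alternating_term N s' v) \<le> M v"
    using alternating_term_majorant[OF assms] by blast
  then have "(\<lambda>v. norm (alternating_term N s v)) summable_on UNIV"
    by (intro Infinite_Sum.abs_summable_on_comparison_test'[of M]) auto
  then show ?thesis
    using abs_summable_summable summable_on_subset_banach by blast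
qed

lemma alternating_sum_holomorphic: "alternating_sum Y N holomorphic_on {s. 1 - real N / 2 < Re s}"
proof (rule holomorphic_onI)
  fix s0 assume "s0 \<in> {s. 1 - real N / 2 < Re s}"
  then have "1 - real N / 2 < Re s0" by simp
  from alternating_term_majorant[OF this] obtain r M where r: "0 < r" and M:
        "M summable_on (UNIV :: (int \<times> int) set)"
    "\<And>s v. s \<in> cball s0 r \<Longrightarrow> norm (alternating_term N s v) \<le> M v"
    by blast
  have lim: "uniform_limit (cball s0 r) (\<lambda>X s. \<Sum>v\<in>X. alternating_term N s v) (alternating_sum Y N)
        (finite_subsets_at_top (UNIV \<times> Y))"
    unfolding alternating_sum_def[abs_def]
  proof (rule Weierstrass_m_test_general)
    show "M summable_on (UNIV \<times> Y)" using M(1) by (rule summable_on_subset_banach) auto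
  qed (use M in auto)
  have hol: "(\<lambda>s. \<Sum>v\<in>X. alternating_term N s v) holomorphic_on A" for X A
    unfolding alternating_term_def by (intro holomorphic_intros lattice_term_holomorphic)
  have "alternating_sum Y N holomorphic_on ball s0 r"
  proof (rule holomorphic_uniform_limit[OF _ lim])
    show "\<forall>\<^sub>F X in finite_subsets_at_top (UNIV \<times> Y). continuous_on (cball s0 r) (\<lambda>s. \<Sum>v\<in>X.
          alternating_term N s v) \<and>
        (\<lambda>s. \<Sum>v\<in>X. alternating_term N s v) holomorphic_on ball s0 r"
      using hol holomorphic_on_imp_continuous_on by (intro always_eventually) blast
  qed auto
  then have "alternating_sum Y N field_differentiable at s0"
    using r by (auto intro: holomorphic_on_imp_differentiable_at)
  then show "alternating_sum Y N field_differentiable at s0 within {s. 1 - real N / 2 < Re s}"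
    by (rule field_differentiable_at_within)
qed

text \<open>Shifting the summation index by one changes all signs, so each difference step preserves the
      sum.\<close>

lemma alternating_sum_Suc:
  assumes s: "1 - real N / 2 < Re s"
  shows "alternating_sum Y (Suc N) s = alternating_sum Y N s"
proof -
  define T where "T = (\<lambda>v :: int \<times> int. (fst v + 1, snd v))"
  define h where "h = alternating_term N s"
  have bij: "bij_betw T (UNIV \<times> Y) (UNIV \<times> Y)"
    by (rule bij_betwI[of _ _ _ "\<lambda>v. (fst v - 1, snd v)"]) (auto simp: T_def)
  have hs: "h summable_on UNIV \<times> Y" unfolding h_def by (rule alternating_term_summable[OF s])
  have Ts: "(\<lambda>v. h (T v)) summable_on UNIV \<times> Y" using hs
        by (subst summable_on_reindex_bij_betw[OF bij])
  have "alternating_term (Suc N) s v = 1 / 2 * (h v + h (T v))" for v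
    by (cases v) (auto simp: alternating_term_def h_def T_def lattice_term_Suc)
  then have "alternating_term (Suc N) s = (\<lambda>v. 1 / 2 * (h v + h (T v)))" by (rule ext)
  then have "alternating_sum Y (Suc N) s = (\<Sum>\<^sub>\<infinity>v\<in>UNIV \<times> Y. 1 / 2 * (h v + h (T v)))"
    by (simp only: alternating_sum_def)
  also have "\<dots> = 1 / 2 * (\<Sum>\<^sub>\<infinity>v\<in>UNIV \<times> Y. h v + h (T v))"
    by (rule infsum_cmult_right) (intro summable_on_add hs Ts)
  also have "(\<Sum>\<^sub>\<infinity>v\<in>UNIV \<times> Y. h v + h (T v)) = (\<Sum>\<^sub>\<infinity>v\<in>UNIV \<times> Y. h v) + (\<Sum>\<^sub>\<infinity>v\<in>UNIV \<times> Y. h (T v))"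
    by (rule infsum_add[OF hs Ts])
  also have "(\<Sum>\<^sub>\<infinity>v\<in>UNIV \<times> Y. h (T v)) = (\<Sum>\<^sub>\<infinity>v\<in>UNIV \<times> Y. h v)"
    by (rule infsum_reindex_bij_betw[OF bij])
  finally show ?thesis by (simp add: alternating_sum_def h_def)
qed

text \<open>The half-planes \<open>Re s > 1 - N / 2\<close> exhaust the plane and the sums for
  different \<open>N\<close> agree where both are defined, so at each point any sufficiently large
  \<open>N\<close>, such as \<open>K s\<close>, gives the value.\<close>

lemma alternating_sum_entire:
  obtains E where "E holomorphic_on UNIV" "\<And>s. 1 < Re s \<Longrightarrow> E s = alternating_sum Y 0 s"
proof -
  have stable: "alternating_sum Y (N + k) s = alternating_sum Y N s" if "1 - real N / 2 < Re s"
        for N k s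
  proof (induction k)
    case (Suc k)
    have "1 - real (N + k) / 2 \<le> 1 - real N / 2" by simp
    with that have "1 - real (N + k) / 2 < Re s" by linarith
    from alternating_sum_Suc[OF this] Suc show ?case by simp
  qed simp
  define K where "K = (\<lambda>s :: complex. nat \<lceil>2 * (1 - Re s)\<rceil> + 1)"
  have K: "1 - real (K s) / 2 < Re s" for s
  proof -
    have "2 * (1 - Re s) \<le> real (nat \<lceil>2 * (1 - Re s)\<rceil>)" by (rule real_nat_ceiling_ge)
    also have "\<dots> < real (K s)" by (simp add: K_def)
    finally show ?thesis by (simp add: field_simps)
  qed
  define E where "E = (\<lambda>s. alternating_sum Y (K s) s)"
  have E: "E s = alternating_sum Y N s" if "1 - real N / 2 < Re s" for N s
    using stable[OF that, of "K s"] stable[OF K[of s], of N] by (simp add: E_def add.commute)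
  have "E holomorphic_on UNIV"
  proof (rule holomorphic_onI)
    fix s0 :: complex
    have op: "open {s. 1 - real (K s0) / 2 < Re s}" by (rule open_halfspace_Re_gt)
    have "E holomorphic_on {s. 1 - real (K s0) / 2 < Re s}"
      using alternating_sum_holomorphic[of Y "K s0"] by (rule holomorphic_transform) (simp add: E)
    then have "E field_differentiable at s0"
      using K[of s0] op by (auto intro: holomorphic_on_imp_differentiable_at)
    then show "E field_differentiable at s0 within UNIV" by simp
  qed
  moreover have "E s = alternating_sum Y 0 s" if "1 < Re s" for s using that by (intro E) simp
  ultimately show ?thesis by (rule that)
qed

section \<open>Plain lattice sums in terms of alternating ones\<close>

lemma lattice_term_0_summable:
  assumes s: "1 < Re s"
  shows "lattice_term 0 s summable_on A"
proof -
  have "alternating_term 0 s summable_on UNIV" using s by (intro alternating_term_summable) simp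
  then have "(\<lambda>v. norm (alternating_term 0 s v)) summable_on UNIV"
    using summable_on_iff_abs_summable_on_complex by blast
  also have "(\<lambda>v. norm (alternating_term 0 s v)) = (\<lambda>v. norm (lattice_term 0 s v))"
    by (simp add: alternating_term_def norm_mult fun_eq_iff)
  finally show ?thesis using abs_summable_summable summable_on_subset_banach by blast
qed

text \<open>The alternating sum is twice the even part minus the whole, and the even part is a
  scaled copy of the whole, hence \<open>q powr (- s)\<close> times it.\<close>

lemma alternating_sum_scaling:
  assumes s: "1 < Re s"
    and inj: "inj_on f (UNIV \<times> Y)" and img: "f ` (UNIV \<times> Y) = {v \<in> UNIV \<times> Y. even (fst v + snd v)}"
    and q: "0 < q" "\<And>v. lattice_norm (f v) = q * lattice_norm v"
  shows "alternating_sum Y 0 s = (2 * of_real q powr (- s) - 1) * (\<Sum>\<^sub>\<infinity>v\<in>UNIV \<times> Y.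
        lattice_term 0 s v)"
proof -
  define h where "h = lattice_term 0 s"
  define A where "A = {v \<in> (UNIV :: int set) \<times> Y. even (fst v + snd v)}"
  define B where "B = {v \<in> (UNIV :: int set) \<times> Y. odd (fst v + snd v)}"
  have AB: "UNIV \<times> Y = A \<union> B" "A \<inter> B = {}" by (auto simp: A_def B_def)
  have hs: "h summable_on S" for S unfolding h_def by (rule lattice_term_0_summable[OF s])
  have "alternating_sum Y 0 s = infsum (alternating_term 0 s) A + infsum (alternating_term 0 s) B"
    unfolding alternating_sum_def AB(1) using s
    by (intro infsum_Un_disjoint AB(2) alternating_term_summable) auto
  also have "infsum (alternating_term 0 s) A = infsum h A"
    by (intro infsum_cong) (auto simp: alternating_term_def A_def h_def)
  also have "infsum (alternating_term 0 s) B = infsum (\<lambda>v. - h v) B"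
    by (intro infsum_cong) (auto simp: alternating_term_def B_def h_def)
  also have "\<dots> = - infsum h B" by (rule infsum_uminus)
  finally have 1: "alternating_sum Y 0 s = infsum h A - infsum h B" by simp
  have 2: "infsum h (UNIV \<times> Y) = infsum h A + infsum h B"
    unfolding AB(1) by (intro infsum_Un_disjoint hs AB(2))
  have "infsum h A = infsum (h \<circ> f) (UNIV \<times> Y)"
    unfolding A_def img[symmetric] by (rule infsum_reindex[OF inj])
  also have "h \<circ> f = (\<lambda>v. of_real q powr (- s) * h v)"
    using q by (auto simp: fun_eq_iff h_def lattice_term_0 lattice_norm_def powr_times_real)
  also have "infsum (\<lambda>v. of_real q powr (- s) * h v) (UNIV \<times> Y)
        = of_real q powr (- s) * infsum h (UNIV \<times> Y)"
    by (intro infsum_cmult_right hs)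
  finally have 3: "infsum h A = of_real q powr (- s) * infsum h (UNIV \<times> Y)" .
  have "infsum h B = infsum h (UNIV \<times> Y) - infsum h A" using 2 by simp
  then have "alternating_sum Y 0 s = 2 * infsum h A - infsum h (UNIV \<times> Y)" using 1 by simp
  then show ?thesis unfolding 3 h_def[symmetric] left_diff_distrib mult.assoc by simp
qed

text \<open>Quarter turns carry \<open>P1\<close> to \<open>P2\<close>, \<open>P3\<close> and
  \<open>P4\<close>, which together make up all nonzero vectors. The closed quadrant without the
  origin is \<open>P1\<close> together with the half-axis \<open>V\<close>, and \<open>V\<close>
  carries half of the sum over the full axis.\<close>

lemma epstein_series_lattice:
  assumes s: "1 < Re s"
  defines "h \<equiv> lattice_term 0 s"
  shows "(\<Sum>\<^sub>\<infinity>v\<in>epstein_index. of_nat (epstein_entry v) powr (- s)) =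
    (\<Sum>\<^sub>\<infinity>v\<in>UNIV \<times> UNIV. h v) / 4 + (\<Sum>\<^sub>\<infinity>v\<in>UNIV \<times> {0}. h v) / 2"
proof -
  have hs: "h summable_on S" for S unfolding h_def by (rule lattice_term_0_summable[OF s])
  have un: "infsum h (A \<union> B) = infsum h A + infsum h B" if "A \<inter> B = {}" for A B
    by (intro infsum_Un_disjoint hs that)
  define P1 where "P1 = {v :: int \<times> int. 0 < fst v \<and> 0 \<le> snd v}"
  define P2 where "P2 = {v :: int \<times> int. fst v \<le> 0 \<and> 0 < snd v}"
  define P3 where "P3 = {v :: int \<times> int. fst v < 0 \<and> snd v \<le> 0}"
  define P4 where "P4 = {v :: int \<times> int. 0 \<le> fst v \<and> snd v < 0}"
  define V where "V = {v :: int \<times> int. fst v = 0 \<and> 0 < snd v}"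
  define W where "W = {v :: int \<times> int. 0 < fst v \<and> snd v = 0}"
  define W' where "W' = {v :: int \<times> int. fst v < 0 \<and> snd v = 0}"
  have rot: "infsum h A = infsum h B"
    if "\<And>v. v \<in> A \<Longrightarrow> (- snd v, fst v) \<in> B" "\<And>v. v \<in> B \<Longrightarrow> (snd v, - fst v) \<in> A" for A B
    using that
    by (intro infsum_reindex_bij_witness[of _ "\<lambda>v. (snd v, - fst v)" "\<lambda>v. (- snd v, fst v)"])
       (auto simp: h_def lattice_term_0 lattice_norm_def add.commute)
  \<comment> \<open>Again \<open>0 powr w = 0\<close>, so the origin may stay in the lattice
    sums.\<close>
  have h0: "infsum h {(0, 0)} = 0" by (simp add: h_def lattice_term_0 lattice_norm_def)
  have "infsum h P1 = infsum h P2" "infsum h P2 = infsum h P3" "infsum h P3 = infsum h P4"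
    by (rule rot; force simp: P1_def P2_def P3_def P4_def)+
  moreover have "infsum h (UNIV \<times> UNIV) = infsum h ({(0, 0)} \<union> (P1 \<union> (P2 \<union> (P3 \<union> P4))))"
    by (intro arg_cong[of _ _ "infsum h"]) (auto simp: P1_def P2_def P3_def P4_def)
  moreover have "\<dots> = infsum h {(0, 0)} + (infsum h P1 + (infsum h P2 + (infsum h P3
        + infsum h P4)))"
    by (subst un, force simp: P1_def P2_def P3_def P4_def)+ simp
  ultimately have 1: "infsum h (UNIV \<times> UNIV) = 4 * infsum h P1" using h0 by simp
  have "infsum h W = infsum h V" "infsum h V = infsum h W'"
    by (rule rot; force simp: V_def W_def W'_def)+
  moreover have "infsum h (UNIV \<times> {0}) = infsum h ({(0, 0)} \<union> (W \<union> W'))"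
    by (intro arg_cong[of _ _ "infsum h"]) (auto simp: W_def W'_def)
  moreover have "\<dots> = infsum h {(0, 0)} + (infsum h W + infsum h W')"
    by (subst un, force simp: W_def W'_def)+ simp
  ultimately have 2: "infsum h (UNIV \<times> {0}) = 2 * infsum h V" using h0 by simp
  have "(\<Sum>\<^sub>\<infinity>v\<in>epstein_index. of_nat (epstein_entry v) powr (- s)) = infsum h (P1 \<union> V)"
    by (intro infsum_reindex_bij_witness[of _ "\<lambda>v. (nat (fst v), nat (snd v))"
          "\<lambda>v. (int (fst v), int (snd v))"])
       (auto simp: epstein_index_def P1_def V_def h_def lattice_term_0 lattice_norm_def
           epstein_entry_def)
  also have "\<dots> = infsum h P1 + infsum h V" by (rule un) (auto simp: P1_def V_def)
  finally show ?thesis using 1 2 by simp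
qed

text \<open>In the plane \<open>(a, b) \<mapsto> (a + b, a - b)\<close> maps onto the vectors of
  even coordinate sum and doubles the norm. On the axis doubling the coordinate does the same with
  factor 4.\<close>

lemma lattice_sum_eq_alternating_sum:
  assumes s: "1 < Re s"
  shows "alternating_sum UNIV 0 s = (2 * 2 powr (- s) - 1) * (\<Sum>\<^sub>\<infinity>v\<in>UNIV \<times> UNIV. lattice_term 0 s v)"
    and "alternating_sum {0} 0 s = (2 * 4 powr (- s) - 1) * (\<Sum>\<^sub>\<infinity>v\<in>UNIV \<times> {0}. lattice_term 0 s v)"
proof -
  let ?S = "\<lambda>Y. \<Sum>\<^sub>\<infinity>v\<in>UNIV \<times> Y. lattice_term 0 s v"
  define f where "f = (\<lambda>v :: int \<times> int. (fst v + snd v, fst v - snd v))"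
  have "f ` (UNIV \<times> UNIV) = {v \<in> UNIV \<times> UNIV. even (fst v + snd v)}"
  proof (intro equalityI subsetI)
    fix v :: "int \<times> int" assume "v \<in> {v \<in> UNIV \<times> UNIV. even (fst v + snd v)}"
    then have "even (fst v + snd v)" by simp
    then obtain k where k: "fst v + snd v = 2 * k" by (rule evenE)
    have "v = f (k, fst v - k)" using k by (cases v) (auto simp: f_def)
    then show "v \<in> f ` (UNIV \<times> UNIV)" by (metis UNIV_I UNIV_Times_UNIV image_eqI)
  qed (auto simp: f_def)
  then have "alternating_sum UNIV 0 s = (2 * of_real 2 powr (- s) - 1) * ?S UNIV"
    by (intro alternating_sum_scaling[OF s, of f])
       (auto simp: inj_on_def f_def lattice_norm_def power2_eq_square algebra_simps)
  then show "alternating_sum UNIV 0 s = (2 * 2 powr (- s) - 1) * ?S UNIV"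
    by simp
  define g where "g = (\<lambda>v :: int \<times> int. (2 * fst v, 2 * snd v))"
  have "g ` (UNIV \<times> {0}) = {v \<in> UNIV \<times> {0}. even (fst v + snd v)}"
    by (auto simp: g_def image_iff elim!: evenE)
  then have "alternating_sum {0} 0 s = (2 * of_real 4 powr (- s) - 1) * ?S {0}"
    by (intro alternating_sum_scaling[OF s, of g])
       (auto simp: inj_on_def g_def lattice_norm_def power2_eq_square algebra_simps)
  then show "alternating_sum {0} 0 s = (2 * 4 powr (- s) - 1) * ?S {0}"
    by simp
qed

section \<open>The continuation, its uniqueness and its constant term\<close>

lemma two_powr_ne_1:
  assumes s: "1 < Re s" and c: "c = 2 \<or> c = (4 :: complex)"
  shows "2 * c powr (- s) - 1 \<noteq> 0"
proof
  assume "2 * c powr (- s) - 1 = 0"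
  \<comment> \<open>For \<open>Re s > 1\<close> the modulus is below 1. On the line
    \<open>Re s = 1\<close> the factor with \<open>c = 2\<close> vanishes at \<open>s = 1\<close>,
    where the pole is.\<close>
  then have "norm (2 * c powr (- s)) = 1" by simp
  then have "2 * Re c powr (- Re s) = 1" using c by (auto simp: norm_mult norm_powr_real_powr)
  moreover have "Re c powr (- Re s) < Re c powr (- 1)" using s c by (intro powr_less_mono) auto
  moreover have "Re c powr (- 1) \<le> 1 / 2" using c by (auto simp: powr_minus)
  ultimately show False by linarith
qed

text \<open>The identity theorem, applied to the difference with removed singularities, gives
  equality only on punctured neighbourhoods. The values at the points themselves follow from the
  normalisation: 0 at a pole, the limit elsewhere.\<close>

lemma nicely_meromorphic_eqI:
  assumes f: "f nicely_meromorphic_on UNIV" and g: "g nicely_meromorphic_on UNIV"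
    and eq: "\<And>s. Re s > 1 \<Longrightarrow> f s = g s"
  shows "f = g"
proof
  fix z
  have mero: "f meromorphic_on UNIV" "g meromorphic_on UNIV"
    using f g by (auto simp: nicely_meromorphic_on_def)
  define d where "d = remove_sings (\<lambda>s. f s - g s)"
  have dm: "(\<lambda>s. f s - g s) meromorphic_on UNIV" using mero by (intro meromorphic_intros)
  then have d: "d nicely_meromorphic_on UNIV" unfolding d_def
        by (rule remove_sings_nicely_meromorphic)
  have "d w = 0" for w
  proof (rule frequently_eq_meromorphic_imp_constant[OF _ d])
    have op: "open {s. 1 < Re s}" by (rule open_halfspace_Re_gt)
    have "eventually (\<lambda>s. s \<in> {s. 1 < Re s}) (at 2)" using op by (intro eventually_at_in_open') auto
    then have "eventually (\<lambda>s. d s = 0) (at 2)"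
    proof eventually_elim
      case (elim s)
      have "eventually (\<lambda>u. f u - g u = 0) (nhds s)"
        using eventually_nhds_in_open[OF op elim] by eventually_elim (use eq in auto)
      then have "(\<lambda>u. f u - g u) \<midarrow>s\<rightarrow> 0"
        by (intro tendsto_eventually) (auto simp: eventually_at_filter elim: eventually_mono)
      then show "d s = 0" unfolding d_def by (rule remove_sings_eqI)
    qed
    then show "frequently (\<lambda>s. d s = 0) (at 2)" by (intro eventually_frequently) auto
  qed auto
  moreover have "eventually (\<lambda>s. d s = f s - g s) (at z)"
    unfolding d_def using dm
    by (intro eventually_remove_sings_eq_at meromorphic_on_isolated_singularity) (auto intro:
          meromorphic_on_subset)
  ultimately have ev: "eventually (\<lambda>s. f s = g s) (at z)" by simp
  have pole: "is_pole f z \<longleftrightarrow> is_pole g z" using ev by (intro is_pole_cong) auto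
  have "is_pole f z \<and> f z = 0 \<or> f \<midarrow>z\<rightarrow> f z" "is_pole g z \<and> g z = 0 \<or> g \<midarrow>z\<rightarrow> g z"
    using f g by (auto simp: nicely_meromorphic_on_def)
  moreover have "f \<midarrow>z\<rightarrow> f z \<Longrightarrow> g \<midarrow>z\<rightarrow> f z" using ev by (rule Lim_transform_eventually[rotated])
  moreover have "\<not> (is_pole f z \<and> f \<midarrow>z\<rightarrow> f z)" "\<not> (is_pole g z \<and> g \<midarrow>z\<rightarrow> g z)"
    by (metis at_neq_bot is_pole_def not_tendsto_and_filterlim_at_infinity)+
  ultimately show "f z = g z"
    using pole by (metis LIM_unique)
qed

text \<open>The description by \<open>THE\<close> is justified: existence by dividing the entire
  alternating sums by their factors, uniqueness by the previous lemma. Passing to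
  \<open>remove_sings F\<close> normalises values and changes nothing for \<open>Re s > 1\<close>,
  where \<open>F\<close> is analytic.\<close>

lemma epstein_zeta_properties:
  "epstein_zeta nicely_meromorphic_on UNIV"
  "1 < Re s \<Longrightarrow> epstein_zeta s = (\<Sum>\<^sub>\<infinity>v\<in>epstein_index. of_nat (epstein_entry v) powr (- s))"
proof -
  let ?S = "\<lambda>s. \<Sum>\<^sub>\<infinity>v\<in>epstein_index. of_nat (epstein_entry v) powr (- s)"
  define P where "P = (\<lambda>f. f nicely_meromorphic_on UNIV \<and>
     (\<forall>s. Re s > 1 \<longrightarrow> f s = ?S s))"
  obtain E1 where E1: "E1 holomorphic_on UNIV" "\<And>s. 1 < Re s \<Longrightarrow> E1 s = alternating_sum UNIV 0 s"
    using alternating_sum_entire[of UNIV] by blast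
  obtain E2 where E2: "E2 holomorphic_on UNIV" "\<And>s. 1 < Re s \<Longrightarrow> E2 s = alternating_sum {0} 0 s"
    using alternating_sum_entire[of "{0}"] by blast
  define F where "F = (\<lambda>s. E1 s / (2 * 2 powr (- s) - 1) / 4 + E2 s / (2 * 4 powr (- s) - 1) / 2)"
  have an: "E1 analytic_on UNIV" "E2 analytic_on UNIV"
    "(\<lambda>s. 2 * 2 powr (- s) - 1 :: complex) analytic_on UNIV"
        "(\<lambda>s. 2 * 4 powr (- s) - 1 :: complex) analytic_on UNIV"
    using E1(1) E2(1) by (auto simp: analytic_on_open intro!: holomorphic_intros)
  have F: "F meromorphic_on UNIV"
    unfolding F_def by (intro meromorphic_intros an[THEN analytic_on_imp_meromorphic_on])
  have Fs: "F s = ?S s" if "1 < Re s" for s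
  proof -
    have "2 * 2 powr (- s) - 1 \<noteq> 0" "2 * 4 powr (- s) - 1 \<noteq> 0"
      using two_powr_ne_1[OF that] by blast+
    then show ?thesis
      unfolding F_def E1(2)[OF that] E2(2)[OF that] lattice_sum_eq_alternating_sum[OF that]
        epstein_series_lattice[OF that] by (simp only: nonzero_mult_div_cancel_left
              not_False_eq_True)
  qed
  have Fan: "F analytic_on {s}" if "1 < Re s" for s
    unfolding F_def using two_powr_ne_1[OF that]
    by (intro analytic_intros an[THEN analytic_on_subset]) auto
  have "P (remove_sings F)"
    unfolding P_def using remove_sings_nicely_meromorphic[OF F] Fs Fan by simp
  moreover have "f = remove_sings F" if "P f" for f
    using that \<open>P (remove_sings F)\<close> unfolding P_def by (intro nicely_meromorphic_eqI) auto
  ultimately have "P (THE f. P f)" by (rule theI)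
  then have *: "P epstein_zeta" unfolding epstein_zeta_def P_def .
  show "epstein_zeta nicely_meromorphic_on UNIV"
    "1 < Re s \<Longrightarrow> epstein_zeta s = ?S s"
    using * by (auto simp: P_def)
qed

text \<open>A finite limit along the real axis from one side excludes a pole of the meromorphic
  function \<open>g\<close>, so \<open>g\<close> has a full limit, its constant coefficient. Adding
  the polar part back changes only the coefficient of index \<open>- 1\<close>.\<close>

lemma finite_part_eqI:
  fixes r K :: complex and a :: real
  assumes mero: "f meromorphic_on {of_real a}"
    and lim: "((\<lambda>s. f (of_real s) - r / (of_real s - of_real a)) \<longlongrightarrow> K) (at_right a)"
  shows "finite_part f (of_real a) = K"
proof -
  define g where "g = (\<lambda>z. f z - r / (z - of_real a))"
  have gm: "g meromorphic_on {of_real a}"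
    unfolding g_def using mero by (intro meromorphic_intros)
  have fl: "filterlim (\<lambda>s. of_real s) (at (complex_of_real a)) (at_right a)"
    by (intro filterlim_atI tendsto_intros) (auto simp: eventually_at_filter)
  have lim': "((\<lambda>s. g (of_real s)) \<longlongrightarrow> K) (at_right a)" using lim by (simp add: g_def)
  have np: "\<not> is_pole g (of_real a)"
  proof
    assume "is_pole g (of_real a)"
    then have "filterlim (\<lambda>s. g (of_real s)) at_infinity (at_right a)"
      unfolding is_pole_def using fl by (rule filterlim_compose)
    with lim' show False
      using not_tendsto_and_filterlim_at_infinity[of "at_right a"]
            by (simp add: trivial_limit_at_right_real)
  qed
  from gm obtain G where G: "(\<lambda>w. g (of_real a + w)) has_laurent_expansion G"
    unfolding meromorphic_on_def by auto
  have G0: "0 \<le> fls_subdegree G"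
    using has_laurent_expansion_imp_is_pole[OF G] np by linarith
  have "((\<lambda>s. g (of_real s)) \<longlongrightarrow> fls_nth G 0) (at_right a)"
    using has_laurent_expansion_imp_tendsto[OF G G0] fl by (rule filterlim_compose)
  with lim' have GK: "fls_nth G 0 = K"
    using tendsto_unique[of "at_right a"] by (simp add: trivial_limit_at_right_real)
  have "(\<lambda>w. g (of_real a + w) + r * inverse w) has_laurent_expansion (G + fls_const r * fls_X_inv)"
    by (intro laurent_expansion_intros G)
  also have "(\<lambda>w. g (of_real a + w) + r * inverse w) = (\<lambda>w. f (of_real a + w))"
    by (simp add: g_def divide_inverse)
  finally have "laurent_expansion f (of_real a) = G + fls_const r * fls_X_inv"
    by (rule laurent_expansion_eqI)
  then show ?thesis by (simp add: finite_part_def GK)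
qed

text \<open>Real points just to the right of 1 lie in the half-plane of convergence, so the limit of
  \<open>epstein_real\<close> decides; the residue is \<open>pi / 4\<close>.\<close>

lemma finite_part_epstein_zeta: "finite_part epstein_zeta 1 = of_real zeta_const"
proof -
  have "finite_part epstein_zeta (of_real 1) = of_real zeta_const"
  proof (rule finite_part_eqI)
    show "epstein_zeta meromorphic_on {of_real 1}"
      using epstein_zeta_properties(1) meromorphic_on_subset
            by (auto simp: nicely_meromorphic_on_def)
    have "((\<lambda>s. complex_of_real (epstein_real s - pi / 4 / (s - 1)))
          \<longlongrightarrow> of_real zeta_const) (at_right 1)"
      by (intro tendsto_of_real epstein_real_tendsto)
    moreover have "\<forall>\<^sub>F s in at_right 1. complex_of_real (epstein_real s - pi / 4 / (s - 1)) =
        epstein_zeta (of_real s) - of_real (pi / 4) / (of_real s - of_real 1)"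
    proof -
      have "\<forall>\<^sub>F s in at_right (1::real). 1 < s \<and> s \<le> 2"
        unfolding eventually_at_right_field by (auto intro!: exI[of _ 2])
      then show ?thesis
      proof eventually_elim
        case (elim s)
        then show ?case using epstein_zeta_properties(2)[of "of_real s"]
              by (simp add: epstein_series_of_real)
      qed
    qed
    ultimately show "((\<lambda>s. epstein_zeta (of_real s) - of_real (pi / 4) / (of_real s - of_real 1))
        \<longlongrightarrow> of_real zeta_const) (at_right 1)"
      by (rule Lim_transform_eventually)
  qed
  then show ?thesis by simp
qed

section \<open>Generating functions and coefficient integrals\<close>

text \<open>The coefficient of \<open>ln F\<close>: a pair with
  \<open>k * epstein_entry v = j\<close> contributes
  \<open>1 / k = epstein_entry v / j\<close>.\<close>

definition log_coeff :: "nat \<Rightarrow> real" where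
  "log_coeff j = real (part_sum j) / real j"

lemma log_coeff_nonneg [simp]: "0 \<le> log_coeff j"
  by (simp add: log_coeff_def)

lemma mult_log_coeff [simp]: "real j * log_coeff j = real (part_sum j)"
  by (cases "j = 0") (auto simp: log_coeff_def)

text \<open>Keeps only the divisor \<open>d = j\<close>, that is the terms with
  \<open>k = 1\<close>.\<close>

lemma entry_mult_le_log_coeff: "real (entry_mult j) \<le> log_coeff j"
proof (cases "j = 0")
  case False
  have "j * entry_mult j \<le> part_sum j"
    unfolding divsum_def using False by (intro member_le_sum[of j _ "\<lambda>d. d * entry_mult d"]) auto
  then have "real j * real (entry_mult j) \<le> real j * log_coeff j"
    by (metis mult_log_coeff of_nat_le_iff of_nat_mult)
  then show ?thesis by (rule mult_left_le_imp_le) (use False in simp)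
qed simp

lemma log_coeff_le_part_sum: "log_coeff j \<le> real (part_sum j)"
  by (cases "j = 0") (auto simp: log_coeff_def divide_le_eq mult_le_cancel_left1)

lemma part_count_le_part_sum: "part_count j \<le> part_sum j"
  unfolding divsum_def
proof (intro sum_mono)
  fix d show "entry_mult d \<le> d * entry_mult d" by (cases d) auto
qed

lemma summable_part_sum: "0 < b \<Longrightarrow> summable (\<lambda>j. real (part_sum j) * exp (- b) ^ j)"
  using part_sum_sums[of b] sums_summable by metis

lemma summable_part_count: "0 < b \<Longrightarrow> summable (\<lambda>j. real (part_count j) * exp (- b) ^ j)"
  by (rule summable_comparison_test'[OF summable_part_sum, of b 0])
     (auto intro!: mult_right_mono part_count_le_part_sum)

lemma summable_log_coeff: "0 < b \<Longrightarrow> summable (\<lambda>j. log_coeff j * exp (- b) ^ j)"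
  by (rule summable_comparison_test'[OF summable_part_sum, of b 0])
     (auto intro!: mult_right_mono log_coeff_le_part_sum)

definition log_fps :: "complex fps" where
  "log_fps = Abs_fps (\<lambda>j. of_real (log_coeff j))"

definition partition_fps :: "complex fps" where
  "partition_fps = Abs_fps (\<lambda>n. of_nat (npart n))"

lemma log_fps_conv_radius: "1 \<le> fps_conv_radius log_fps"
  unfolding fps_conv_radius_def log_fps_def
proof (rule conv_radius_geI_ex')
  fix r :: real assume r: "0 < r" "ereal r < 1"
  then have "0 < - ln r" "exp (- (- ln r)) = r" by auto
  then have "summable (\<lambda>j. log_coeff j * r ^ j)" using summable_log_coeff[of "- ln r"] by simp
  then have "summable (\<lambda>j. complex_of_real (log_coeff j * r ^ j))" by (rule summable_of_real)
  then show "summable (\<lambda>n. fps_nth (Abs_fps (\<lambda>j. of_real (log_coeff j))) n * (of_real r ::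
        complex) ^ n)" by simp
qed

text \<open>The derivative of the exponential shows that its coefficients satisfy the recursion of
  \<open>npart_rec\<close> with the same initial value, so the identity holds among formal power
  series, ahead of any convergence.\<close>

lemma partition_fps_eq: "partition_fps = fps_exp 1 oo log_fps"
proof -
  define G where "G = fps_exp (1::complex) oo log_fps"
  have A0: "fps_nth log_fps 0 = 0" by (simp add: log_fps_def log_coeff_def)
  have dG: "fps_deriv G = G * fps_deriv log_fps"
    unfolding G_def by (simp add: fps_compose_deriv[OF A0])
  have G0: "fps_nth G 0 = 1" by (simp add: G_def)
  have rec: "of_nat (Suc n) * fps_nth G (Suc n) = (\<Sum>i=0..n. fps_nth G i * of_nat (part_sum (Suc n
        - i)))" for n
  proof -
    have "of_nat (Suc n) * fps_nth G (Suc n) = fps_nth (fps_deriv G) n" by simp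
    also have "\<dots> = (\<Sum>i=0..n. fps_nth G i * of_nat (part_sum (Suc n - i)))"
      unfolding dG fps_mult_nth
    proof (intro sum.cong refl)
      fix i assume "i \<in> {0..n}"
      then have e: "Suc n - i = Suc (n - i)" by auto
      have "of_nat (Suc (n - i)) * complex_of_real (log_coeff (Suc (n - i)))
            = of_nat (part_sum (Suc (n - i)))"
        by (metis mult_log_coeff of_real_mult of_real_of_nat_eq)
      then show "fps_nth G i * fps_nth (fps_deriv log_fps) (n - i)
            = fps_nth G i * of_nat (part_sum (Suc n - i))"
        unfolding e by (simp add: log_fps_def del: of_nat_Suc)
    qed
    finally show ?thesis .
  qed
  have "fps_nth G n = of_nat (npart n)" for n
  proof (induction n rule: less_induct)
    case (less n)
    show ?case
    proof (cases n)
      case 0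
      then show ?thesis by (simp add: G0 npart_0)
    next
      case (Suc m)
      have "of_nat (Suc m) * fps_nth G (Suc m) = (\<Sum>i=0..m. of_nat (npart i) * of_nat (part_sum
            (Suc m - i)))"
        unfolding rec by (intro sum.cong refl) (use less Suc in auto)
      also have "\<dots> = of_nat (\<Sum>i=0..m. npart i * part_sum (Suc m - i))" by simp
      also have "(\<Sum>i=0..m. npart i * part_sum (Suc m - i)) = (\<Sum>j\<in>{1..Suc m}.
            part_sum j * npart (Suc m - j))"
        by (rule sum.reindex_bij_witness[of _ "\<lambda>j. Suc m - j" "\<lambda>i. Suc m - i"]) auto
      also have "\<dots> = Suc m * npart (Suc m)" by (rule npart_rec[symmetric])
      finally show ?thesis using Suc by (simp del: of_nat_Suc mult_Suc)
    qed
  qed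
  then show ?thesis by (simp add: fps_eq_iff partition_fps_def G_def)
qed

text \<open>The exponential of a function holomorphic in the unit disc is represented there by its
  power series, whose coefficients are known formally. Convergence of \<open>F\<close> is thereby
  obtained as well.\<close>

lemma npart_sums:
  assumes z: "norm (z :: complex) < 1"
  shows "(\<lambda>n. of_nat (npart n) * z ^ n) sums exp (\<Sum>j. of_real (log_coeff j) * z ^ j)"
proof -
  have hol: "eval_fps log_fps holomorphic_on eball 0 1"
    by (intro holomorphic_intros) (auto intro!: less_le_trans[OF _ log_fps_conv_radius])
  have "eval_fps log_fps has_fps_expansion log_fps"
    using log_fps_conv_radius by (intro eval_fps_has_fps_expansion) (auto intro: less_le_trans[of
          0 1])
  then have "(exp \<circ> eval_fps log_fps) has_fps_expansion (fps_exp 1 oo log_fps)"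
    by (intro has_fps_expansion_compose fps_expansion_intros) (simp_all add: log_fps_def
          log_coeff_def)
  moreover have "(exp \<circ> eval_fps log_fps) holomorphic_on eball 0 1"
    by (rule holomorphic_on_compose[OF hol holomorphic_on_exp])
  ultimately have "(\<lambda>n. fps_nth (fps_exp 1 oo log_fps) n * z ^ n) sums (exp \<circ> eval_fps log_fps) z"
    by (rule has_fps_expansion_imp_sums_complex[where r = 1]) (use z in simp)
  then show ?thesis
    unfolding partition_fps_eq[symmetric] by (simp add: partition_fps_def log_fps_def eval_fps_def
          o_def)
qed

section \<open>Coefficients as integrals over a circle\<close>

lemma integral_cis_int:
  "((\<lambda>t. cis (of_int k * t)) has_integral (if k = 0 then 2 * pi else 0)) {- pi..pi}"
proof (cases "k = 0")
  case True
  then show ?thesis using has_integral_const_real[of "1 :: complex" "- pi" pi]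
        by (simp add: scaleR_conv_of_real)
next
  case False
  define F where "F = (\<lambda>t. cis (of_int k * t) / (\<i> * of_int k))"
  have "((\<lambda>t. cis (of_int k * t)) has_integral (F pi - F (- pi))) {- pi..pi}"
  proof (rule fundamental_theorem_of_calculus)
    fix x :: real
    show "(F has_vector_derivative cis (of_int k * x)) (at x within {- pi..pi})"
    proof -
      have "((\<lambda>z. exp (\<i> * (of_int k * z)) / (\<i> * of_int k)) has_field_derivative exp (\<i> * (of_int
            k * of_real x))) (at (of_real x))"
        using False by (auto intro!: derivative_eq_intros simp: mult.commute[of _ \<i>])
      from has_vector_derivative_real_field[OF this] show ?thesis
        unfolding F_def cis_conv_exp by simp
    qed
  qed auto
  moreover have "cis (of_int k * - pi) = cis (of_int k * pi)"
    by (simp add: complex_eq_iff mult.commute[of _ pi])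
  then have "F pi - F (- pi) = 0" by (simp add: F_def)
  ultimately show ?thesis using False by simp
qed

text \<open>Uniform convergence allows integration term by term; by orthogonality the integrals of
  the partial sums are constant once \<open>N > n\<close>.\<close>

lemma coefficient_integral:
  fixes c :: "nat \<Rightarrow> complex"
  assumes c: "summable (\<lambda>j. norm (c j))"
  shows "((\<lambda>t. (\<Sum>j. c j * cis (real j * t)) * cis (- (real n * t)))
        has_integral (2 * pi * c n)) {- pi..pi}"
proof -
  define f where "f = (\<lambda>N t. (\<Sum>j<N. c j * cis (real j * t)) * cis (- (real n * t)))"
  have *: "uniform_limit {- pi..pi} (\<lambda>N t. \<Sum>j<N. c j * cis (real j * t)) (\<lambda>t. \<Sum>j.
        c j * cis (real j * t)) sequentially"
    by (rule Weierstrass_m_test[OF _ c]) (simp add: norm_mult)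
  have u: "uniform_limit {- pi..pi} f (\<lambda>t. (\<Sum>j. c j * cis (real j * t)) * cis (- (real n * t)))
        sequentially"
    unfolding uniform_limit_iff
  proof (intro allI impI)
    fix e :: real assume "0 < e"
    with * have "\<forall>\<^sub>F N in sequentially. \<forall>t\<in>{- pi..pi}.
        dist (\<Sum>j<N. c j * cis (real j * t)) (\<Sum>j. c j * cis (real j * t)) < e"
      by (auto simp: uniform_limit_iff)
    then show "\<forall>\<^sub>F N in sequentially. \<forall>t\<in>{- pi..pi}.
        dist (f N t) ((\<Sum>j. c j * cis (real j * t)) * cis (- (real n * t))) < e"
      by eventually_elim (simp add: f_def dist_norm norm_mult flip: left_diff_distrib)
  qed
  have cont: "continuous_on {- pi..pi} (f N)" for N
    unfolding f_def cis_conv_exp by (intro continuous_intros)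
  obtain I J where I: "\<And>N. (f N has_integral I N) {- pi..pi}"
    and J: "((\<lambda>t. (\<Sum>j. c j * cis (real j * t)) * cis (- (real n * t))) has_integral J) {- pi..pi}"
    and lim: "I \<longlonglongrightarrow> J"
    using uniform_limit_integral[OF u cont] by auto
  have "I N = 2 * pi * c n" if "n < N" for N
  proof -
    have "((\<lambda>t. \<Sum>j<N. c j * cis (of_int (int j - int n) * t)) has_integral
        (\<Sum>j<N. c j * (if int j - int n = 0 then 2 * pi else 0))) {- pi..pi}"
      by (intro has_integral_sum has_integral_mult_right integral_cis_int) auto
    also have "(\<lambda>t. \<Sum>j<N. c j * cis (of_int (int j - int n) * t)) = f N"
    proof
      fix t
      have "cis (of_int (int j - int n) * t) = cis (real j * t) * cis (- (real n * t))" for j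
        by (simp add: cis_mult left_diff_distrib)
      then show "(\<Sum>j<N. c j * cis (of_int (int j - int n) * t)) = f N t"
        by (simp add: f_def sum_distrib_right mult.assoc)
    qed
    also have "(\<Sum>j<N. c j * (if int j - int n = 0 then 2 * pi else 0)) = (\<Sum>j<N. if j
          = n then 2 * pi * c n else 0)"
      by (intro sum.cong) auto
    also have "\<dots> = 2 * pi * c n" using that by simp
    finally show ?thesis using I[of N] has_integral_unique by blast
  qed
  then have "\<forall>\<^sub>F N in sequentially. I N = 2 * pi * c n"
    by (intro eventually_mono[OF eventually_gt_at_top[of n]])
  then have "I \<longlonglongrightarrow> 2 * pi * c n" by (rule tendsto_eventually)
  with lim have "J = 2 * pi * c n" by (rule LIMSEQ_unique)
  with J show ?thesis by simp
qed

section \<open>The saddle point integral\<close>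

lemma one_minus_cos_ge: "x\<^sup>2 / 4 \<le> 1 - cos x" if "\<bar>x\<bar> \<le> 1" for x :: real
proof -
  obtain z where z: "cos x = (\<Sum>m<4. cos_coeff m * x ^ m) + cos (z + 1 / 2 * real 4 * pi) / fact 4
        * x ^ 4"
    using Maclaurin_cos_expansion[of x 4] by blast
  have "cos (z + 1 / 2 * real 4 * pi) / fact 4 * x ^ 4 \<le> 1 / fact 4 * x ^ 4"
    by (intro mult_right_mono divide_right_mono) auto
  moreover have "(\<Sum>m<4. cos_coeff m * x ^ m) = 1 - x\<^sup>2 / 2"
    by (simp add: cos_coeff_def eval_nat_numeral) presburger
  moreover have "x ^ 4 \<le> x\<^sup>2"
  proof -
    have "\<bar>x\<bar> ^ 4 \<le> \<bar>x\<bar> ^ 2" using that by (intro power_decreasing) auto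
    then show ?thesis by simp
  qed
  moreover have "1 / fact 4 * x ^ 4 = x ^ 4 / 24" by (simp add: fact_numeral)
  moreover have "0 \<le> x\<^sup>2" by simp
  ultimately show ?thesis unfolding z by linarith
qed

text \<open>With \<open>1 - cos z = 2 (sin (z / 2))^2\<close> this is
  \<open>(p - q)^2 \<le> 2 p^2 + 2 q^2\<close>. If two phases are close to multiples of
  \<open>2 pi\<close>, so is their difference.\<close>

lemma one_minus_cos_diff_le: "1 - cos (x - y) \<le> 2 * (1 - cos x) + 2 * (1 - cos y)" for x y :: real
proof -
  have c: "1 - cos z = 2 * (sin (z / 2))\<^sup>2" for z :: real
    using cos_double_sin[of "z / 2"] by simp
  define p q where "p = sin (x / 2) * cos (y / 2)" and "q = cos (x / 2) * sin (y / 2)"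
  have "(p - q)\<^sup>2 \<le> 2 * p\<^sup>2 + 2 * q\<^sup>2" using zero_le_power2[of "p + q"]
        by (simp add: power2_eq_square algebra_simps)
  also have "p\<^sup>2 \<le> (sin (x / 2))\<^sup>2"
    unfolding p_def power_mult_distrib by (simp add: mult_left_le abs_square_le_1)
  also have "q\<^sup>2 \<le> (sin (y / 2))\<^sup>2"
    unfolding q_def power_mult_distrib by (simp add: mult_left_le_one_le abs_square_le_1)
  finally have "(sin ((x - y) / 2))\<^sup>2 \<le> 2 * (sin (x / 2))\<^sup>2 + 2 * (sin (y / 2))\<^sup>2"
    by (simp add: p_def q_def sin_diff diff_divide_distrib)
  then show ?thesis unfolding c by simp
qed

text \<open>The logarithm of \<open>F(e^(-b))\<close> divided by the modulus of
  \<open>F(e^(-b+it))\<close>, see \<open>norm_char_fun\<close>.\<close>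

definition decay :: "real \<Rightarrow> real \<Rightarrow> real" where
  "decay b t = (\<Sum>j. log_coeff j * exp (- b) ^ j * (1 - cos (real j * t)))"

lemma summable_decay: "0 < b \<Longrightarrow> summable (\<lambda>j. log_coeff j * exp (- b) ^ j * (1 - cos (real j * t)))"
proof (rule summable_comparison_test'[OF summable_mult[OF summable_log_coeff, of b 2], of 0])
  fix n :: nat assume b: "0 < b"
  have "0 \<le> 1 - cos (real n * t)" "1 - cos (real n * t) \<le> 2" using cos_ge_minus_one[of
        "real n * t"] by auto
  then show "norm (log_coeff n * exp (- b) ^ n * (1 - cos (real n * t)))
        \<le> 2 * (log_coeff n * exp (- b) ^ n)"
    by (simp add: abs_mult mult_right_mono mult.commute[of 2] mult_left_mono)
qed

text \<open>All terms of \<open>decay\<close> are nonnegative, so a lower bound may select finitely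
  many vectors, with \<open>k = 1\<close> only.\<close>

lemma decay_ge_vectors:
  fixes b t :: real
  assumes b: "0 < b" and S: "finite S" "S \<subseteq> epstein_index"
  shows "(\<Sum>v\<in>S. exp (- b * epstein_entry v) * (1 - cos (epstein_entry v * t))) \<le> decay b t"
proof -
  define g where "g = (\<lambda>j. exp (- b * real j) * (1 - cos (real j * t)))"
  have g0: "0 \<le> g j" for j by (simp add: g_def)
  obtain J where J: "\<And>v. v \<in> S \<Longrightarrow> epstein_entry v \<le> J"
    using S(1) finite_nat_set_iff_bounded_le[of "epstein_entry ` S"] by auto
  have "(\<Sum>v\<in>S. g (epstein_entry v)) \<le> (\<Sum>v\<in>(\<Union>j\<le>J. {v \<in> epstein_index. epstein_entry v
        = j}). g (epstein_entry v))"
    using S J g0 by (intro sum_mono2) (auto simp: finite_entry_eq)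
  also have "\<dots> = (\<Sum>j\<le>J. \<Sum>v\<in>{v \<in> epstein_index. epstein_entry v = j}. g (epstein_entry v))"
    by (intro sum.UNION_disjoint) (auto simp: finite_entry_eq)
  also have "\<dots> = (\<Sum>j\<le>J. real (entry_mult j) * g j)"
    by (intro sum.cong refl) (simp add: entry_mult_def)
  also have "\<dots> \<le> (\<Sum>j\<le>J. log_coeff j * g j)"
    by (intro sum_mono mult_right_mono entry_mult_le_log_coeff g0)
  also have "\<dots> = (\<Sum>j\<le>J. log_coeff j * exp (- b) ^ j * (1 - cos (real j * t)))"
    by (intro sum.cong refl) (simp add: g_def exp_of_nat_mult[symmetric] mult.commute)
  also have "\<dots> \<le> decay b t"
    unfolding decay_def by (intro sum_le_suminf summable_decay b) auto
  finally show ?thesis by (simp add: g_def)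
qed

lemma floor_half:
  fixes x :: real
  assumes x: "1 \<le> x"
  shows "x / 2 \<le> real (nat \<lfloor>x\<rfloor>) \<and> real (nat \<lfloor>x\<rfloor>) \<le> x \<and> 1 \<le> nat \<lfloor>x\<rfloor>"
proof -
  have "real (nat \<lfloor>x\<rfloor>) = of_int \<lfloor>x\<rfloor>" "1 \<le> \<lfloor>x\<rfloor>" using x by auto
  moreover have "real_of_int \<lfloor>x\<rfloor> \<le> x" "x < real_of_int \<lfloor>x\<rfloor> + 1" by linarith+
  moreover have "1 \<le> real_of_int \<lfloor>x\<rfloor>" using calculation(2) by simp
  ultimately show ?thesis by (intro conjI) (linarith, linarith, simp add: le_nat_floor)
qed

text \<open>The block \<open>S\<close> consists of \<open>s^2\<close> vectors with entries between
  \<open>s^2\<close> and \<open>5 s^2\<close>, where \<open>s\<close> is about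
  \<open>1 / sqrt (5 b)\<close>. Hence \<open>b l \<le> 1\<close> and
  \<open>\<bar>l t\<bar> \<le> 1\<close> for each entry \<open>l\<close>, which contributes at least
  \<open>exp (- 1) s^4 t^2 / 4\<close>. The constant is \<open>4 * 64 * 125 = 32000\<close>, from
  this 4 and from \<open>s^6 \<ge> (x / 2)^6\<close>.\<close>

lemma decay_near:
  assumes b: "0 < b" "b \<le> 1 / 5" and t: "\<bar>t\<bar> \<le> b"
  shows "exp (- 1) / 32000 * t\<^sup>2 / b ^ 3 \<le> decay b t"
proof -
  define x where "x = 1 / sqrt (5 * b)"
  have x1: "1 \<le> x" using b by (simp add: x_def)
  have x2: "x\<^sup>2 = 1 / (5 * b)" using b by (simp add: x_def power_divide)
  define s where "s = nat \<lfloor>x\<rfloor>"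
  have s: "x / 2 \<le> real s" "real s \<le> x" "1 \<le> s" using floor_half[OF x1] by (auto simp: s_def)
  define S where "S = {s..<2 * s} \<times> {..<s}"
  have each: "exp (- 1) * (real s ^ 4 * t\<^sup>2 / 4) \<le> exp (- b * epstein_entry v) * (1
        - cos (epstein_entry v * t))"
    if "v \<in> S" for v
  proof -
    obtain m n where v: "v = (m, n)" by (cases v)
    define l where "l = real (epstein_entry v)"
    have mn: "s \<le> m" "m \<le> 2 * s" "n \<le> s" using that by (auto simp: S_def v)
    have "s\<^sup>2 \<le> epstein_entry v" using mn by (auto simp: v epstein_entry_def intro: trans_le_add1
          power_mono)
    then have l1: "real s ^ 2 \<le> l" unfolding l_def by (metis of_nat_le_iff of_nat_power)
    have "epstein_entry v \<le> (2 * s)\<^sup>2 + s\<^sup>2"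
      using power_mono[OF mn(2), of 2] power_mono[OF mn(3), of 2] unfolding v epstein_entry_def
            fst_conv snd_conv
      by (rule add_mono) auto
    then have "l \<le> real ((2 * s)\<^sup>2 + s\<^sup>2)" unfolding l_def by (simp only: of_nat_le_iff)
    then have "l \<le> 5 * real s ^ 2" by (simp add: power_mult_distrib)
    also have "real s ^ 2 \<le> x ^ 2" using s by (intro power_mono) auto
    finally have l2: "b * l \<le> 1" using b by (simp add: x2 field_simps)
    have l0: "0 \<le> l" by (simp add: l_def)
    have "\<bar>l * t\<bar> \<le> l * b" using t l0 by (simp add: abs_mult mult_left_mono)
    then have "(l * t)\<^sup>2 / 4 \<le> 1 - cos (l * t)" using l2
          by (intro one_minus_cos_ge) (simp add: mult.commute)
    moreover have "real s ^ 4 * t\<^sup>2 \<le> (l * t)\<^sup>2"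
    proof -
      have "(real s ^ 2)\<^sup>2 \<le> l\<^sup>2" using l1 by (intro power_mono) auto
      then have "real s ^ 4 \<le> l\<^sup>2" by simp
      then show ?thesis by (simp add: power_mult_distrib mult_right_mono)
    qed
    ultimately have "real s ^ 4 * t\<^sup>2 / 4 \<le> 1 - cos (l * t)" by simp
    then show ?thesis unfolding l_def[symmetric] using l2 by (intro mult_mono) auto
  qed
  have card: "card S = s * s" by (simp add: S_def)
  have "S \<subseteq> epstein_index" using s(3) by (auto simp: S_def epstein_index_def)
  have x6: "x ^ 6 = 1 / (125 * b ^ 3)"
  proof -
    have "x ^ 6 = (x\<^sup>2) ^ 3" by simp
    then show ?thesis unfolding x2 by (simp add: power_divide power_mult_distrib)
  qed
  have "(x / 2) ^ 6 \<le> real s ^ 6" using s x1 by (intro power_mono) auto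
  then have s6: "1 / (8000 * b ^ 3) \<le> real s ^ 6" by (simp add: power_divide x6)
  have "exp (- 1) / 32000 * t\<^sup>2 / b ^ 3 = 1 / (8000 * b ^ 3) * (exp (- 1) * t\<^sup>2 / 4)" by simp
  also have "\<dots> \<le> real s ^ 6 * (exp (- 1) * t\<^sup>2 / 4)" using s6 by (intro mult_right_mono) auto
  also have "\<dots> = (\<Sum>v\<in>S. exp (- 1) * (real s ^ 4 * t\<^sup>2 / 4))" by (simp add: card eval_nat_numeral)
  also have "\<dots> \<le> (\<Sum>v\<in>S. exp (- b * epstein_entry v) * (1 - cos (epstein_entry v * t)))"
    by (intro sum_mono each)
  also have "\<dots> \<le> decay b t" by (rule decay_ge_vectors) (use b \<open>S \<subseteq> epstein_index\<close> in \<open>auto simp: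
        S_def\<close>)
  finally show ?thesis .
qed

text \<open>
  The entries of \<open>(a, 0)\<close> and \<open>(a, m)\<close> differ by \<open>m\<^sup>2\<close>, so they cannot both be close to multiples
  of \<open>2 * pi / t\<close> if \<open>m\<^sup>2 * t\<close> is not.
\<close>

lemma decay_far:
  assumes b: "0 < b" "b \<le> 1" and t: "b \<le> \<bar>t\<bar>" "\<bar>t\<bar> \<le> pi"
  shows "exp (- (1 + pi)) / 32 / sqrt b \<le> decay b t"
proof -
  \<comment> \<open>Rounding \<open>y\<close> down to \<open>m\<close> loses at most a factor 2, so
    \<open>m^2 \<bar>t\<bar>\<close> lies between \<open>pi / 4\<close> and \<open>pi\<close>, away
    from multiples of \<open>2 pi\<close>; \<open>b \<le> \<bar>t\<bar>\<close> keeps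
    \<open>b m^2\<close> bounded.\<close>
  define y where "y = sqrt (pi / \<bar>t\<bar>)"
  have t0: "0 < \<bar>t\<bar>" using b t by auto
  have y1: "1 \<le> y" using t t0 by (simp add: y_def)
  have y2: "y\<^sup>2 = pi / \<bar>t\<bar>" using t0 by (simp add: y_def)
  define m where "m = nat \<lfloor>y\<rfloor>"
  have m: "y / 2 \<le> real m" "real m \<le> y" "1 \<le> m" using floor_half[OF y1] by (auto simp: m_def)
  have "real m ^ 2 \<le> y\<^sup>2" using m by (intro power_mono) auto
  then have mt1: "real m ^ 2 * \<bar>t\<bar> \<le> pi" using t0 by (simp add: y2 field_simps)
  have "pi / \<bar>t\<bar> \<le> pi / b" using t b by (intro divide_left_mono) auto
  then have "real m ^ 2 \<le> pi / b" using \<open>real m ^ 2 \<le> y\<^sup>2\<close> unfolding y2 by linarith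
  then have mb: "b * real m ^ 2 \<le> pi" using b by (simp add: field_simps)
  have "(y / 2)\<^sup>2 \<le> real m ^ 2" using m y1 by (intro power_mono) auto
  then have mt2: "pi / 4 \<le> real m ^ 2 * \<bar>t\<bar>" using t0 by (simp add: power_divide y2 field_simps)
  have cosm: "1 / 4 \<le> 1 - cos (real m ^ 2 * t)"
  proof -
    have "cos (real m ^ 2 * t) = cos (real m ^ 2 * \<bar>t\<bar>)" by (simp add: abs_if)
    also have "\<dots> \<le> cos (pi / 4)" using mt1 mt2 by (intro cos_monotone_0_pi_le) auto
    also have "\<dots> = sqrt 2 / 2" by (rule cos_45)
    also have "\<dots> \<le> 3 / 4" 
    proof -
      have "sqrt 2 \<le> 3 / 2" by (rule real_le_lsqrt) (auto simp: power2_eq_square)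
      then show ?thesis by simp
    qed
    finally show ?thesis by simp
  qed
  define x where "x = 1 / sqrt b"
  have x1: "1 \<le> x" using b by (simp add: x_def)
  have x2: "x\<^sup>2 = 1 / b" using b by (simp add: x_def power_divide)
  define s where "s = nat \<lfloor>x\<rfloor>"
  have s: "x / 2 \<le> real s" "real s \<le> x" using floor_half[OF x1] by (auto simp: s_def)
  define f where "f = (\<lambda>v. exp (- b * epstein_entry v) * (1 - cos (epstein_entry v * t)))"
  \<comment> \<open>Each of the roughly \<open>1 / sqrt b\<close> values of \<open>a\<close>
    contributes a fixed amount, because both damping factors are at least
    \<open>exp (- (1 + pi))\<close>.\<close>
  have pair: "exp (- (1 + pi)) / 8 \<le> f (a, 0) + f (a, m)" if a: "a \<in> {1..s}" for a
  proof -
    define u v where "u = real a ^ 2" and "v = real a ^ 2 + real m ^ 2"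
    have "real a ^ 2 \<le> x ^ 2" using a s by (intro power_mono) auto
    then have ba: "b * real a ^ 2 \<le> 1" using b by (simp add: x2 field_simps)
    have "1 - cos (v * t - u * t) \<le> 2 * (1 - cos (v * t)) + 2 * (1 - cos (u * t))"
      by (rule one_minus_cos_diff_le)
    moreover have "v * t - u * t = real m ^ 2 * t" by (simp add: u_def v_def algebra_simps)
    ultimately have c: "1 / 8 \<le> (1 - cos (u * t)) + (1 - cos (v * t))" using cosm by simp
    have "exp (- (1 + pi)) / 8 = exp (- (1 + pi)) * (1 / 8)" by simp
    also have "\<dots> \<le> exp (- (1 + pi)) * ((1 - cos (u * t)) + (1 - cos (v * t)))"
      using c by (intro mult_left_mono) auto
    also have "\<dots> = exp (- (1 + pi)) * (1 - cos (u * t)) + exp (- (1 + pi)) * (1 - cos (v * t))"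
      by (simp add: algebra_simps)
    also have "\<dots> \<le> exp (- b * u) * (1 - cos (u * t)) + exp (- b * v) * (1 - cos (v * t))"
    proof (intro add_mono mult_right_mono)
      have "b * u \<le> 1 + pi" using ba pi_gt_zero unfolding u_def by linarith
      then show "exp (- (1 + pi)) \<le> exp (- b * u)" by simp
      show "exp (- (1 + pi)) \<le> exp (- b * v)" using ba mb by (simp add: v_def algebra_simps)
    qed auto
    also have "\<dots> = f (a, 0) + f (a, m)" by (simp add: f_def epstein_entry_def u_def v_def)
    finally show ?thesis .
  qed
  define S where "S = {1..s} \<times> {0, m}"
  have "exp (- (1 + pi)) / 32 / sqrt b \<le> real s * (exp (- (1 + pi)) / 8)"
  proof -
    have "x / 2 * (exp (- (1 + pi)) / 8) \<le> real s * (exp (- (1 + pi)) / 8)" using s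
          by (intro mult_right_mono) auto
    moreover have "exp (- (1 + pi)) / 32 / sqrt b \<le> x / 2 * (exp (- (1 + pi)) / 8)"
      using b by (simp add: x_def field_simps)
    ultimately show ?thesis by linarith
  qed
  also have "\<dots> = (\<Sum>a\<in>{1..s}. exp (- (1 + pi)) / 8)" by simp
  also have "\<dots> \<le> (\<Sum>a\<in>{1..s}. f (a, 0) + f (a, m))" by (intro sum_mono pair)
  also have "\<dots> = (\<Sum>a\<in>{1..s}. \<Sum>c\<in>{0, m}. f (a, c))" using m by (intro sum.cong) auto
  also have "\<dots> = (\<Sum>v\<in>S. f v)" unfolding S_def by (simp add: sum.cartesian_product)
  also have "\<dots> \<le> decay b t" unfolding f_def
    by (rule decay_ge_vectors) (use b in \<open>auto simp: S_def epstein_index_def\<close>)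
  finally show ?thesis .
qed

text \<open>The quotient of \<open>F(e^(-b+it))\<close> by \<open>F(e^(-b))\<close>: the
  characteristic function of the distribution with weights
  \<open>p(n) exp (- b n) / F(e^(-b))\<close>.\<close>

definition char_fun :: "real \<Rightarrow> real \<Rightarrow> complex" where
  "char_fun b t = exp (\<Sum>j. of_real (log_coeff j * exp (- b) ^ j) * (cis (real j * t) - 1))"

lemma summable_norm_log_coeff_cis:
  assumes "0 < b"
  shows "summable (\<lambda>j. norm (complex_of_real (log_coeff j * exp (- b) ^ j) * cis (real j * t)))"
  using summable_log_coeff[OF assms] by (simp add: norm_mult norm_power)

lemma summable_npart: 
  assumes "0 < b"
  shows "summable (\<lambda>n. real (npart n) * exp (- b) ^ n)"
proof -
  have "summable (\<lambda>n. of_nat (npart n) * (of_real (exp (- b)) :: complex) ^ n)"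
    using assms by (intro sums_summable[OF npart_sums]) simp
  also have "(\<lambda>n. of_nat (npart n) * (of_real (exp (- b)) :: complex) ^ n)
        = (\<lambda>n. of_real (real (npart n) * exp (- b) ^ n))"
    by simp
  finally show ?thesis by (simp only: summable_of_real_iff)
qed

definition partition_gf :: "real \<Rightarrow> real" where
  "partition_gf b = exp (\<Sum>j. log_coeff j * exp (- b) ^ j)"

lemma partition_gf_pos: "0 < partition_gf b"
  by (simp add: partition_gf_def)

lemma npart_char_fun:
  assumes b: "0 < b"
  shows "(\<Sum>n. of_real (real (npart n) * exp (- b) ^ n) * cis (real n * t)) =
    of_real (partition_gf b) * char_fun b t"
proof -
  let ?a = "\<lambda>j. complex_of_real (log_coeff j * exp (- b) ^ j)"
  define z where "z = of_real (exp (- b)) * cis t"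
  have z: "norm z < 1" using b by (simp add: z_def norm_mult)
  have zj: "z ^ j = of_real (exp (- b) ^ j) * cis (real j * t)" for j
    by (simp add: z_def power_mult_distrib Complex.DeMoivre)
  have "(\<Sum>n. of_real (real (npart n) * exp (- b) ^ n) * cis (real n * t))
        = (\<Sum>n. of_nat (npart n) * z ^ n)"
    by (simp add: zj mult.assoc)
  also have "\<dots> = exp (\<Sum>j. of_real (log_coeff j) * z ^ j)"
    using npart_sums[OF z] by (rule sums_unique[symmetric])
  also have "(\<Sum>j. of_real (log_coeff j) * z ^ j) = (\<Sum>j. ?a j +
      ?a j * (cis (real j * t) - 1))"
    by (simp add: zj algebra_simps)
  also have "\<dots> = (\<Sum>j. ?a j) +
      (\<Sum>j. ?a j * (cis (real j * t) - 1))"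
  proof (rule suminf_add[symmetric])
    show s: "summable (\<lambda>j. ?a j)"
      by (intro summable_of_real summable_log_coeff b)
    show "summable (\<lambda>j. ?a j * (cis (real j * t) - 1))"
      unfolding right_diff_distrib mult_1_right
      by (intro summable_diff s summable_norm_cancel[OF summable_norm_log_coeff_cis[OF b]])
  qed
  also have "(\<Sum>j. ?a j) = of_real (\<Sum>j. log_coeff j * exp (- b) ^ j)"
    by (intro suminf_of_real[symmetric] summable_log_coeff b)
  finally show ?thesis by (simp add: exp_add char_fun_def partition_gf_def exp_of_real)
qed

lemma norm_char_fun:
  assumes b: "0 < b"
  shows "norm (char_fun b t) = exp (- decay b t)"
proof -
  have s: "summable (\<lambda>j. complex_of_real (log_coeff j * exp (- b) ^ j) * (cis (real j * t) - 1))"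
    unfolding right_diff_distrib mult_1_right
    by (intro summable_diff summable_of_real summable_log_coeff b summable_norm_cancel[OF
          summable_norm_log_coeff_cis[OF b]])
  have "Re (\<Sum>j. complex_of_real (log_coeff j * exp (- b) ^ j) * (cis (real j * t) - 1)) =
      (\<Sum>j. - (log_coeff j * exp (- b) ^ j * (1 - cos (real j * t))))"
    by (subst Re_suminf[OF s]) (simp add: algebra_simps)
  also have "\<dots> = - decay b t" unfolding decay_def by (rule suminf_minus[OF summable_decay[OF b]])
  finally show ?thesis by (simp add: char_fun_def norm_exp_eq_Re)
qed

definition near_rate :: real where "near_rate = exp (- 1) / 32000"

definition far_rate :: real where "far_rate = exp (- (1 + pi)) / 32"

lemma rates_pos: "0 < near_rate" "0 < far_rate"
  by (simp_all add: near_rate_def far_rate_def)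

text \<open>Adding the bounds for \<open>\<bar>t\<bar> \<le> b\<close> and
  \<open>\<bar>t\<bar> > b\<close> gives one majorant that can be integrated over the whole
  circle.\<close>

lemma norm_char_fun_le:
  assumes b: "0 < b" "b \<le> 1 / 5" and t: "\<bar>t\<bar> \<le> pi"
  shows "norm (char_fun b t) \<le> exp (- (near_rate / b ^ 3 * t\<^sup>2)) + exp (- far_rate / sqrt b)"
proof (cases "\<bar>t\<bar> \<le> b")
  case True
  then have "norm (char_fun b t) \<le> exp (- (near_rate / b ^ 3 * t\<^sup>2))"
    using decay_near[OF b True] by (simp add: norm_char_fun[OF b(1)] near_rate_def)
  then show ?thesis by (simp add: add_increasing2)
next
  case False
  then have "norm (char_fun b t) \<le> exp (- far_rate / sqrt b)"
    using decay_far[of b t] b t by (simp add: norm_char_fun far_rate_def)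
  then show ?thesis by (simp add: add_increasing)
qed

definition summand_count :: "nat \<Rightarrow> real" where
  "summand_count n = (\<Sum>j\<le>n. real (part_count j) * real (npart (n - j)))"

definition part_count_gf :: "real \<Rightarrow> real" where
  "part_count_gf b = (\<Sum>j. real (part_count j) * exp (- b) ^ j)"

text \<open>The coefficients of \<open>F\<close> and of \<open>T F\<close> carry the same factor
  \<open>exp (- b n) / P\<close>, which cancels in the mean.\<close>

lemma saddle_integrals:
  assumes b: "0 < b"
  defines "P \<equiv> partition_gf b"
    and "T \<equiv> \<lambda>t. \<Sum>j. of_real (real (part_count j) * exp (- b) ^ j) * cis (real j * t)"
  shows "((\<lambda>t. char_fun b t * cis (- (real n * t))) has_integral
      of_real (2 * pi * (real (npart n) * exp (- b) ^ n / P))) {- pi..pi}"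
    and "((\<lambda>t. T t * char_fun b t * cis (- (real n * t))) has_integral
      of_real (2 * pi * (summand_count n * exp (- b) ^ n / P))) {- pi..pi}"
proof -
  have P: "0 < P" by (simp add: P_def partition_gf_pos)
  define w where "w = (\<lambda>n. complex_of_real (real (npart n) * exp (- b) ^ n))"
  define u where "u = (\<lambda>n. complex_of_real (real (part_count n) * exp (- b) ^ n))"
  have wn: "summable (\<lambda>j. norm (w j))" using summable_npart[OF b]
        by (simp add: w_def norm_mult norm_power)
  have un: "summable (\<lambda>j. norm (u j))" using summable_part_count[OF b]
        by (simp add: u_def norm_mult norm_power)
  have wc: "(\<Sum>j. w j * cis (real j * t)) = of_real P * char_fun b t" for t
    using npart_char_fun[OF b] by (simp only: w_def P_def)
  have "((\<lambda>t. (\<Sum>j. w j * cis (real j * t)) * cis (- (real n * t)) / of_real P)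
        has_integral (2 * pi * w n / of_real P)) {- pi..pi}"
    by (intro has_integral_divide coefficient_integral wn)
  then show "((\<lambda>t. char_fun b t * cis (- (real n * t))) has_integral
      of_real (2 * pi * (real (npart n) * exp (- b) ^ n / P))) {- pi..pi}"
    unfolding wc using P by (simp add: w_def mult.assoc)
  define v where "v = (\<lambda>n. \<Sum>i\<le>n. u i * w (n - i))"
  have v: "v n = complex_of_real (summand_count n * exp (- b) ^ n)" for n
  proof -
    have "u i * w (n - i) = of_real (real (part_count i) * real (npart (n - i)) * exp (- b) ^ n)"
          if "i \<le> n" for i
      using that power_add[of "exp (- b)" i "n - i"]
            by (simp add: u_def w_def flip: of_real_mult of_real_power)
    then show ?thesis by (simp add: v_def summand_count_def sum_distrib_right)
  qed
  have vn: "summable (\<lambda>j. norm (v j))"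
  proof -
    have "norm (v j) = (\<Sum>i\<le>j. norm (u i) * norm (w (j - i)))" for j
    proof -
      have "0 \<le> summand_count j" unfolding summand_count_def by (intro sum_nonneg) simp
      then have "norm (v j) = summand_count j * exp (- b) ^ j" unfolding v norm_of_real by simp
      also have "\<dots> = (\<Sum>i\<le>j. norm (u i) * norm (w (j - i)))"
        unfolding summand_count_def sum_distrib_right
      proof (intro sum.cong refl)
        fix i assume "i \<in> {..j}"
        then show "real (part_count i) * real (npart (j - i)) * exp (- b) ^ j
              = norm (u i) * norm (w (j - i))"
          using power_add[of "exp (- b)" i "j - i"] by (simp add: u_def w_def norm_mult norm_power)
      qed
      finally show ?thesis .
    qed
    moreover have "summable (\<lambda>j. \<Sum>i\<le>j. norm (u i) * norm (w (j - i)))"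
      using un wn by (intro summable_Cauchy_product) auto
    ultimately show ?thesis by simp
  qed
  have vc: "(\<Sum>j. v j * cis (real j * t)) = T t * (of_real P * char_fun b t)" for t
  proof -
    have "T t * (of_real P * char_fun b t) = (\<Sum>j. u j * cis (real j * t)) * (\<Sum>j.
          w j * cis (real j * t))"
      unfolding wc T_def u_def ..
    also have "\<dots> = (\<Sum>j. \<Sum>i\<le>j. (u i * cis (real i * t)) * (w (j - i) * cis (real (j - i) * t)))"
      using un wn by (intro Cauchy_product) (simp_all add: norm_mult)
    also have "\<dots> = (\<Sum>j. v j * cis (real j * t))"
    proof (intro suminf_cong)
      fix j
      have "(u i * cis (real i * t)) * (w (j - i) * cis (real (j - i) * t))
            = (u i * w (j - i)) * cis (real j * t)"
        if "i \<le> j" for i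
      proof -
        have "cis (real j * t) = cis (real i * t) * cis (real (j - i) * t)"
          using that by (simp add: cis_mult of_nat_diff algebra_simps)
        then show ?thesis by (simp only: mult_ac)
      qed
      then show "(\<Sum>i\<le>j. (u i * cis (real i * t)) * (w (j - i) * cis (real (j - i) * t)))
            = v j * cis (real j * t)"
        unfolding v_def sum_distrib_right by (intro sum.cong) auto
    qed
    finally show ?thesis by simp
  qed
  have "((\<lambda>t. (\<Sum>j. v j * cis (real j * t)) * cis (- (real n * t)) / of_real P)
        has_integral (2 * pi * v n / of_real P)) {- pi..pi}"
    by (intro has_integral_divide coefficient_integral vn)
  then show "((\<lambda>t. T t * char_fun b t * cis (- (real n * t))) has_integral
      of_real (2 * pi * (summand_count n * exp (- b) ^ n / P))) {- pi..pi}"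
    unfolding vc using P by (simp add: v mult.assoc)
qed

section \<open>Moment and Taylor estimates\<close>

lemma abs_gauss_integral:
  fixes k A :: real
  assumes k: "0 < k" and A: "0 \<le> A"
  obtains I where "((\<lambda>t. \<bar>t\<bar> * exp (- (k * t\<^sup>2))) has_integral I) {- A..A}" "I \<le> 1 / k"
proof -
  define F :: "real \<Rightarrow> real" where "F = (\<lambda>t. exp (- (k * t\<^sup>2)) / (2 * k))"
  have d: "(F has_vector_derivative - t * exp (- (k * t\<^sup>2))) (at t within S)" for t S
    unfolding F_def has_real_derivative_iff_has_vector_derivative[symmetric] using k
    by (auto intro!: derivative_eq_intros simp: field_simps)
  have 1: "((\<lambda>t. - t * exp (- (k * t\<^sup>2))) has_integral (F 0 - F (- A))) {- A..0}"
    using A by (intro fundamental_theorem_of_calculus d) auto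
  have "((\<lambda>t. - t * exp (- (k * t\<^sup>2))) has_integral (F A - F 0)) {0..A}"
    using A by (intro fundamental_theorem_of_calculus d) auto
  from has_integral_neg[OF this] have 2: "((\<lambda>t. t * exp (- (k * t\<^sup>2)))
        has_integral (F 0 - F A)) {0..A}" by simp
  have "((\<lambda>t. \<bar>t\<bar> * exp (- (k * t\<^sup>2))) has_integral (F 0 - F (- A)) + (F 0 - F A)) {- A..A}"
  proof (rule has_integral_combine[of _ 0])
    show "((\<lambda>t. \<bar>t\<bar> * exp (- (k * t\<^sup>2))) has_integral (F 0 - F (- A))) {- A..0}"
      using 1 by (rule has_integral_eq[rotated]) auto
    show "((\<lambda>t. \<bar>t\<bar> * exp (- (k * t\<^sup>2))) has_integral (F 0 - F A)) {0..A}"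
      using 2 by (rule has_integral_eq[rotated]) auto
  qed (use A in auto)
  moreover have "(F 0 - F (- A)) + (F 0 - F A) \<le> 1 / k"
  proof -
    have "0 \<le> F A" "0 \<le> F (- A)" "F 0 = 1 / (2 * k)" using k by (auto simp: F_def)
    moreover have "1 / (2 * k) + 1 / (2 * k) = 1 / k" using k by simp
    ultimately show ?thesis by linarith
  qed
  ultimately show ?thesis by (rule that)
qed

text \<open>The left half-plane is convex and the derivative of \<open>exp\<close> there has modulus
  at most 1. This compares \<open>char_fun\<close> with a Gaussian through their exponents.\<close>

lemma norm_exp_diff_le:
  assumes "Re z \<le> 0" "Re w \<le> 0"
  shows "norm (exp z - exp w) \<le> norm (z - w)"
proof -
  have "norm (exp z - exp w) \<le> 1 * norm (z - w)"
  proof (rule field_differentiable_bound[where S = "{z. Re z \<le> 0}" and f' = exp])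
    show "convex {z. Re z \<le> 0}" by (rule convex_halfspace_Re_le)
    fix u assume "u \<in> {z. Re z \<le> 0}"
    then show "norm (exp u) \<le> 1" by (simp add: norm_exp_eq_Re)
    show "(exp has_field_derivative exp u) (at u within {z. Re z \<le> 0})"
      by (intro DERIV_exp has_field_derivative_at_within)
  qed (use assms in auto)
  then show ?thesis by simp
qed

lemma norm_cis_diff_1_le: "norm (cis x - 1) \<le> \<bar>x\<bar>"
  using iexp_approx1[of x 0] by (simp add: cis_conv_exp)

lemma norm_cis_taylor: "norm (cis x - 1 - \<i> * of_real x + of_real (x\<^sup>2 / 2)) \<le> \<bar>x\<bar> ^ 3 / 6"
proof -
  have "(\<Sum>k\<le>2. (\<i> * complex_of_real x) ^ k / fact k) = 1 + \<i> * of_real x - of_real (x\<^sup>2 / 2)"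
    by (simp add: eval_nat_numeral field_simps)
  then show ?thesis
    using iexp_approx1[of x 2] by (simp add: cis_conv_exp algebra_simps eval_nat_numeral)
qed

text \<open>Half of the damping pays for the factor \<open>j\<close>, so a moment at
  \<open>b\<close> is controlled by the generating function at \<open>b / 2\<close>.\<close>

lemma mult_exp_power_le:
  assumes b: "0 < b"
  shows "real j * exp (- b) ^ j \<le> 2 / b * exp (- (b / 2)) ^ j"
proof -
  define y where "y = b / 2 * real j"
  have "y \<le> exp y" using exp_ge_add_one_self[of y] by linarith
  then have "y * exp (- (2 * y)) \<le> exp y * exp (- (2 * y))" by (intro mult_right_mono) auto
  also have "exp y * exp (- (2 * y)) = exp (- y)" by (simp add: mult_exp_exp)
  finally have "2 / b * (y * exp (- (2 * y))) \<le> 2 / b * exp (- y)" using b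
        by (intro mult_left_mono) auto
  then show ?thesis using b by (simp add: y_def exp_of_nat_mult[symmetric] mult_ac)
qed

lemma sq_mult_exp_power_le:
  assumes b: "0 < b"
  shows "(real j)\<^sup>2 * exp (- b) ^ j \<le> 8 / b\<^sup>2 * exp (- (b / 2)) ^ j"
proof -
  define y where "y = b / 2 * real j"
  have "1 + y + y\<^sup>2 / 2 \<le> exp y" using b by (intro exp_lower_Taylor_quadratic) (simp add: y_def)
  moreover have "0 \<le> y" using b by (simp add: y_def)
  ultimately have "y\<^sup>2 \<le> 2 * exp y" by linarith
  then have "y\<^sup>2 * exp (- (2 * y)) \<le> 2 * exp y * exp (- (2 * y))" by (intro mult_right_mono) auto
  also have "2 * exp y * exp (- (2 * y)) = 2 * exp (- y)" by (simp add: mult_exp_exp)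
  finally have "4 / b\<^sup>2 * (y\<^sup>2 * exp (- (2 * y))) \<le> 4 / b\<^sup>2 * (2 * exp (- y))"
        by (intro mult_left_mono) auto
  then show ?thesis using b by (simp add: y_def exp_of_nat_mult[symmetric] power_mult_distrib
        power_divide mult_ac)
qed

definition part_sum_gf :: "real \<Rightarrow> real" where
  "part_sum_gf b = (\<Sum>j. real (part_sum j) * exp (- b) ^ j)"

lemma part_sum_gf_approx:
  assumes "0 < b"
  shows "\<bar>part_sum_gf b - pi / 4 * riemann_zeta 2 / b\<^sup>2\<bar>
        \<le> 17 * zeta_three_halves * b powr (- 3 / 2)"
proof -
  obtain S where "(\<lambda>j. real (part_sum j) * exp (- b) ^ j) sums S"
    "\<bar>S - pi / 4 * riemann_zeta 2 / b\<^sup>2\<bar> \<le> 17 * zeta_three_halves * b powr (- 3 / 2)"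
    using part_sum_sums[OF assms] .
  then show ?thesis unfolding part_sum_gf_def by (simp add: sums_iff)
qed

lemma part_count_gf_approx:
  assumes "0 < b" "b \<le> 1"
  shows "\<bar>b * part_count_gf b - (zeta_const - pi / 4 * ln b)\<bar> \<le> 9 * sqrt b"
proof -
  obtain S where "(\<lambda>j. real (part_count j) * exp (- b) ^ j) sums S"
    "\<bar>b * S - (zeta_const - pi / 4 * ln b)\<bar> \<le> 9 * sqrt b"
    using part_count_sums[OF assms] .
  then show ?thesis unfolding part_count_gf_def by (simp add: sums_iff)
qed

lemma zeta_three_halves_nonneg: "0 \<le> zeta_three_halves"
  unfolding zeta_three_halves_def using sums_summable[OF three_halves_sums[of 1]]
  by (intro suminf_nonneg) auto

lemma part_sum_gf_le: 
  obtains C where "0 < C" "\<And>b. 0 < b \<Longrightarrow> b \<le> 1 \<Longrightarrow> part_sum_gf b \<le> C / b\<^sup>2"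
proof -
  define C where "C = pi / 4 * riemann_zeta 2 + 17 * zeta_three_halves"
  have "0 < C" unfolding C_def using riemann_zeta_2_pos zeta_three_halves_nonneg
        by (simp add: add_pos_nonneg)
  moreover have "part_sum_gf b \<le> C / b\<^sup>2" if b: "0 < b" "b \<le> 1" for b
  proof -
    have "b powr (- 3 / 2) \<le> b powr (- 2)" using b by (intro powr_mono') auto
    also have "b powr (- 2) = 1 / b\<^sup>2" using b by (simp add: powr_minus divide_inverse)
    finally have "17 * zeta_three_halves * b powr (- 3 / 2) \<le> 17 * zeta_three_halves * (1 / b\<^sup>2)"
      using zeta_three_halves_nonneg by (intro mult_left_mono) auto
    then show ?thesis using part_sum_gf_approx[OF b(1)]
          by (simp add: C_def add_divide_distrib abs_le_iff)
  qed
  ultimately show ?thesis by (rule that)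
qed

lemma has_integral_norm_bound:
  fixes f :: "'n::euclidean_space \<Rightarrow> 'a::banach"
  assumes "(f has_integral i) S" "(g has_integral j) S" "\<And>x. x \<in> S \<Longrightarrow> norm (f x) \<le> g x"
  shows "norm i \<le> j"
  using integral_norm_bound_integral[of f S g] assms
        by (metis has_integral_integrable integral_unique)

text \<open>The integrand is \<open>T(t) - T(0)\<close> times \<open>char_fun\<close>, so a
  Lipschitz bound for \<open>T\<close> leaves the first absolute moment of the majorant. Its
  Gaussian part gives \<open>b^3 / near_rate\<close>, and \<open>\<bar>t\<bar> \<le> pi\<close> on
  an interval of length \<open>2 pi\<close> gives the other part.\<close>

lemma summand_count_deviation:
  assumes b: "0 < b" "b \<le> 1 / 5"
  shows "\<bar>2 * pi * ((summand_count n - real (npart n) * part_count_gf b) * exp (- b) ^ n /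
        partition_gf b)\<bar>
    \<le> 2 / b * part_count_gf (b / 2) * (b ^ 3 / near_rate + 2 * pi\<^sup>2 * exp (- far_rate / sqrt b))"
proof -
  let ?u = "\<lambda>j. complex_of_real (real (part_count j) * exp (- b) ^ j)"
  let ?e = "\<lambda>t. char_fun b t * cis (- (real n * t))"
  define P where "P = partition_gf b"
  define T where "T = (\<lambda>t. \<Sum>j. ?u j * cis (real j * t))"
  define T0 where "T0 = part_count_gf b"
  define k where "k = near_rate / b ^ 3"
  define e where "e = exp (- far_rate / sqrt b)"
  define D where "D = 2 / b * part_count_gf (b / 2)"
  have k: "0 < k" using b rates_pos by (simp add: k_def)
  let ?d = "2 * pi * ((summand_count n - real (npart n) * T0) * exp (- b) ^ n / P)"
  have "((\<lambda>t. T t * char_fun b t * cis (- (real n * t)) - of_real T0 * ?e t) has_integral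
      (of_real (2 * pi * (summand_count n * exp (- b) ^ n / P)) - of_real T0 * of_real (2 * pi *
          (real (npart n) * exp (- b) ^ n / P)))) {- pi..pi}"
    using saddle_integrals[OF b(1), of n] unfolding P_def T_def
    by (intro has_integral_diff has_integral_mult_right)
  also have "of_real (2 * pi * (summand_count n * exp (- b) ^ n / P)) - of_real T0 * of_real (2 *
        pi * (real (npart n) * exp (- b) ^ n / P))
      = complex_of_real ?d"
  proof -
    have "2 * pi * (summand_count n * exp (- b) ^ n / P) - T0 * (2 * pi * (real (npart n) * exp (-
          b) ^ n / P))
      = ?d"
      by (simp add: left_diff_distrib diff_divide_distrib right_diff_distrib)
    then show ?thesis by (metis of_real_diff of_real_mult)
  qed
  finally have int: "((\<lambda>t. T t * char_fun b t * cis (- (real n * t)) - of_real T0 * ?e t)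
        has_integral
      complex_of_real ?d) {- pi..pi}" .
  have D: "norm (T t - of_real T0) \<le> D * \<bar>t\<bar>" for t
  proof -
    have s: "summable (\<lambda>j. ?u j)"
      by (intro summable_of_real summable_part_count b)
    have s': "summable (\<lambda>j. ?u j * cis (real j * t))"
      by (rule summable_norm_cancel) (use summable_part_count[OF b(1)] in \<open>simp add: norm_mult
            norm_power\<close>)
    have "of_real T0 = (\<Sum>j. ?u j)"
      unfolding T0_def part_count_gf_def by (rule suminf_of_real[OF summable_part_count[OF b(1)]])
    then have "T t - of_real T0 = (\<Sum>j. ?u j * cis (real j * t) - ?u j)"
      unfolding T_def by (simp only: suminf_diff[OF s' s])
    also have "norm \<dots> \<le> (\<Sum>j. 2 / b * \<bar>t\<bar> * (real (part_count j) * exp (- (b / 2)) ^ j))"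
    proof (rule norm_suminf_le)
      fix j
      have "norm (?u j * cis (real j * t) - ?u j)
          = real (part_count j) * exp (- b) ^ j * norm (cis (real j * t) - 1)"
      proof -
        have "?u j * cis (real j * t) - ?u j
            = ?u j * (cis (real j * t) - 1)" by (simp add: algebra_simps)
        then show ?thesis by (simp only: norm_mult norm_of_real) simp
      qed
      also have "\<dots> \<le> real (part_count j) * exp (- b) ^ j * (real j * \<bar>t\<bar>)"
        using norm_cis_diff_1_le[of "real j * t"] by (intro mult_left_mono) (auto simp: abs_mult)
      also have "\<dots> = real (part_count j) * \<bar>t\<bar> * (real j * exp (- b) ^ j)" by simp
      also have "\<dots> \<le> real (part_count j) * \<bar>t\<bar> * (2 / b * exp (- (b / 2)) ^ j)"
        using mult_exp_power_le[OF b(1)] by (intro mult_left_mono) auto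
      finally show "norm (?u j * cis (real j * t) - ?u j)
          \<le> 2 / b * \<bar>t\<bar> * (real (part_count j) * exp (- (b / 2)) ^ j)" by (simp add: mult_ac)
    qed (use b in \<open>intro summable_mult summable_part_count, simp\<close>)
    also have "\<dots> = D * \<bar>t\<bar>"
      unfolding D_def part_count_gf_def using b
            by (subst suminf_mult) (auto intro!: summable_part_count)
    finally show ?thesis .
  qed
  have D0: "0 \<le> D" using order_trans[OF norm_ge_zero D[of 1]] by simp
  obtain I where I: "((\<lambda>t. \<bar>t\<bar> * exp (- (k * t\<^sup>2))) has_integral I) {- pi..pi}" "I \<le> 1 / k"
    using abs_gauss_integral[OF k pi_ge_zero] by blast
  have c: "((\<lambda>t. pi * e) has_integral (2 * pi * (pi * e))) {- pi..pi}"
    using has_integral_const_real[of "pi * e" "- pi" pi] by simp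
  have maj: "((\<lambda>t. D * (\<bar>t\<bar> * exp (- (k * t\<^sup>2)) + pi * e))
        has_integral D * (I + 2 * pi * (pi * e))) {- pi..pi}"
    by (intro has_integral_mult_right has_integral_add I c)
  have "norm (complex_of_real ?d) \<le> D * (I + 2 * pi * (pi * e))"
  proof (rule has_integral_norm_bound[OF int maj])
    fix t assume t: "t \<in> {- pi..pi}"
    have "T t * char_fun b t * cis (- (real n * t)) - of_real T0 * ?e t
        = (T t - of_real T0) * char_fun b t * cis (- (real n * t))" by (simp add: algebra_simps)
    also have "norm \<dots> = norm (T t - of_real T0) * norm (char_fun b t)" by (simp add: norm_mult)
    also have "\<dots> \<le> D * \<bar>t\<bar> * (exp (- (k * t\<^sup>2)) + e)"
      using norm_char_fun_le[OF b, of t] t D0 unfolding k_def e_def by (intro mult_mono D) auto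
    also have "\<dots> = D * (\<bar>t\<bar> * exp (- (k * t\<^sup>2)) + \<bar>t\<bar> * e)" by (simp add: algebra_simps)
    also have "\<dots> \<le> D * (\<bar>t\<bar> * exp (- (k * t\<^sup>2)) + pi * e)"
      using t D0 by (intro mult_left_mono add_left_mono mult_right_mono) (auto simp: e_def)
    finally show "norm (T t * char_fun b t * cis (- (real n * t)) - of_real T0 * ?e t)
        \<le> D * (\<bar>t\<bar> * exp (- (k * t\<^sup>2)) + pi * e)" .
  qed
  also have "\<dots> \<le> D * (1 / k + 2 * pi * (pi * e))" using I D0 by (intro mult_left_mono) auto
  also have "\<dots> = D * (b ^ 3 / near_rate + 2 * pi\<^sup>2 * e)" by (simp add: k_def power2_eq_square)
  finally show ?thesis unfolding P_def T0_def D_def e_def norm_of_real .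
qed

text \<open>
  For \<open>\<bar>t\<bar> \<le> M * b powr (3 / 2)\<close> the integrand is compared with a Gaussian. Beyond that, the
  factor \<open>\<bar>t\<bar> / (M * b powr (3 / 2)) \<ge> 1\<close> turns the tail into a first moment, which the choice of
  \<open>M\<close> makes smaller than half of the main term.
\<close>

lemma npart_lower:
  obtains c b0 where "0 < c" "0 < b0" "b0 \<le> 1 / 5"
    "\<And>b n. 0 < b \<Longrightarrow> b \<le> b0 \<Longrightarrow> part_sum_gf b = real n \<Longrightarrow>
      c * b powr (3 / 2) \<le> 2 * pi * (real (npart n) * exp (- b) ^ n / partition_gf b)"
proof -
  obtain C where C: "0 < C" "\<And>b. 0 < b \<Longrightarrow> b \<le> 1 \<Longrightarrow> part_sum_gf b \<le> C / b\<^sup>2"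
    using part_sum_gf_le by blast
  \<comment> \<open>\<open>V / b^3\<close> and \<open>A / b^4\<close> will bound the second and
    third cumulants \<open>v\<close> and \<open>a3\<close>; \<open>E\<close> is the least value of
    the Gaussian on \<open>\<bar>t\<bar> \<le> b powr (3 / 2)\<close>, as far as this bound
    shows.\<close>
  define V where "V = 8 * C"
  define A where "A = 32 * C"
  define E where "E = exp (- (V / 2))"
  \<comment> \<open>Large enough that the tail, at most \<open>d / (near_rate * M)\<close>, is at
    most \<open>d * E\<close>, half of the main contribution \<open>2 * d * E\<close>.\<close>
  define M where "M = max 1 (1 / (near_rate * E))"
  have M: "1 \<le> M" "1 / (near_rate * M) \<le> E"
  proof -
    show "1 \<le> M" by (simp add: M_def)
    have "1 / (near_rate * E) \<le> M" by (simp add: M_def)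
    then have "1 \<le> M * (near_rate * E)" using rates_pos by (simp add: E_def field_simps)
    then show "1 / (near_rate * M) \<le> E" using rates_pos \<open>1 \<le> M\<close> by (simp add: field_simps)
  qed
  have E: "0 < E" by (simp add: E_def)
  define K where "K = A * M ^ 4 / 3"
  have K: "0 \<le> K" using C(1) M by (simp add: K_def A_def)
  have fr: "0 < far_rate" by (rule rates_pos)
  have lim: "((\<lambda>b. (K * b\<^sup>2 + 2 * pi * exp (- far_rate / sqrt b)) / b powr (3 / 2))
        \<longlongrightarrow> 0) (at_right 0)"
    using fr by real_asymp
  have lim2: "((\<lambda>b. M * b powr (3 / 2)) \<longlongrightarrow> 0) (at_right 0)" by real_asymp
  have "\<forall>\<^sub>F b in at_right 0. (K * b\<^sup>2 + 2 * pi * exp (- far_rate / sqrt b)) / b powr (3 / 2)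
        < E / 2 \<and> M * b powr (3 / 2) < pi"
    using E by (intro eventually_conj order_tendstoD(2)[OF lim] order_tendstoD(2)[OF lim2]) auto
  then obtain b1 where b1: "0 < b1" "\<And>b. 0 < b \<Longrightarrow> b < b1 \<Longrightarrow>
      (K * b\<^sup>2 + 2 * pi * exp (- far_rate / sqrt b)) / b powr (3 / 2) < E / 2 \<and>
          M * b powr (3 / 2) < pi"
    unfolding eventually_at_right_field by auto
  define b0 where "b0 = min (b1 / 2) (1 / 5)"
  show ?thesis
  proof (rule that[of "E / 2" b0])
    show "0 < E / 2" "0 < b0" "b0 \<le> 1 / 5" using E b1 by (auto simp: b0_def)
    fix b :: real and n :: nat assume b: "0 < b" "b \<le> b0" and n: "part_sum_gf b = real n"
    have b5: "b \<le> 1 / 5" and bb1: "b < b1" using b b1 by (auto simp: b0_def)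
    define P where "P = partition_gf b"
    define W where "W = 2 * pi * (real (npart n) * exp (- b) ^ n / P)"
    define k where "k = near_rate / b ^ 3"
    define e where "e = exp (- far_rate / sqrt b)"
    define d where "d = b powr (3 / 2)"
    have d0: "0 < d" using b by (simp add: d_def)
    have d2: "d\<^sup>2 = b ^ 3" using b by (simp add: d_def powr_power powr_numeral)
    define \<delta> where "\<delta> = M * d"
    have \<delta>: "d \<le> \<delta>" "\<delta> < pi" "0 < \<delta>"
      using M d0 b1(2)[OF b(1) bb1] by (auto simp: \<delta>_def d_def)
    have k: "0 < k" using b rates_pos by (simp add: k_def)
    define v where "v = (\<Sum>j. real j * real (part_sum j) * exp (- b) ^ j)"
    have half: "summable (\<lambda>j. real (part_sum j) * exp (- (b / 2)) ^ j)" using b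
          by (intro summable_part_sum) simp
    have gf_half: "part_sum_gf (b / 2) \<le> 4 * C / b\<^sup>2"
      using C(2)[of "b / 2"] b b5 by (simp add: power_divide mult.commute)
    have vle: "real j * real (part_sum j) * exp (- b) ^ j
          \<le> 2 / b * (real (part_sum j) * exp (- (b / 2)) ^ j)" for j
      using mult_left_mono[OF mult_exp_power_le[OF b(1), of j], of "real (part_sum j)"]
            by (simp add: mult_ac)
    have vs: "summable (\<lambda>j. real j * real (part_sum j) * exp (- b) ^ j)"
      by (rule summable_comparison_test'[OF summable_mult[OF half, of
            "2 / b"], of 0]) (use vle in auto)
    have v0: "0 \<le> v" unfolding v_def by (intro suminf_nonneg vs) auto
    have "v \<le> (\<Sum>j. 2 / b * (real (part_sum j) * exp (- (b / 2)) ^ j))"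
      unfolding v_def by (intro suminf_le vle vs summable_mult half)
    also have "\<dots> = 2 / b * part_sum_gf (b / 2)" unfolding part_sum_gf_def
          by (rule suminf_mult[OF half])
    also have "\<dots> \<le> 2 / b * (4 * C / b\<^sup>2)" using gf_half b by (intro mult_left_mono) auto
    also have "\<dots> = V / b ^ 3" by (simp add: V_def eval_nat_numeral)
    finally have vV: "v \<le> V / b ^ 3" .
    define a3 where "a3 = (\<Sum>j. (real j)\<^sup>2 * real (part_sum j) * exp (- b) ^ j)"
    have ale: "(real j)\<^sup>2 * real (part_sum j) * exp (- b) ^ j
          \<le> 8 / b\<^sup>2 * (real (part_sum j) * exp (- (b / 2)) ^ j)" for j
      using mult_left_mono[OF sq_mult_exp_power_le[OF b(1), of j], of "real (part_sum j)"]
            by (simp add: mult_ac)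
    have as: "summable (\<lambda>j. (real j)\<^sup>2 * real (part_sum j) * exp (- b) ^ j)"
      by (rule summable_comparison_test'[OF summable_mult[OF half, of
            "8 / b\<^sup>2"], of 0]) (use ale in auto)
    have a0: "0 \<le> a3" unfolding a3_def by (intro suminf_nonneg as) auto
    have "a3 \<le> (\<Sum>j. 8 / b\<^sup>2 * (real (part_sum j) * exp (- (b / 2)) ^ j))"
      unfolding a3_def by (intro suminf_le ale as summable_mult half)
    also have "\<dots> = 8 / b\<^sup>2 * part_sum_gf (b / 2)" unfolding part_sum_gf_def
          by (rule suminf_mult[OF half])
    also have "\<dots> \<le> 8 / b\<^sup>2 * (4 * C / b\<^sup>2)" using gf_half b by (intro mult_left_mono) auto
    also have "\<dots> = A / b ^ 4" by (simp add: A_def eval_nat_numeral)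
    finally have aA: "a3 \<le> A / b ^ 4" .
    let ?e = "\<lambda>t. char_fun b t * cis (- (real n * t))"
    let ?rem = "\<lambda>x. cis x - 1 - \<i> * of_real x + of_real (x\<^sup>2 / 2)"
    \<comment> \<open>The exponent is expanded to second order. All terms of third order are
      collected in \<open>a3\<close>, since
      \<open>j^3 * log_coeff j = j^2 * part_sum j\<close>.\<close>
    have taylor: "norm (?e t - of_real (exp (- (v * t\<^sup>2 / 2)))) \<le> a3 * \<bar>t\<bar> ^ 3 / 6" for t
    proof -
      define q where "q = (\<lambda>j. complex_of_real (log_coeff j * exp (- b) ^ j))"
      define z where "z = (\<Sum>j. q j * (cis (real j * t) - 1)) - \<i> * of_real (real n * t)"
      have qs: "summable (\<lambda>j. q j * (cis (real j * t) - 1))"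
        unfolding q_def right_diff_distrib mult_1_right
        by (intro summable_diff summable_of_real summable_log_coeff b summable_norm_cancel[OF
              summable_norm_log_coeff_cis[OF b(1)]])
      have ez: "exp z = ?e t"
        by (simp add: z_def char_fun_def q_def exp_diff cis_conv_exp exp_minus divide_inverse)
      have "Re z \<le> 0"
      proof -
        have "exp (Re z) = exp (- decay b t)"
          unfolding norm_exp_eq_Re[symmetric] ez by (simp add: norm_mult norm_char_fun[OF b(1)])
        moreover have "0 \<le> decay b t" unfolding decay_def
              by (intro suminf_nonneg summable_decay b) auto
        ultimately show ?thesis by simp
      qed
      then have "norm (exp z - exp (of_real (- (v * t\<^sup>2 / 2))))
            \<le> norm (z - of_real (- (v * t\<^sup>2 / 2)))"
        using v0 by (intro norm_exp_diff_le) auto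
      also have "z - of_real (- (v * t\<^sup>2 / 2)) = (\<Sum>j. q j * ?rem (real j * t))"
      proof -
        have m: "complex_of_nat (part_sum j) = of_nat j * of_real (log_coeff j)" for j
          by (metis mult_log_coeff of_real_mult of_real_of_nat_eq)
        have 1: "(\<lambda>j. q j * (cis (real j * t) - 1)) sums (\<Sum>j. q j * (cis (real j * t) - 1))"
          by (rule summable_sums[OF qs])
        have g2: "(\<lambda>j. \<i> * of_real t * complex_of_real (real (part_sum j) * exp (- b) ^ j))
              sums (\<i> * of_real t * of_real (part_sum_gf b))"
          unfolding part_sum_gf_def by (intro sums_mult sums_of_real summable_sums
                summable_part_sum b)
        have e2: "\<i> * of_real t * complex_of_real (real (part_sum j) * exp (- b) ^ j)
              = q j * (\<i> * of_real (real j * t))" for j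
          by (simp add: q_def m)
        \<comment> \<open>The saddle point equation enters here: the linear term is exactly
          \<open>n t\<close> and cancels against \<open>cis (- (n t))\<close>.\<close>
        have 2: "(\<lambda>j. q j * (\<i> * of_real (real j * t))) sums (\<i> * of_real (real n * t))"
          using g2[unfolded e2 n] by (simp only: of_real_mult mult_ac)
        have g3: "(\<lambda>j. of_real (t\<^sup>2 / 2) * complex_of_real (real j * real (part_sum j) * exp (- b)
              ^ j)) sums (of_real (t\<^sup>2 / 2) * of_real v)"
          unfolding v_def by (intro sums_mult sums_of_real summable_sums vs)
        have e3: "of_real (t\<^sup>2 / 2) * complex_of_real (real j * real (part_sum j) * exp (- b) ^ j)
              = q j * of_real ((real j * t)\<^sup>2 / 2)" for j
          by (simp add: q_def m power2_eq_square)
        have 3: "(\<lambda>j. q j * of_real ((real j * t)\<^sup>2 / 2)) sums (of_real (v * t\<^sup>2 / 2))"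
          using g3[unfolded e3] by (simp only: of_real_mult[symmetric] mult_ac
                times_divide_eq_left times_divide_eq_right)
        from sums_add[OF sums_diff[OF 1 2] 3]
        have "(\<lambda>j. q j * ?rem (real j * t)) sums (z - of_real (- (v * t\<^sup>2 / 2)))"
          unfolding z_def by (simp add: algebra_simps)
        then show ?thesis by (rule sums_unique)
      qed
      also have "norm \<dots> \<le> (\<Sum>j. \<bar>t\<bar> ^ 3 / 6 * ((real j)\<^sup>2 * real (part_sum j) * exp (- b) ^ j))"
      proof (rule norm_suminf_le)
        fix j
        have "norm (q j * ?rem (real j * t))
            \<le> norm (q j) * (\<bar>real j * t\<bar> ^ 3 / 6)"
          unfolding norm_mult by (intro mult_left_mono norm_cis_taylor) auto
        also have "norm (q j) = log_coeff j * exp (- b) ^ j" unfolding q_def norm_of_real by simp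
        also have "log_coeff j * exp (- b) ^ j * (\<bar>real j * t\<bar> ^ 3 / 6)
              = \<bar>t\<bar> ^ 3 / 6 * ((real j)\<^sup>2 * (real j * log_coeff j) * exp (- b) ^ j)"
        proof -
          have "\<bar>real j * t\<bar> ^ 3 = (real j)\<^sup>2 * real j * \<bar>t\<bar> ^ 3"
            by (simp add: abs_mult power_mult_distrib power3_eq_cube power2_eq_square)
          then show ?thesis by (simp only: mult_ac times_divide_eq_left times_divide_eq_right)
        qed
        finally show "norm (q j * ?rem (real j * t))
            \<le> \<bar>t\<bar> ^ 3 / 6 * ((real j)\<^sup>2 * real (part_sum j) * exp (- b) ^ j)" by simp
      qed (intro summable_mult as)
      also have "\<dots> = a3 * \<bar>t\<bar> ^ 3 / 6" unfolding a3_def by (subst suminf_mult[OF as]) simp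
      finally show ?thesis unfolding ez exp_of_real .
    qed
    \<comment> \<open>An integrable minorant: the Gaussian is kept as the constant \<open>E\<close>
      on \<open>\<bar>t\<bar> \<le> d\<close>, the cubic error is charged on
      \<open>\<bar>t\<bar> \<le> \<delta>\<close>, and the tail majorant everywhere.\<close>
    define low where "low = (\<lambda>t. (if t \<in> {- d..d} then E else 0) - (if t \<in> {- \<delta>..\<delta>} then a3 * \<delta> ^
          3 / 6 else 0)
      - (1 / \<delta> * (\<bar>t\<bar> * exp (- (k * t\<^sup>2))) + e))"
    have lower: "low t \<le> Re (?e t)" if t: "t \<in> {- pi..pi}" for t
    proof -
      have e0: "0 \<le> 1 / \<delta> * (\<bar>t\<bar> * exp (- (k * t\<^sup>2))) + e" using \<delta> by (simp add: e_def)
      show ?thesis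
      proof (cases "\<bar>t\<bar> \<le> \<delta>")
        case True
        have "\<bar>Re (?e t) - exp (- (v * t\<^sup>2 / 2))\<bar> \<le> a3 * \<bar>t\<bar> ^ 3 / 6"
          using order_trans[OF abs_Re_le_cmod taylor[of t]] by simp
        moreover have "a3 * \<bar>t\<bar> ^ 3 / 6 \<le> a3 * \<delta> ^ 3 / 6"
          using True a0 by (intro divide_right_mono mult_left_mono power_mono) auto
        moreover have "(if t \<in> {- d..d} then E else 0) \<le> exp (- (v * t\<^sup>2 / 2))"
        proof (cases "t \<in> {- d..d}")
          case True
          then have "t\<^sup>2 \<le> b ^ 3" using d0 power_mono[of "\<bar>t\<bar>" d 2] unfolding d2 by auto
          then have "v * t\<^sup>2 \<le> V / b ^ 3 * b ^ 3" using vV v0 C(1) b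
                by (intro mult_mono) (auto simp: V_def)
          then show ?thesis using True b by (simp add: E_def)
        next
          case False
          show ?thesis unfolding if_not_P[OF False] by simp
        qed
        moreover have "t \<in> {- \<delta>..\<delta>}" using True by auto
        then have "low t = (if t \<in> {- d..d} then E else 0) - a3 * \<delta> ^ 3 / 6
            - (1 / \<delta> * (\<bar>t\<bar> * exp (- (k * t\<^sup>2))) + e)"
          by (simp only: low_def if_True)
        ultimately show ?thesis using e0 unfolding abs_le_iff by linarith
      next
        case False
        have "\<bar>Re (?e t)\<bar> \<le> norm (char_fun b t)"
          using abs_Re_le_cmod[of "?e t"] by (simp add: norm_mult)
        also have "\<dots> \<le> exp (- (k * t\<^sup>2)) + e"
          using norm_char_fun_le[OF b(1) b5, of t] t unfolding k_def e_def by auto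
        also have "\<dots> \<le> 1 / \<delta> * (\<bar>t\<bar> * exp (- (k * t\<^sup>2))) + e"
          using False \<delta> by (simp add: field_simps)
        finally have "- (1 / \<delta> * (\<bar>t\<bar> * exp (- (k * t\<^sup>2))) + e) \<le> Re (?e t)" by linarith
        moreover have nt: "t \<notin> {- \<delta>..\<delta>}" "t \<notin> {- d..d}" using False \<delta> by auto
        have "low t = - (1 / \<delta> * (\<bar>t\<bar> * exp (- (k * t\<^sup>2))) + e)"
          unfolding low_def if_not_P[OF nt(1)] if_not_P[OF nt(2)] by simp
        ultimately show ?thesis by linarith
      qed
    qed
    have ind: "((\<lambda>t. if t \<in> {- r..r} then c else 0) has_integral 2 * r * c) {- pi..pi}" if "0 \<le> r"
          "r \<le> pi" for r c :: real
    proof -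
      have "((\<lambda>t. c) has_integral 2 * r * c) {- r..r}" using has_integral_const_real[of c
            "- r" r] that by simp
      then show ?thesis using that by (subst has_integral_restrict) auto
    qed
    obtain I where I: "((\<lambda>t. \<bar>t\<bar> * exp (- (k * t\<^sup>2))) has_integral I) {- pi..pi}" "I \<le> 1 / k"
      using abs_gauss_integral[OF k pi_ge_zero] by blast
    have ec: "((\<lambda>t. e) has_integral (2 * pi * e)) {- pi..pi}"
      using has_integral_const_real[of e "- pi" pi] by simp
    have "(low has_integral (2 * d * E - 2 * \<delta> * (a3 * \<delta> ^ 3 / 6) - (1 / \<delta> * I + 2 * pi * e))) {-
          pi..pi}"
      unfolding low_def using \<delta> d0
      by (intro has_integral_diff has_integral_add has_integral_mult_right ind I ec) auto
    moreover have "((\<lambda>t. Re (?e t)) has_integral W) {- pi..pi}"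
      using has_integral_Re[OF saddle_integrals(1)[OF b(1), of n]]
            by (simp only: W_def P_def Re_complex_of_real)
    ultimately have "2 * d * E - 2 * \<delta> * (a3 * \<delta> ^ 3 / 6) - (1 / \<delta> * I + 2 * pi * e) \<le> W"
      by (rule has_integral_le) (use lower in auto)
    moreover have "1 / \<delta> * I \<le> d * E"
    proof -
      have "1 / \<delta> * I \<le> 1 / \<delta> * (1 / k)" using I \<delta> by (intro mult_left_mono) auto
      also have "\<dots> = b ^ 3 / d * (1 / (near_rate * M))" by (simp add: \<delta>_def k_def)
      also have "b ^ 3 / d = d" using d0 by (simp add: d2[symmetric] power2_eq_square)
      also have "d * (1 / (near_rate * M)) \<le> d * E" using M d0 by (intro mult_left_mono) auto
      finally show ?thesis .
    qed
    moreover have "2 * \<delta> * (a3 * \<delta> ^ 3 / 6) \<le> K * b\<^sup>2"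
    proof -
      have "2 * \<delta> * (a3 * \<delta> ^ 3 / 6) = a3 * (M ^ 4 * (d\<^sup>2)\<^sup>2 / 3)"
        by (simp add: \<delta>_def eval_nat_numeral)
      also have "\<dots> \<le> A / b ^ 4 * (M ^ 4 * (d\<^sup>2)\<^sup>2 / 3)" using aA M by (intro mult_right_mono) auto
      also have "\<dots> = K * b\<^sup>2" using b by (simp add: d2 K_def field_simps flip: power_mult power_add)
      finally show ?thesis .
    qed
    moreover have "K * b\<^sup>2 + 2 * pi * e < E / 2 * d"
      using b1(2)[OF b(1) bb1] d0 unfolding d_def[symmetric] e_def by (simp add: divide_less_eq)
    \<comment> \<open>Of \<open>2 * d * E\<close> the tail takes at most \<open>d * E\<close>, cubic
      error and exponentially small part together less than \<open>d * E / 2\<close>.\<close>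
    ultimately have "E / 2 * d \<le> W" by (simp add: algebra_simps)
    then show "E / 2 * b powr (3 / 2) \<le> 2 * pi * (real (npart n) * exp (- b) ^ n / partition_gf b)"
      unfolding W_def P_def d_def .
  qed
qed

section \<open>Comparing the saddle point with its main term\<close>

text \<open>Dividing the deviation, of order \<open>L b\<close>, by the lower bound
  \<open>c b^(3/2)\<close> gives \<open>L / sqrt b\<close>. The approximation of \<open>T\<close>
  itself adds \<open>9 / sqrt b\<close>, and \<open>L \<ge> 1\<close> merges the two.\<close>

lemma expected_summands_approx:
  obtains C b1 where "0 < b1" "b1 \<le> 1" "0 < C"
    "\<And>b n. 0 < b \<Longrightarrow> b \<le> b1 \<Longrightarrow> part_sum_gf b = real n \<Longrightarrow>
      \<bar>expected_summands n - (zeta_const - pi / 4 * ln b) / b\<bar> \<le> C * ((1 - ln b) / sqrt b)"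
proof -
  obtain c b0 where c: "0 < c" "0 < b0" "b0 \<le> 1 / 5"
    and low: "\<And>b n. 0 < b \<Longrightarrow> b \<le> b0 \<Longrightarrow> part_sum_gf b = real n \<Longrightarrow>
      c * b powr (3 / 2) \<le> 2 * pi * (real (npart n) * exp (- b) ^ n / partition_gf b)"
    using npart_lower by blast
  have fr: "0 < far_rate" "0 < near_rate" by (rule rates_pos)+
  have lim: "((\<lambda>b. 2 * pi\<^sup>2 * exp (- far_rate / sqrt b) / b ^ 3) \<longlongrightarrow> 0) (at_right 0)"
    using fr by real_asymp
  have "\<forall>\<^sub>F b in at_right 0. 2 * pi\<^sup>2 * exp (- far_rate / sqrt b) / b ^ 3 < 1"
    by (rule order_tendstoD(2)[OF lim]) simp
  then obtain b2 where b2: "0 < b2" "\<And>b. 0 < b \<Longrightarrow> b < b2 \<Longrightarrow>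
        2 * pi\<^sup>2 * exp (- far_rate / sqrt b) / b ^ 3 < 1"
    unfolding eventually_at_right_field by auto
  define G where "G = 1 / near_rate + 1"
  define H where "H = \<bar>zeta_const\<bar> + 11"
  define C where "C = 4 * G * H / c + 9"
  have pos: "0 < G" "0 < H" "0 < C" using fr c
        by (auto simp: G_def H_def C_def add_pos_pos intro!: add_nonneg_pos divide_nonneg_pos)
  show ?thesis
  proof (rule that[of "min b0 (b2 / 2)" C])
    show "0 < min b0 (b2 / 2)" "min b0 (b2 / 2) \<le> 1" "0 < C" using c b2 pos by auto
    fix b :: real and n :: nat assume b: "0 < b" "b \<le> min b0 (b2 / 2)" and n: "part_sum_gf b
          = real n"
    have b5: "b \<le> b0" "b \<le> 1 / 5" "b < b2" "b \<le> 1" using b c b2 by auto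
    define L where "L = 1 - ln b"
    have L: "1 \<le> L" using b b5 by (simp add: L_def)
    define X where "X = 2 * pi * (exp (- b) ^ n / partition_gf b)"
    define D where "D = part_count_gf b"
    have X: "0 < X" by (simp add: X_def partition_gf_pos)
    have "c * b powr (3 / 2) \<le> 2 * pi * (real (npart n) * exp (- b) ^ n / partition_gf b)"
      by (rule low[OF b(1) b5(1) n])
    also have "\<dots> = real (npart n) * X" by (simp add: X_def)
    finally have pX: "c * b powr (3 / 2) \<le> real (npart n) * X" .
    have cb: "0 < c * b powr (3 / 2)" using c b by simp
    \<comment> \<open>That \<open>n\<close> has a partition at all is read off from the lower bound
      for the integral.\<close>
    then have p: "0 < real (npart n)" using pX X by (metis less_le_trans zero_less_mult_pos2)
    have half: "part_count_gf (b / 2) \<le> 2 * H * L / b"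
    proof -
      have "b / 2 * part_count_gf (b / 2) \<le> zeta_const - pi / 4 * ln (b / 2) + 9 * sqrt (b / 2)"
        using part_count_gf_approx[of "b / 2"] b b5 by (simp add: abs_le_iff)
      also have "ln (b / 2) = ln b - ln 2" using b by (simp add: ln_div)
      also have "sqrt (b / 2) \<le> 1" using b b5 by simp
      also have "zeta_const - pi / 4 * (ln b - ln 2) + 9 * 1 \<le> H * L"
      proof -
        have "zeta_const \<le> \<bar>zeta_const\<bar> * L" using L mult_left_mono[OF L, of "\<bar>zeta_const\<bar>"] by simp
        moreover have "pi / 4 * (ln 2 - ln b) \<le> 1 * L"
        proof (intro mult_mono)
          show "pi / 4 \<le> 1" using pi_less_4 by simp
          show "ln 2 - ln b \<le> L" using ln_2_less_1 by (simp add: L_def)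
          show "0 \<le> ln 2 - ln b" using b b5 by (simp add: ln_le_cancel_iff)
        qed simp
        moreover have "pi / 4 * (ln b - ln 2) = - (pi / 4 * (ln 2 - ln b))"
              by (simp add: algebra_simps)
        moreover have "H * L = \<bar>zeta_const\<bar> * L + 11 * L" by (simp add: H_def algebra_simps)
        ultimately show ?thesis using L by linarith
      qed
      finally have "b / 2 * part_count_gf (b / 2) \<le> H * L" by simp
      then show ?thesis using b by (simp add: field_simps)
    qed
    define R where "R = 2 / b * part_count_gf (b / 2) * (b ^ 3 / near_rate + 2 * pi\<^sup>2 * exp (-
          far_rate / sqrt b))"
    have "\<bar>2 * pi * ((summand_count n - real (npart n) * D) * exp (- b) ^ n / partition_gf b)\<bar> \<le> R"
      unfolding R_def D_def by (rule summand_count_deviation[OF b(1) b5(2)])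
    also have "2 * pi * ((summand_count n - real (npart n) * D) * exp (- b) ^ n / partition_gf b)
        = (summand_count n - real (npart n) * D) * X" by (simp add: X_def)
    finally have dev: "\<bar>summand_count n - real (npart n) * D\<bar> * X \<le> R" using X
          by (simp add: abs_mult)
    have R: "R \<le> 4 * G * H * L * b"
    proof -
      have "2 * pi\<^sup>2 * exp (- far_rate / sqrt b) \<le> b ^ 3"
        using b2(2)[OF b(1) b5(3)] b by (simp add: divide_less_eq)
      then have "b ^ 3 / near_rate + 2 * pi\<^sup>2 * exp (- far_rate / sqrt b) \<le> G * b ^ 3"
        by (simp add: G_def algebra_simps)
      moreover have "0 \<le> b ^ 3 / near_rate + 2 * pi\<^sup>2 * exp (- far_rate / sqrt b)" using b fr
            by simp
      ultimately have "R \<le> 2 / b * (2 * H * L / b) * (G * b ^ 3)"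
        unfolding R_def using half b pos L by (intro mult_mono mult_left_mono) auto
      also have "\<dots> = 4 * G * H * L * b" using b by (simp add: eval_nat_numeral)
      finally show ?thesis .
    qed
    have es: "expected_summands n - D = (summand_count n - real (npart n) * D) * X / (real (npart
          n) * X)"
      using p X by (simp add: expected_summands_eq summand_count_def diff_divide_distrib)
    have "\<bar>expected_summands n - D\<bar> = \<bar>summand_count n - real (npart n) * D\<bar> * X / (real (npart n)
          * X)"
      unfolding es using p X by (simp add: abs_mult)
    also have "\<dots> \<le> (4 * G * H * L * b) / (c * b powr (3 / 2))"
    proof (rule frac_le)
      show "0 \<le> 4 * G * H * L * b" using pos L b by simp
    qed (use dev R pX cb in auto)
    also have "\<dots> = 4 * G * H / c * (L / sqrt b)"
    proof -
      have "b powr (3 / 2) = b powr (1 + 1 / 2)" by simp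
      also have "\<dots> = b * sqrt b" using b by (simp only: powr_add powr_half_sqrt powr_one
            less_imp_le)
      finally show ?thesis using b by simp
    qed
    finally have 1: "\<bar>expected_summands n - D\<bar> \<le> 4 * G * H / c * (L / sqrt b)" .
    have "\<bar>D - (zeta_const - pi / 4 * ln b) / b\<bar> = \<bar>b * D - (zeta_const - pi / 4 * ln b)\<bar> / b"
    proof -
      have "D - (zeta_const - pi / 4 * ln b) / b = (b * D - (zeta_const - pi / 4 * ln b)) / b"
        using b by (simp add: diff_divide_distrib)
      then show ?thesis using b by simp
    qed
    also have "\<dots> \<le> 9 * sqrt b / b"
      using part_count_gf_approx[OF b(1) b5(4)] b unfolding D_def by (intro divide_right_mono) auto
    also have "\<dots> = 9 * (1 / sqrt b)" using b by (simp add: divide_simps)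
    also have "\<dots> \<le> 9 * (L / sqrt b)" using L b by (intro mult_left_mono divide_right_mono) auto
    finally have "\<bar>expected_summands n - (zeta_const - pi / 4 * ln b) / b\<bar>
          \<le> 4 * G * H / c * (L / sqrt b) + 9 * (L / sqrt b)"
      using 1 by linarith
    then show "\<bar>expected_summands n - (zeta_const - pi / 4 * ln b) / b\<bar> \<le> C * ((1 - ln b) / sqrt b)"
      unfolding C_def L_def distrib_right .
  qed
qed

section \<open>Locating the saddle point\<close>

lemma continuous_on_part_sum_gf:
  assumes a: "0 < a"
  shows "continuous_on {a..d} part_sum_gf"
proof -
  have "uniform_limit {a..d} (\<lambda>n b. \<Sum>j<n. real (part_sum j) * exp (- b) ^ j)
      (\<lambda>b. \<Sum>j. real (part_sum j) * exp (- b) ^ j) sequentially"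
  proof (rule Weierstrass_m_test[OF _ summable_part_sum[OF a]])
    fix j and b assume "b \<in> {a..d}"
    then show "norm (real (part_sum j) * exp (- b) ^ j) \<le> real (part_sum j) * exp (- a) ^ j"
      by (auto intro!: mult_left_mono power_mono)
  qed
  then have "continuous_on {a..d} (\<lambda>b. \<Sum>j. real (part_sum j) * exp (- b) ^ j)"
    by (rule uniform_limit_theorem[rotated]) (auto intro!: always_eventually continuous_intros)
  then show ?thesis by (simp add: part_sum_gf_def[abs_def])
qed

text \<open>The solution of the saddle point equation with \<open>part_sum_gf b\<close> replaced by
  its main term. Its inverse is the square root factor of the theorem.\<close>

definition saddle_scale :: "nat \<Rightarrow> real" where
  "saddle_scale n = sqrt (pi / 4 * riemann_zeta 2 / real n)"

text \<open>The intermediate value theorem on \<open>[a, d]\<close>: at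
  \<open>a = sqrt (c / (2 n))\<close> the main term is \<open>2 n\<close> and a relative error of at
  most \<open>1 / 2\<close> leaves at least \<open>n\<close>, while at the fixed point
  \<open>d\<close> the value is below \<open>n\<close> eventually.\<close>

lemma saddle_point_exists:
  assumes b1: "0 < b1"
  obtains C where "0 < C" "\<forall>\<^sub>F n in sequentially. \<exists>b. 0 < b \<and> b \<le> b1 \<and> part_sum_gf b = real n \<and>
    \<bar>b / saddle_scale n - 1\<bar> \<le> 1 / 2 \<and> \<bar>b / saddle_scale n - 1\<bar> \<le> C * sqrt (saddle_scale n)"
proof -
  define c where "c = pi / 4 * riemann_zeta 2"
  define Z where "Z = 17 * zeta_three_halves"
  have c: "0 < c" using riemann_zeta_2_pos by (simp add: c_def)
  have Z: "0 \<le> Z" using zeta_three_halves_nonneg by (simp add: Z_def)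
  have approx: "\<bar>part_sum_gf b * b\<^sup>2 / c - 1\<bar> \<le> Z / c * sqrt b" if b: "0 < b" for b
  proof -
    have "b powr (- 3 / 2) * b\<^sup>2 = b powr (- 3 / 2) * b powr 2" using b by (simp add: powr_numeral)
    also have "\<dots> = b powr (- 3 / 2 + 2)" by (rule powr_add[symmetric])
    also have "\<dots> = sqrt b" using b by (simp add: powr_half_sqrt)
    finally have e: "b powr (- 3 / 2) * b\<^sup>2 = sqrt b" .
    have "part_sum_gf b * b\<^sup>2 / c - 1 = (part_sum_gf b - c / b\<^sup>2) * (b\<^sup>2 / c)"
      using b c by (simp add: field_simps)
    then have "\<bar>part_sum_gf b * b\<^sup>2 / c - 1\<bar> = \<bar>part_sum_gf b - c / b\<^sup>2\<bar> * (b\<^sup>2 / c)"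
      using b c by (simp add: abs_mult)
    also have "\<dots> \<le> (Z * b powr (- 3 / 2)) * (b\<^sup>2 / c)"
      using part_sum_gf_approx[OF b] b c unfolding c_def[symmetric] Z_def
            by (intro mult_right_mono) auto
    also have "\<dots> = Z / c * (b powr (- 3 / 2) * b\<^sup>2)" by simp
    finally show ?thesis unfolding e .
  qed
  \<comment> \<open>Chosen so that the relative error \<open>Z / c * sqrt b\<close> is at most
    \<open>1 / 2\<close> up to \<open>d\<close>; the added 1 covers \<open>Z = 0\<close>.\<close>
  define d where "d = min b1 ((c / (2 * (Z + 1)))\<^sup>2)"
  have d: "0 < d" "d \<le> b1" using b1 c Z by (auto simp: d_def)
  have small: "Z / c * sqrt b \<le> 1 / 2" if "0 < b" "b \<le> d" for b
  proof -
    have "sqrt b \<le> c / (2 * (Z + 1))" using that c Z by (intro real_le_lsqrt) (auto simp: d_def)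
    then have "Z / c * sqrt b \<le> Z / c * (c / (2 * (Z + 1)))" using c Z
          by (intro mult_left_mono) auto
    also have "\<dots> \<le> 1 / 2" using c Z by (simp add: field_simps)
    finally show ?thesis .
  qed
  define C where "C = 2 * (Z / c + 1)"
  have C: "0 < C" using Z c by (simp add: C_def add_nonneg_pos)
  have "(\<lambda>n. sqrt (c / (2 * real n))) \<longlonglongrightarrow> 0" using c by real_asymp
  then have "\<forall>\<^sub>F n in sequentially. sqrt (c / (2 * real n)) < d" using d
        by (intro order_tendstoD(2)) auto
  moreover have "\<forall>\<^sub>F n in sequentially. part_sum_gf d \<le> real n" by real_asymp
  moreover have "\<forall>\<^sub>F n in sequentially. (0::nat) < n" by (rule eventually_gt_at_top)
  ultimately have "\<forall>\<^sub>F n in sequentially. \<exists>b. 0 < b \<and> b \<le> b1 \<and> part_sum_gf b = real n \<and>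
    \<bar>b / saddle_scale n - 1\<bar> \<le> 1 / 2 \<and> \<bar>b / saddle_scale n - 1\<bar> \<le> C * sqrt (saddle_scale n)"
  proof eventually_elim
    case (elim n)
    define a where "a = sqrt (c / (2 * real n))"
    have a: "0 < a" "a \<le> d" "a\<^sup>2 = c / (2 * real n)" using elim c by (auto simp: a_def)
    have "\<bar>part_sum_gf a * a\<^sup>2 / c - 1\<bar> \<le> 1 / 2" using approx[OF a(1)] small[OF a(1,2)] by linarith
    then have "1 / 2 \<le> part_sum_gf a * a\<^sup>2 / c" by linarith
    then have "real n \<le> part_sum_gf a" unfolding a(3) using c elim by (simp add: field_simps)
    then obtain b where b: "a \<le> b" "b \<le> d" "part_sum_gf b = real n"
      using IVT2'[of part_sum_gf d "real n" a] elim a continuous_on_part_sum_gf[OF a(1)] by blast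
    have b0: "0 < b" using a b by simp
    define B where "B = saddle_scale n"
    have B: "0 < B" "B\<^sup>2 = c / real n" using c elim by (auto simp: B_def saddle_scale_def c_def)
    define x where "x = b / B"
    have x0: "0 < x" using b0 B by (simp add: x_def)
    \<comment> \<open>Because \<open>b\<close> solves the equation exactly, \<open>x^2\<close> is
      the quotient of \<open>part_sum_gf b\<close> by its main term, and \<open>x + 1 > 1\<close>
      transfers the error from \<open>x^2\<close> to \<open>x\<close>.\<close>
    have "x\<^sup>2 = part_sum_gf b * b\<^sup>2 / c" unfolding x_def power_divide B(2) using elim
          by (simp add: b(3))
    then have x2: "\<bar>x\<^sup>2 - 1\<bar> \<le> Z / c * sqrt b" using approx[OF b0] by simp
    have "x\<^sup>2 - 1 = (x - 1) * (x + 1)" by (simp add: power2_eq_square algebra_simps)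
    then have "\<bar>x\<^sup>2 - 1\<bar> = \<bar>x - 1\<bar> * (x + 1)" using x0 by (simp add: abs_mult)
    moreover have "\<bar>x - 1\<bar> * 1 \<le> \<bar>x - 1\<bar> * (x + 1)" using x0 by (intro mult_left_mono) auto
    ultimately have "\<bar>x - 1\<bar> \<le> \<bar>x\<^sup>2 - 1\<bar>" by simp
    then have x1: "\<bar>x - 1\<bar> \<le> Z / c * sqrt b" using x2 by linarith
    then have xh: "\<bar>x - 1\<bar> \<le> 1 / 2" using small[OF b0 b(2)] by linarith
    then have "x \<le> 4" by linarith
    then have "b \<le> 4 * B" using B by (simp add: x_def field_simps)
    then have "sqrt b \<le> sqrt (4 * B)" by simp
    also have "\<dots> = 2 * sqrt B" by (simp add: real_sqrt_mult)
    finally have "Z / c * sqrt b \<le> Z / c * (2 * sqrt B)" using Z c by (intro mult_left_mono) auto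
    also have "\<dots> \<le> C * sqrt B" using B by (simp add: C_def algebra_simps)
    finally have "\<bar>x - 1\<bar> \<le> C * sqrt B" using x1 by linarith
    then show ?case using b b0 d xh unfolding x_def B_def by (intro exI[of _ b]) auto
  qed
  with C show ?thesis by (rule that)
qed

text \<open>Writing \<open>b = x B\<close>, the change is governed by \<open>1 / x - 1\<close> and
  \<open>ln x / x\<close>, both \<open>O(\<bar>x - 1\<bar>)\<close> since
  \<open>x \<ge> 1 / 2\<close>. The factor \<open>1 - ln B\<close> is kept explicit so that it can
  cancel against the main term.\<close>

lemma main_term_shift:
  fixes K b B :: real
  assumes B: "0 < B" "B \<le> 1" and x: "\<bar>b / B - 1\<bar> \<le> 1 / 2"
  shows "\<bar>(K - pi / 4 * ln b) / b - (K - pi / 4 * ln B) / B\<bar> \<le> (2 * \<bar>K\<bar> + 6) * (1 - ln B) * \<bar>b / B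
        - 1\<bar> / B"
proof -
  define x where "x = b / B"
  define y where "y = \<bar>x - 1\<bar>"
  have "\<bar>x - 1\<bar> \<le> 1 / 2" using x by (simp only: x_def)
  then have x1: "1 / 2 \<le> x" "y \<le> 1 / 2" unfolding y_def by linarith+
  have x0: "0 < x" and b: "b = x * B" using x1 B by (auto simp: x_def)
  have l: "0 \<le> - ln B" using B by simp
  have inv: "\<bar>1 / x - 1\<bar> \<le> 2 * y"
  proof -
    have "1 / x - 1 = (1 - x) / x" using x0 by (simp add: field_simps)
    then have "\<bar>1 / x - 1\<bar> = y / x" using x0 by (simp add: y_def abs_minus_commute)
    also have "\<dots> \<le> y / (1 / 2)" using x1 by (intro divide_left_mono) (auto simp: y_def)
    finally show ?thesis by simp
  qed
  have lnx: "\<bar>ln x\<bar> \<le> 2 * y"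
  proof -
    have "ln x \<le> x - 1" using x0 by (rule ln_le_minus_one)
    moreover have "ln (1 / x) \<le> 1 / x - 1" using x0 by (intro ln_le_minus_one) auto
    moreover have "ln (1 / x) = - ln x" using x0 by (simp add: ln_div)
    moreover have "x - 1 \<le> y" "0 \<le> y" by (auto simp: y_def)
    ultimately show ?thesis using inv by (simp add: abs_le_iff)
  qed
  have lnxx: "\<bar>ln x / x\<bar> \<le> 4 * y"
  proof -
    have "\<bar>ln x / x\<bar> = \<bar>ln x\<bar> / x" using x0 by simp
    also have "\<dots> \<le> (2 * y) / (1 / 2)" using lnx x1 by (intro frac_le) (auto simp: y_def)
    finally show ?thesis by simp
  qed
  have "(K - pi / 4 * ln b) / b - (K - pi / 4 * ln B) / B = ((1 / x - 1) * (K - pi / 4 * ln B)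
        - pi / 4 * (ln x / x)) / B"
    unfolding b using x0 B by (simp add: ln_mult field_simps)
  then have "\<bar>(K - pi / 4 * ln b) / b - (K - pi / 4 * ln B) / B\<bar>
        = \<bar>(1 / x - 1) * (K - pi / 4 * ln B) - pi / 4 * (ln x / x)\<bar> / B"
    using B by simp
  also have "\<dots> \<le> ((2 * \<bar>K\<bar> + 6) * (1 - ln B) * y) / B"
  proof (intro divide_right_mono)
    have p4: "pi / 4 \<le> 1" using pi_less_4 by simp
    have "\<bar>K - pi / 4 * ln B\<bar> \<le> \<bar>K\<bar> + (- ln B)"
    proof -
      have "\<bar>pi / 4 * ln B\<bar> \<le> 1 * (- ln B)" unfolding abs_mult using l p4 by (intro mult_mono) auto
      then show ?thesis by linarith
    qed
    then have 1: "\<bar>(1 / x - 1) * (K - pi / 4 * ln B)\<bar> \<le> (2 * y) * (\<bar>K\<bar> + (- ln B))"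
      unfolding abs_mult using inv by (intro mult_mono) (auto simp: y_def)
    have 2: "\<bar>pi / 4 * (ln x / x)\<bar> \<le> 1 * (4 * y)"
      unfolding abs_mult[of "pi / 4"] using lnxx p4 by (intro mult_mono) auto
    have y0: "0 \<le> y" by (simp add: y_def)
    have "(2 * \<bar>K\<bar> + 6) * (1 - ln B) * y - ((2 * y) * (\<bar>K\<bar> + (- ln B)) + 1 * (4 * y))
          = (2 * \<bar>K\<bar> * (- ln B) + 4 * (- ln B) + 2) * y"
      by (simp add: algebra_simps)
    moreover have "0 \<le> (2 * \<bar>K\<bar> * (- ln B) + 4 * (- ln B) + 2) * y" using l y0
          by (intro mult_nonneg_nonneg add_nonneg_nonneg) auto
    ultimately show "\<bar>(1 / x - 1) * (K - pi / 4 * ln B) - pi / 4 * (ln x / x)\<bar>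
          \<le> (2 * \<bar>K\<bar> + 6) * (1 - ln B) * y"
      using 1 2 by linarith
  qed (use B in simp)
  finally show ?thesis by (simp add: y_def x_def)
qed

theorem corollary16:
  "\<exists>\<epsilon> :: nat \<Rightarrow> real.
     \<epsilon> \<in> O(\<lambda>n. real n powr (- 1 / 4)) \<and>
     (\<forall>\<^sub>F n in sequentially.
        complex_of_real (expected_summands n) =
          complex_of_real ((4 * real n / (pi * riemann_zeta 2)) powr (1 / 2)) *
          (finite_part epstein_zeta 1 -
             complex_of_real (pi / 8 * ln (pi * riemann_zeta 2 / (4 * real n)))) *
          complex_of_real (1 + \<epsilon> n))"
proof -
  define K where "K = zeta_const"
  define B where "B = saddle_scale"
  \<comment> \<open>The main term of the theorem in terms of \<open>B n\<close>: the square root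
    factor is \<open>1 / B n\<close>, and the logarithm there is \<open>2 * ln (B n)\<close>, whence
    \<open>pi / 4\<close> for \<open>pi / 8\<close>.\<close>
  define H where "H = (\<lambda>n. (K - pi / 4 * ln (B n)) / B n)"
  define \<epsilon> where "\<epsilon> = (\<lambda>n. expected_summands n / H n - 1)"
  define c where "c = pi / 4 * riemann_zeta 2"
  have c: "0 < c" using riemann_zeta_2_pos by (simp add: c_def)
  obtain C b1 where b1: "0 < b1" "b1 \<le> 1" and C: "0 < C"
    and approx: "\<And>b n. 0 < b \<Longrightarrow> b \<le> b1 \<Longrightarrow> part_sum_gf b = real n \<Longrightarrow>
      \<bar>expected_summands n - (K - pi / 4 * ln b) / b\<bar> \<le> C * ((1 - ln b) / sqrt b)"
    by (rule expected_summands_approx[folded K_def]) (rule that)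
  obtain C' where C': "0 < C'" and saddle: "\<forall>\<^sub>F n in sequentially. \<exists>b. 0 < b \<and> b \<le> b1 \<and>
        part_sum_gf b = real n \<and>
    \<bar>b / B n - 1\<bar> \<le> 1 / 2 \<and> \<bar>b / B n - 1\<bar> \<le> C' * sqrt (B n)"
    by (rule saddle_point_exists[OF b1(1), folded B_def]) (rule that)
  have Blim: "B \<longlonglongrightarrow> 0" unfolding B_def saddle_scale_def c_def[symmetric] using c by real_asymp
  \<comment> \<open>Below this bound \<open>- ln (B n)\<close> outweighs \<open>K\<close> whatever
    its sign, so the main term is positive and at least \<open>L / 2 / B n\<close>.\<close>
  define M where "M = exp (- 10 * (\<bar>K\<bar> + 1))"
  have "0 < M" "M \<le> 1" by (auto simp: M_def)
  with Blim have Bsmall: "\<forall>\<^sub>F n in sequentially. B n < M" by (intro order_tendstoD(2)) auto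
  have npos: "\<forall>\<^sub>F n in sequentially. (0::nat) < n" by (rule eventually_gt_at_top)
  define Q where "Q = 2 * (4 * C + (2 * \<bar>K\<bar> + 6) * C')"
  have key: "\<forall>\<^sub>F n in sequentially. 0 < H n \<and> \<bar>\<epsilon> n\<bar> \<le> Q * sqrt (B n)"
    using saddle Bsmall npos
  proof eventually_elim
    case (elim n)
    then obtain b where b: "0 < b" "b \<le> b1" "part_sum_gf b = real n"
      "\<bar>b / B n - 1\<bar> \<le> 1 / 2" "\<bar>b / B n - 1\<bar> \<le> C' * sqrt (B n)" by blast
    have "0 < B n" using elim(3) c by (simp add: B_def saddle_scale_def c_def)
    moreover have "B n \<le> 1" using elim(2) \<open>M \<le> 1\<close> by linarith
    ultimately have B: "0 < B n" "B n \<le> 1" .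
    define L where "L = 1 - ln (B n)"
    have "ln (B n) \<le> ln M" using elim B by (intro ln_mono) auto
    then have lnB: "ln (B n) \<le> - 10 * (\<bar>K\<bar> + 1)" by (simp add: M_def)
    then have L1: "1 \<le> L" by (simp add: L_def)
    have "L / 2 \<le> K - pi / 4 * ln (B n)"
    proof -
      have "0.7 * (- ln (B n)) \<le> pi / 4 * (- ln (B n))"
        using lnB pi_approx by (intro mult_right_mono) auto
      then show ?thesis using lnB unfolding L_def by simp
    qed
    then have Hlow: "L / 2 / B n \<le> H n" unfolding H_def using B by (intro divide_right_mono) auto
    moreover have "0 < L / 2 / B n" using L1 B by simp
    ultimately have H0: "0 < H n" by linarith
    have bB: "B n / 2 \<le> b" 
    proof -
      have "1 / 2 \<le> b / B n" using b(4) unfolding abs_le_iff by linarith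
      then show ?thesis using B by (simp add: field_simps)
    qed
    have "\<bar>expected_summands n - (K - pi / 4 * ln b) / b\<bar> \<le> C * ((1 - ln b) / sqrt b)"
      by (rule approx[OF b(1-3)])
    also have "\<dots> \<le> C * (4 * L / sqrt (B n))"
    proof (intro mult_left_mono)
      have "ln (B n / 2) \<le> ln b" using bB B by (intro ln_mono) auto
      then have "ln (B n) - ln 2 \<le> ln b" using B by (simp add: ln_div)
      moreover have "ln 2 < (1 :: real)" by (rule ln_2_less_1)
      moreover have "ln (B n) \<le> 0" using B by simp
      ultimately have "1 - ln b \<le> 2 * L" unfolding L_def right_diff_distrib by linarith
      moreover have "sqrt (B n) / 2 \<le> sqrt b"
      proof -
        have "sqrt (B n) / 2 = sqrt (B n / 4)" by (simp add: real_sqrt_divide)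
        also have "\<dots> \<le> sqrt b" using bB B by simp
        finally show ?thesis .
      qed
      ultimately have "(1 - ln b) / sqrt b \<le> (2 * L) / (sqrt (B n) / 2)"
        using b B b1 L1 by (intro frac_le) auto
      then show "(1 - ln b) / sqrt b \<le> 4 * L / sqrt (B n)" by simp
    qed (use C in simp)
    finally have 1: "\<bar>expected_summands n - (K - pi / 4 * ln b) / b\<bar> \<le> 4 * C * L / sqrt (B n)"
          by (simp add: mult_ac)
    have "\<bar>(K - pi / 4 * ln b) / b - H n\<bar> \<le> (2 * \<bar>K\<bar> + 6) * L * \<bar>b / B n - 1\<bar> / B n"
      unfolding H_def L_def by (rule main_term_shift[OF B b(4)])
    also have "\<dots> \<le> (2 * \<bar>K\<bar> + 6) * L * (C' * sqrt (B n)) / B n"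
      using b(5) L1 B by (intro divide_right_mono mult_left_mono) auto
    also have "\<dots> = (2 * \<bar>K\<bar> + 6) * C' * L / sqrt (B n)"
      using B by (simp add: divide_simps)
    finally have "\<bar>expected_summands n - H n\<bar> \<le> 4 * C * L / sqrt (B n) + (2 * \<bar>K\<bar> + 6) * C' * L /
          sqrt (B n)"
      using 1 by linarith
    \<comment> \<open>Both errors carry \<open>L / sqrt (B n)\<close>. Measured against
      \<open>L / 2 / B n\<close> the logarithm disappears and \<open>sqrt (B n)\<close>, of order
      \<open>n powr (- 1 / 4)\<close>, remains.\<close>
    also have "\<dots> = Q * sqrt (B n) * (L / 2 / B n)"
    proof -
      define r where "r = sqrt (B n)"
      have r: "0 < r" "B n = r * r" using B by (auto simp: r_def)
      have "u * L / r + w * L / r = 2 * (u + w) * r * (L / 2 / (r * r))" for u w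
        using r(1) by (simp add: field_simps)
      then show ?thesis unfolding Q_def r_def[symmetric] unfolding r(2) by blast
    qed
    also have "\<dots> \<le> Q * sqrt (B n) * H n"
      using Hlow B C C' by (intro mult_left_mono) (auto simp: Q_def)
    finally have "\<bar>expected_summands n - H n\<bar> \<le> Q * sqrt (B n) * H n" .
    moreover have "\<epsilon> n = (expected_summands n - H n) / H n" using H0
          by (simp add: \<epsilon>_def diff_divide_distrib)
    ultimately have "\<bar>\<epsilon> n\<bar> \<le> Q * sqrt (B n)" using H0 by (simp add: divide_le_eq)
    with H0 show ?case by simp
  qed
  have "\<epsilon> \<in> O(\<lambda>n. real n powr (- 1 / 4))"
  proof (rule bigoI[of _ "Q * sqrt (sqrt c)"])
    show "\<forall>\<^sub>F n in sequentially. norm (\<epsilon> n) \<le> Q * sqrt (sqrt c) * norm (real n powr (- 1 / 4))"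
      using key npos
    proof eventually_elim
      case (elim n)
      have "sqrt (B n) = sqrt (sqrt c) * (1 / sqrt (sqrt (real n)))"
        by (simp add: B_def saddle_scale_def c_def real_sqrt_divide real_sqrt_mult)
      moreover have "real n powr (- 1 / 4) = 1 / sqrt (sqrt (real n))"
      proof -
        have "sqrt (sqrt (real n)) = (real n powr (1 / 2)) powr (1 / 2)"
              by (simp add: powr_half_sqrt)
        also have "\<dots> = real n powr (1 / 4)" by (simp add: powr_powr)
        finally show ?thesis by (simp add: powr_minus_divide)
      qed
      ultimately have "sqrt (B n) = sqrt (sqrt c) * (real n powr (- 1 / 4))" by simp
      with elim show ?case by (simp add: mult_ac)
    qed
  qed
  moreover have "\<forall>\<^sub>F n in sequentially.
        complex_of_real (expected_summands n) =
          complex_of_real ((4 * real n / (pi * riemann_zeta 2)) powr (1 / 2)) *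
          (finite_part epstein_zeta 1 -
             complex_of_real (pi / 8 * ln (pi * riemann_zeta 2 / (4 * real n)))) *
          complex_of_real (1 + \<epsilon> n)"
    using key npos
  proof eventually_elim
    case (elim n)
    have B2: "B n = sqrt (c / real n)" by (simp add: B_def saddle_scale_def c_def)
    have cn: "0 < c / real n" using c elim by simp
    have "(4 * real n / (pi * riemann_zeta 2)) powr (1 / 2) = sqrt (1 / (c / real n))"
      using c elim riemann_zeta_2_pos by (simp add: powr_half_sqrt c_def)
    then have e1: "(4 * real n / (pi * riemann_zeta 2)) powr (1 / 2) = 1 / B n"
      by (simp add: B2 real_sqrt_divide)
    have "pi * riemann_zeta 2 / (4 * real n) = c / real n" by (simp add: c_def)
    moreover have "ln (c / real n) = 2 * ln (B n)" unfolding B2 using cn by (simp add: ln_sqrt)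
    ultimately have e2: "pi / 8 * ln (pi * riemann_zeta 2 / (4 * real n)) = pi / 4 * ln (B n)"
          by simp
    have "expected_summands n = H n * (1 + \<epsilon> n)" using elim by (simp add: \<epsilon>_def)
    also have "H n = 1 / B n * (K - pi / 4 * ln (B n))" by (simp add: H_def)
    finally have "complex_of_real (expected_summands n) =
        complex_of_real (1 / B n * (K - pi / 4 * ln (B n)) * (1 + \<epsilon> n))" by (rule arg_cong)
    then show ?case unfolding e1 e2 finite_part_epstein_zeta K_def
          by (simp only: of_real_mult of_real_diff)
  qed
  ultimately show ?thesis by blast
qed

end
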